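(* Let $A\in\mathbb{C}^{n\times n}$ be Hermitian, $\vec b\in\mathbb{C}^n$ nonzero, $k,m,s\in\mathbb{N}$ positive, $M=k+sm$. Let $\vec\theta_M=[\theta_0,\dots,\theta_{M-1}]\subset\overline{\mathbb{C}}$ (outer poles) be a list closed under complex conjugation, with $\theta_0=\infty$ and $\theta_{k+im}=\infty$ for $i=1,\dots,s-1$, and let $\vec\xi_k=[\xi_0,\dots,\xi_{k-1}]\subset\overline{\mathbb{C}}$ (inner poles) be a list closed under complex conjugation. Let $f$ be a function analytic on $\mathbb{W}(A)$, let $\vec y_s$ be the final vector computed (in exact arithmetic, without breakdown) by the RK-compressed rational Lanczos algorithm with $s$ cycles (described in the context) applied to $f$, $A$, $\vec b$ with inner poles $\vec\xi_k$ and outer poles $\vec\theta_M$, and let $\widehat{\vec y}=\mathbf{Q}_Mf(\mathbf{T}_M)\vec e_1\|\vec b\|_2$ be the approximation to $f(A)\vec b$ computed by the rational Lanczos algorithm. Then $$\|\widehat{\vec y}-\vec y_s\|_2\le 4(s-1)\,\|\vec b\|_2\,\min_{r\in\Pi_{k-1}/q}\|f-r\|_{\mathbb{W}(A)},$$ where $q(x)=\prod_{\xi\in\vec\xi_k,\ \xi\neq\infty}(x-\xi)$.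
   Context: Notation: $\overline{\mathbb{C}}=\mathbb{C}\cup\{\infty\}$; $\Pi_j$ is the set of polynomials of degree at most $j$; $\Pi_{k-1}/q=\{p/q:\ p\in\Pi_{k-1}\}$; $\vec e_1$ is the first unit vector of the appropriate size. $\mathbb{W}(A)=\{\vec x^HA\vec x:\|\vec x\|_2=1\}$ is the field of values (for Hermitian $A$, the convex hull of the spectrum). $\|g\|_{\mathcal{S}}$ is the supremum norm of $g$ on $\mathcal{S}$ (equal to $+\infty$ if $g$ has a pole in $\mathcal{S}$). Functions of Hermitian matrices are defined through an eigendecomposition. Rational Krylov subspace: for a square matrix $N$, a vector $\vec c$ and a list $\vec\zeta_\ell=[\zeta_0,\dots,\zeta_{\ell-1}]\subset\overline{\mathbb{C}}$ of poles none of which is an eigenvalue of $N$, $$\mathcal{Q}(N,\vec c,\vec\zeta_\ell)=\{q(N)^{-1}p(N)\vec c:\ p\in\Pi_{\ell-1}\},\qquad q(x)=\prod_{\zeta\in\vec\zeta_\ell,\ \zeta\ne\infty}(x-\zeta).$$ Rational Lanczos basis: put $\vec\theta_\ell=[\theta_0,\dots,\theta_{\ell-1}]$ and assume no breakdown, i.e. $\dim\mathcal{Q}(A,\vec b,\vec\theta_M)=M$. The rational Lanczos algorithm produces orthonormal vectors $\vec q_1,\dots,\vec q_M$, with $\vec q_1=\vec b/\|\vec b\|_2$ (since $\theta_0=\infty$), such that for each $\ell\le M$ the matrix $\mathbf{Q}_\ell=[\vec q_1,\dots,\vec q_\ell]$ is an orthonormal basis of $\mathcal{Q}(A,\vec b,\vec\theta_\ell)$.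 Put $\mathbf{T}_\ell=\mathbf{Q}_\ell^HA\mathbf{Q}_\ell$. Block splitting: write $\mathbf{Q}_M=[Q_1\ Q_2\ \cdots\ Q_s]$ with $Q_1\in\mathbb{C}^{n\times(k+m)}$ and $Q_i\in\mathbb{C}^{n\times m}$ for $i\ge2$; let $T_i=Q_i^HAQ_i$. Because $\theta_{k+im}=\infty$ for $1\le i\le s-1$, $\mathbf{T}_M$ is block tridiagonal with respect to this splitting, and its off-diagonal block in position $(i,i+1)$ is $Q_i^HAQ_{i+1}=\vec b_i\vec e_1^H$, where $\vec b_i:=Q_i^HA\vec q_{k+im+1}$. The RK-compressed rational Lanczos algorithm (for a function $f$, inner poles $\vec\xi_k$, outer poles $\vec\theta_M$): - First cycle: set $V_1=Q_1$, $S_1=T_1$, $\vec v_1=\vec e_1\|\vec b\|_2\in\mathbb{C}^{k+m}$, $\widetilde{\vec b}_1=\vec b_1$, and $\vec y_1=Q_1f(T_1)\vec e_1\|\vec b\|_2$. - For $i=2,\dots,s$: let $U_{i-1}$ be a matrix whose columns form an orthonormal basis of $\mathcal{Q}(S_{i-1},\widetilde{\vec b}_{i-1},\vec\xi_k)$; set $$\vec w_{i-1}=-V_{i-1}U_{i-1}f(U_{i-1}^HS_{i-1}U_{i-1})U_{i-1}^H\vec v_{i-1},$$ $$V_i=[V_{i-1}U_{i-1}\ \ Q_i],\quad \vec v_i=\begin{bmatrix}U_{i-1}^H\vec v_{i-1}\\ 0\end{bmatrix},\quad S_i=\begin{bmatrix}U_{i-1}^HS_{i-1}U_{i-1}&U_{i-1}^H\widetilde{\vec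 b}_{i-1}\vec e_1^H\\ \vec e_1\widetilde{\vec b}_{i-1}^HU_{i-1}&T_i\end{bmatrix},\quad \widetilde{\vec b}_i=\begin{bmatrix}0\\ \vec b_i\end{bmatrix}\ (i<s),$$ $$\vec y_i=\vec y_{i-1}+\vec w_{i-1}+V_if(S_i)\vec v_i.$$ It is implicitly assumed that all rational Krylov subspaces are well defined: outer poles are not eigenvalues of $A$ and inner poles are not eigenvalues of the matrices $S_i$. *)

theory Defs
  imports
    "HOL-Complex_Analysis.Complex_Analysis"
    "HOL-Library.Multiset"
    "Jordan_Normal_Form.Schur_Decomposition"
begin

no_notation Finite_Cartesian_Product.vec_nth (infixl \<open>$\<close> 90)

section \<open>Vectors and matrices\<close>

definition norm2 :: "complex vec \<Rightarrow> real" where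
  "norm2 v = L2_set (\<lambda>i. cmod (v $ i)) {..<dim_vec v}"

definition hermitian :: "complex mat \<Rightarrow> bool" where
  "hermitian A \<longleftrightarrow> A \<in> carrier_mat (dim_row A) (dim_row A) \<and> mat_adjoint A = A"

definition field_of_values :: "complex mat \<Rightarrow> complex set" where
  "field_of_values A = {(A *\<^sub>v x) \<bullet>c x |x. x \<in> carrier_vec (dim_row A) \<and> norm2 x = 1}"

text \<open>The rank-one matrix \<open>u v\<^sup>H\<close>.\<close>

definition outer_prod :: "complex vec \<Rightarrow> complex vec \<Rightarrow> complex mat" where
  "outer_prod u v = mat (dim_vec u) (dim_vec v) (\<lambda>(i, j). u $ i * cnj (v $ j))"

text \<open>Columns \<open>c, \<dots>, d - 1\<close> (counted from \<open>0\<close>) of a matrix.\<close>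

definition col_range :: "complex mat \<Rightarrow> nat \<Rightarrow> nat \<Rightarrow> complex mat" where
  "col_range B c d = mat_of_cols (dim_row B) (map (col B) [c..<d])"

definition join_cols :: "complex mat \<Rightarrow> complex mat \<Rightarrow> complex mat" where
  "join_cols B C = mat_of_cols (dim_row B) (cols B @ cols C)"

definition orthonormal_basis_matrix :: "complex mat \<Rightarrow> complex vec set \<Rightarrow> bool" where
  "orthonormal_basis_matrix U W \<longleftrightarrow>
     mat_adjoint U * U = 1\<^sub>m (dim_col U) \<and> vec_space.col_space (dim_row U) U = W"

definition poly_mat :: "complex poly \<Rightarrow> complex mat \<Rightarrow> complex mat" where
  "poly_mat p N =
     mat (dim_row N) (dim_row N) (\<lambda>(i, j). \<Sum>d\<le>degree p. coeff p d * (N ^\<^sub>m d) $$ (i, j))"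

text \<open>
  Functions of Hermitian matrices through an eigendecomposition \<open>H = W D W\<^sup>H\<close> with \<open>W\<close> unitary.
  The value does not depend on the decomposition chosen.
\<close>

definition mat_fun :: "(complex \<Rightarrow> complex) \<Rightarrow> complex mat \<Rightarrow> complex mat" where
  "mat_fun f H = (SOME F. \<exists>W d.
     W \<in> carrier_mat (dim_row H) (dim_row H) \<and> mat_adjoint W * W = 1\<^sub>m (dim_row H) \<and>
     H = W * mat_diag (dim_row H) d * mat_adjoint W \<and>
     F = W * mat_diag (dim_row H) (\<lambda>i. f (d i)) * mat_adjoint W)"

section \<open>Poles and rational Krylov subspaces\<close>

text \<open>A pole is a point of the extended complex plane; \<open>None\<close> is the point at infinity.\<close>

type_synonym pole = "complex option"

text \<open>Pole lists carry multiplicities, so closedness under conjugation is a statement on multisets.\<close>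

definition cnj_closed :: "pole list \<Rightarrow> bool" where
  "cnj_closed \<zeta>s \<longleftrightarrow> mset (map (map_option cnj) \<zeta>s) = mset \<zeta>s"

definition pole_poly :: "pole list \<Rightarrow> complex poly" where
  "pole_poly \<zeta>s = prod_list (map (\<lambda>\<zeta>. case \<zeta> of None \<Rightarrow> 1 | Some z \<Rightarrow> [:- z, 1:]) \<zeta>s)"

text \<open>No finite pole is an eigenvalue, so that \<open>q(N)\<close> is invertible.\<close>

definition poles_admissible :: "complex mat \<Rightarrow> pole list \<Rightarrow> bool" where
  "poles_admissible N \<zeta>s \<longleftrightarrow> (\<forall>z. Some z \<in> set \<zeta>s \<longrightarrow> \<not> eigenvalue N z)"

text \<open>
  For a nonempty list of \<open>l\<close> poles, \<open>degree p < l\<close> is membership in \<open>\<Pi>\<close> with index \<open>l - 1\<close>, the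
  zero polynomial included. The definition is only meant for \<open>poles_admissible N \<zeta>s\<close>.
\<close>

definition rational_krylov :: "complex mat \<Rightarrow> complex vec \<Rightarrow> pole list \<Rightarrow> complex vec set" where
  "rational_krylov N c \<zeta>s =
     {the (mat_inverse (poly_mat (pole_poly \<zeta>s) N)) *\<^sub>v (poly_mat p N *\<^sub>v c) |p.
        degree p < length \<zeta>s}"

text \<open>The space \<open>\<Pi>\<^bsub>k-1\<^esub>/q\<close> for the denominator \<open>q\<close> of the pole list.\<close>

definition rational_functions :: "nat \<Rightarrow> pole list \<Rightarrow> (complex \<Rightarrow> complex) set" where
  "rational_functions k \<zeta>s = {\<lambda>x. poly p x / poly (pole_poly \<zeta>s) x |p. degree p < k}"

text \<open>
  Supremum norm of a meromorphic function. Division by zero yields \<open>0\<close> in HOL, so at a zero of \<open>q\<close>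
  the value of \<open>p/q\<close> is not meaningful; \<open>remove_sings\<close> restores it where \<open>p\<close> cancels the zero, and
  a genuine pole contributes \<open>\<infinity>\<close>.
\<close>

definition sup_norm_on :: "complex set \<Rightarrow> (complex \<Rightarrow> complex) \<Rightarrow> ereal" where
  "sup_norm_on X g = (SUP x\<in>X. if is_pole g x then \<infinity> else ereal (cmod (remove_sings g x)))"

section \<open>Rational Lanczos\<close>

text \<open>
  Output of the rational Lanczos algorithm. That \<open>Q\<close> has \<open>length \<theta>s\<close> orthonormal columns spanning the
  full Krylov space includes the absence of breakdown. The vectors are determined up to unimodular
  factors, hence a predicate.
\<close>

definition rational_lanczos_basis ::
  "complex mat \<Rightarrow> complex vec \<Rightarrow> pole list \<Rightarrow> complex mat \<Rightarrow> bool" where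
  "rational_lanczos_basis A b \<theta>s Q \<longleftrightarrow>
     Q \<in> carrier_mat (dim_row A) (length \<theta>s) \<and>
     col Q 0 = complex_of_real (1 / norm2 b) \<cdot>\<^sub>v b \<and>
     (\<forall>l\<in>{1..length \<theta>s}.
        orthonormal_basis_matrix (col_range Q 0 l) (rational_krylov A b (take l \<theta>s)))"

definition compress :: "complex mat \<Rightarrow> complex mat \<Rightarrow> complex mat" where
  "compress U N = mat_adjoint U * N * U"

text \<open>\<open>\<parallel>b\<parallel> e\<^sub>1\<close> of size \<open>d\<close>\<close>

definition start_vec :: "complex vec \<Rightarrow> nat \<Rightarrow> complex vec" where
  "start_vec b d = complex_of_real (norm2 b) \<cdot>\<^sub>v unit_vec d 0"

definition rational_lanczos_approx ::
  "(complex \<Rightarrow> complex) \<Rightarrow> complex mat \<Rightarrow> complex vec \<Rightarrow> complex mat \<Rightarrow> complex vec" where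
  "rational_lanczos_approx f A b Q =
     Q *\<^sub>v (mat_fun f (compress Q A) *\<^sub>v start_vec b (dim_col Q))"

section \<open>RK-compressed rational Lanczos\<close>

text \<open>
  The blocks \<open>Q\<^sub>1\<close> (\<open>k + m\<close> columns) and \<open>Q\<^sub>i\<close>, \<open>i \<ge> 2\<close> (\<open>m\<close> columns), numbered from \<open>1\<close>. Columns are
  numbered from \<open>0\<close>, so \<open>col Q (k + i * m)\<close> is the vector \<open>q\<^bsub>k+im+1\<^esub>\<close>, the first column of block
  \<open>i + 1\<close>.
\<close>

definition lanczos_block :: "nat \<Rightarrow> nat \<Rightarrow> complex mat \<Rightarrow> nat \<Rightarrow> complex mat" where
  "lanczos_block k m Q i = col_range Q (if i = 1 then 0 else k + (i - 1) * m) (k + i * m)"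

definition coupling_vec ::
  "complex mat \<Rightarrow> nat \<Rightarrow> nat \<Rightarrow> complex mat \<Rightarrow> nat \<Rightarrow> complex vec" where
  "coupling_vec A k m Q i =
     mat_adjoint (lanczos_block k m Q i) *\<^sub>v (A *\<^sub>v col Q (k + i * m))"

text \<open>
  A run of the algorithm with \<open>s\<close> cycles: the sequences are the quantities computed in cycle \<open>i\<close>,
  for \<open>1 \<le> i \<le> s\<close>, with \<open>bt i\<close> the vector \<open>b\<^sub>i\<close> with tilde. The bases \<open>U i\<close> may be any orthonormal
  bases of the inner Krylov spaces, so a run is not unique. The spaces are not required to have
  dimension \<open>k\<close>.
\<close>

definition rk_compressed_rational_lanczos where
  "rk_compressed_rational_lanczos f A b k m s \<xi>s Q U V S v bt w y \<longleftrightarrow>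
     V 1 = lanczos_block k m Q 1 \<and>
     S 1 = compress (lanczos_block k m Q 1) A \<and>
     v 1 = start_vec b (k + m) \<and>
     (1 < s \<longrightarrow> bt 1 = coupling_vec A k m Q 1) \<and>
     y 1 = lanczos_block k m Q 1 *\<^sub>v
       (mat_fun f (compress (lanczos_block k m Q 1) A) *\<^sub>v start_vec b (k + m)) \<and>
     (\<forall>i::nat\<in>{2..s}.
        dim_row (U (i - 1)) = dim_row (S (i - 1)) \<and>
        orthonormal_basis_matrix (U (i - 1)) (rational_krylov (S (i - 1)) (bt (i - 1)) \<xi>s) \<and>
        w (i - 1) = - (V (i - 1) *\<^sub>v (U (i - 1) *\<^sub>v
          (mat_fun f (compress (U (i - 1)) (S (i - 1))) *\<^sub>v
            (mat_adjoint (U (i - 1)) *\<^sub>v v (i - 1))))) \<and>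
        V i = join_cols (V (i - 1) * U (i - 1)) (lanczos_block k m Q i) \<and>
        v i = (mat_adjoint (U (i - 1)) *\<^sub>v v (i - 1)) @\<^sub>v 0\<^sub>v m \<and>
        S i = four_block_mat
          (compress (U (i - 1)) (S (i - 1)))
          (outer_prod (mat_adjoint (U (i - 1)) *\<^sub>v bt (i - 1)) (unit_vec m 0))
          (outer_prod (unit_vec m 0) (mat_adjoint (U (i - 1)) *\<^sub>v bt (i - 1)))
          (compress (lanczos_block k m Q i) A) \<and>
        (i < s \<longrightarrow> bt i = 0\<^sub>v (dim_col (U (i - 1))) @\<^sub>v coupling_vec A k m Q i) \<and>
        y i = y (i - 1) + w (i - 1) + V i *\<^sub>v (mat_fun f (S i) *\<^sub>v v i))"

end

theory Submission
  imports Defs "Jordan_Normal_Form.Spectral_Radius"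
begin

text \<open>
  For a matrix \<open>V\<close> with orthonormal columns put \<open>F\<^sub>V(g) = V g(V\<^sup>H A V) V\<^sup>H b\<close>. Let \<open>Z\<^sub>i\<close> be \<open>V\<^sub>i\<close> extended by
  the unprocessed columns of \<open>Q\<close>. Since \<open>S\<^sub>i = V\<^sub>i\<^sup>H A V\<^sub>i\<close>, the error of the compressed algorithm telescopes
  into the sum over \<open>i < s\<close> of
  \<open>F\<^bsub>Z\<^esub>(f) - F\<^bsub>V\<^esub>(f) - F\<^bsub>Z'\<^esub>(f) + F\<^bsub>VU\<^esub>(f)\<close> with \<open>V = V\<^sub>i\<close>, \<open>U = U\<^sub>i\<close>, \<open>Z = Z\<^sub>i\<close> and \<open>Z' = Z\<^bsub>i+1\<^esub>\<close>.
  Each summand vanishes when \<open>f\<close> is replaced by an element \<open>r\<close> of \<open>\<Pi>\<^bsub>k-1\<^esub>/q\<close> without poles on the field of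
  values, because the coupling between \<open>V\<close> and the remaining columns has rank one and the rational
  Krylov space that \<open>U\<close> spans contains everything the coupling can produce. So \<open>f\<close> may be replaced by
  \<open>f - r\<close>, and each of the four terms is at most \<open>\<parallel>f - r\<parallel> \<parallel>b\<parallel>\<close>.
\<close>

section \<open>Adjoints and the Euclidean norm\<close>

text \<open>The inner poles are only known not to be eigenvalues of the \<open>S i\<close>, so some
  may lie inside the field of values X, where \<open>q\<close> of an extended compression may be
  singular. The exactness argument therefore works with \<open>p/d\<close>, where \<open>d\<close>
  is a divisor of \<open>q\<close> without zeros on X; a numerator with finite error has to cancel
  the rest of \<open>q\<close>. For such functions exactness is built up from the constant 1 by
  multiplication with x and division by x - z. Two facts about the coupling vector h carry this.
  What flows back into V is always g(V^H A V) h with g again in the rational space, so V U captures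
  it. And the pairing of r(V^H A V) V^H b with h must be the same for V and V U. As b need not lie
  in any inner Krylov space, r is moved onto h as its conjugate; this is where conjugation-closed
  inner poles and the realness of X enter. The minimum over r must also be shown to exist among
  functions that may have poles on X, and the bound must make sense when it is infinite.\<close>

lemma dim_mat_adjoint [simp]:
  "dim_row (mat_adjoint A) = dim_col A" "dim_col (mat_adjoint A) = dim_row A"
  by (auto simp: mat_adjoint_def mat_of_rows_def)

lemma mat_adjoint_carrier [simp]: "A \<in> carrier_mat m n \<Longrightarrow> mat_adjoint A \<in> carrier_mat n m"
  by (intro carrier_matI) (simp_all add: carrier_matD)

lemma index_mat_adjoint [simp]:
  fixes A :: "complex mat"
  shows "i < dim_col A \<Longrightarrow> j < dim_row A \<Longrightarrow> mat_adjoint A $$ (i, j) = cnj (A $$ (j, i))"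
  by (auto simp: mat_adjoint_def mat_of_rows_def)

lemma mat_adjoint_adjoint [simp]: "mat_adjoint (mat_adjoint A) = (A :: complex mat)"
  by (rule eq_matI) auto

lemma mat_adjoint_mult:
  fixes A B :: "complex mat"
  assumes "A \<in> carrier_mat m n" "B \<in> carrier_mat n p"
  shows "mat_adjoint (A * B) = mat_adjoint B * mat_adjoint A"
  by (rule eq_matI) (use assms in \<open>auto simp: scalar_prod_def mult.commute intro!: sum.cong\<close>)

lemma mat_adjoint_diag [simp]: "mat_adjoint (mat_diag n d :: complex mat) = mat_diag n (\<lambda>i. cnj (d i))"
  by (rule eq_matI) (auto simp: mat_diag_def)

lemma index_mat_adjoint_mult_vec:
  fixes V :: "complex mat"
  assumes "j < dim_col V" "dim_vec x = dim_row V"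
  shows "(mat_adjoint V *\<^sub>v x) $ j = x \<bullet>c col V j"
  using assms by (auto simp: scalar_prod_def mult.commute intro!: sum.cong)

lemma cscalar_prod_mult_mat_vec:
  fixes A :: "complex mat"
  assumes A: "A \<in> carrier_mat m n" and x: "x \<in> carrier_vec n" and y: "y \<in> carrier_vec m"
  shows "(A *\<^sub>v x) \<bullet>c y = x \<bullet>c (mat_adjoint A *\<^sub>v y)"
proof -
  have "(A *\<^sub>v x) \<bullet>c y = (\<Sum>i<m. \<Sum>j<n. A $$ (i, j) * x $ j * cnj (y $ i))"
    using A x y by (simp add: scalar_prod_def sum_distrib_right lessThan_atLeast0)
  also have "\<dots> = (\<Sum>j<n. \<Sum>i<m. A $$ (i, j) * x $ j * cnj (y $ i))" by (rule sum.swap)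
  also have "\<dots> = x \<bullet>c (mat_adjoint A *\<^sub>v y)"
    using A x y by (simp add: scalar_prod_def sum_distrib_left lessThan_atLeast0 mult_ac)
  finally show ?thesis .
qed

lemma cscalar_prod_commute:
  fixes x y :: "complex vec"
  assumes "x \<in> carrier_vec n" "y \<in> carrier_vec n"
  shows "x \<bullet>c y = cnj (y \<bullet>c x)"
  using assms by (simp add: scalar_prod_def mult.commute)

lemma cscalar_prod_self:
  fixes v :: "complex vec"
  shows "v \<bullet>c v = complex_of_real ((norm2 v)\<^sup>2)"
  by (simp add: norm2_def L2_set_def sum_nonneg scalar_prod_def lessThan_atLeast0
      complex_mult_cnj cmod_power2)

lemma norm2_nonneg [simp]: "0 \<le> norm2 v"
  by (simp add: norm2_def L2_set_def sum_nonneg)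

lemma norm2_eq_0_iff: "v \<in> carrier_vec n \<Longrightarrow> norm2 v = 0 \<longleftrightarrow> v = 0\<^sub>v n"
  using conjugate_square_eq_0_vec[of v n] by (simp add: cscalar_prod_self)

lemma norm2_smult: "norm2 (c \<cdot>\<^sub>v v) = cmod c * norm2 v"
proof -
  have "norm2 (c \<cdot>\<^sub>v v) = L2_set (\<lambda>i. cmod c * cmod (v $ i)) {..<dim_vec v}"
    unfolding norm2_def by (rule L2_set_cong) (auto simp: norm_mult)
  then show ?thesis by (simp add: norm2_def L2_set_right_distrib)
qed

lemma norm2_add_le:
  assumes "v \<in> carrier_vec n" "w \<in> carrier_vec n"
  shows "norm2 (v + w) \<le> norm2 v + norm2 w"
proof -
  have "norm2 (v + w) \<le> L2_set (\<lambda>i. cmod (v $ i) + cmod (w $ i)) {..<n}"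
    unfolding norm2_def using assms
    by (auto intro!: L2_set_mono norm_triangle_ineq)
  also have "\<dots> \<le> norm2 v + norm2 w"
    using L2_set_triangle_ineq[of "\<lambda>i. cmod (v $ i)" "\<lambda>i. cmod (w $ i)" "{..<n}"] assms
    by (simp add: norm2_def)
  finally show ?thesis .
qed

lemma norm2_diff_le:
  assumes "v \<in> carrier_vec n" "w \<in> carrier_vec n"
  shows "norm2 (v - w) \<le> norm2 v + norm2 w"
proof -
  have "v - w = v + (-1) \<cdot>\<^sub>v w" using assms by (intro eq_vecI) auto
  then show ?thesis
    using norm2_add_le[of v n "(-1) \<cdot>\<^sub>v w"] assms by (simp add: norm2_smult)
qed

lemma norm2_isometry:
  assumes V: "V \<in> carrier_mat n a" and VV: "mat_adjoint V * V = 1\<^sub>m a" and x: "x \<in> carrier_vec a"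
  shows "norm2 (V *\<^sub>v x) = norm2 x"
proof -
  have "(V *\<^sub>v x) \<bullet>c (V *\<^sub>v x) = x \<bullet>c (mat_adjoint V *\<^sub>v (V *\<^sub>v x))"
    by (rule cscalar_prod_mult_mat_vec[OF V x]) (use V x in auto)
  also have "mat_adjoint V *\<^sub>v (V *\<^sub>v x) = x"
    using V x VV by (simp flip: assoc_mult_mat_vec[of "mat_adjoint V" a n V a x])
  finally have "(norm2 (V *\<^sub>v x))\<^sup>2 = (norm2 x)\<^sup>2"
    unfolding cscalar_prod_self of_real_eq_iff .
  then show ?thesis by simp
qed

lemma cscalar_prod_diff_self:
  fixes x z :: "complex vec"
  assumes "x \<in> carrier_vec n" "z \<in> carrier_vec n"
  shows "(x - z) \<bullet>c (x - z) = (x \<bullet>c x - x \<bullet>c z) - (z \<bullet>c x - z \<bullet>c z)"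
  using assms by (simp add: scalar_prod_def algebra_simps sum_subtractf sum.distrib)

text \<open>Bessel's inequality: the defect between the squared norms is the squared norm of the
  residual \<open>x - V *\<^sub>v c\<close>.\<close>

lemma norm2_adjoint_isometry_le:
  assumes V: "V \<in> carrier_mat n a" and VV: "mat_adjoint V * V = 1\<^sub>m a" and x: "x \<in> carrier_vec n"
  shows "norm2 (mat_adjoint V *\<^sub>v x) \<le> norm2 x"
proof -
  define c where "c = mat_adjoint V *\<^sub>v x"
  have c: "c \<in> carrier_vec a" using V x by (auto simp: c_def intro!: carrier_vecI)
  have Vc: "V *\<^sub>v c \<in> carrier_vec n" using V c by simp
  have 1: "x \<bullet>c (V *\<^sub>v c) = complex_of_real ((norm2 c)\<^sup>2)"
    using cscalar_prod_mult_mat_vec[of "mat_adjoint V" a n x c] V x c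
    by (simp add: cscalar_prod_self flip: c_def)
  have 2: "(V *\<^sub>v c) \<bullet>c x = complex_of_real ((norm2 c)\<^sup>2)"
    using cscalar_prod_commute[OF Vc x] 1 by simp
  have "(x - V *\<^sub>v c) \<bullet>c (x - V *\<^sub>v c) =
      (x \<bullet>c x - x \<bullet>c (V *\<^sub>v c)) - ((V *\<^sub>v c) \<bullet>c x - (V *\<^sub>v c) \<bullet>c (V *\<^sub>v c))"
    by (rule cscalar_prod_diff_self[OF x Vc])
  also have "\<dots> = complex_of_real ((norm2 x)\<^sup>2 - (norm2 c)\<^sup>2)"
    using norm2_isometry[OF V VV c] by (simp add: 1 2 cscalar_prod_self)
  finally have "(norm2 x)\<^sup>2 - (norm2 c)\<^sup>2 = (norm2 (x - V *\<^sub>v c))\<^sup>2"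
    unfolding cscalar_prod_self of_real_eq_iff by simp
  then have "(norm2 c)\<^sup>2 \<le> (norm2 x)\<^sup>2"
    by (metis diff_ge_0_iff_ge zero_le_power2)
  then show ?thesis unfolding c_def by (simp add: power_mono_iff)
qed

lemma adjoint_mult_index:
  fixes W :: "complex mat"
  assumes "B \<in> carrier_mat n p" "W \<in> carrier_mat n q" "i < q" "j < p"
  shows "(mat_adjoint W * B) $$ (i, j) = col B j \<bullet>c col W i"
  using assms by (auto simp: scalar_prod_def mult.commute intro!: sum.cong)

text \<open>Deflation in the spectral theorem needs a unitary matrix with a prescribed first
  direction. Gram-Schmidt keeps the head of a list, so starting from a basis that begins with
  \<open>v\<close> puts \<open>v\<close> first; its output is orthogonal but not normalized, hence
  the scaling in \<open>W\<close>.\<close>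

lemma unitary_completion:
  fixes v :: "complex vec"
  assumes v: "v \<in> carrier_vec n" and v0: "v \<noteq> 0\<^sub>v n"
  obtains W where "W \<in> carrier_mat n n" "mat_adjoint W * W = 1\<^sub>m n"
    "col W 0 = complex_of_real (1 / norm2 v) \<cdot>\<^sub>v v"
proof -
  interpret cof_vec_space n "TYPE(complex)" .
  note bc = basis_completion[OF v v0]
  have n: "n > 0" using v v0 by (cases n) (auto intro: eq_vecI)
  define ws where "ws = gram_schmidt n (basis_completion v)"
  note gs = gram_schmidt_result[OF bc(2) bc(4) _ refl, folded ws_def]
  have orth: "corthogonal ws" and ws: "set ws \<subseteq> carrier_vec n" and len: "length ws = n"
    using gs bc by auto
  obtain vs where vs: "basis_completion v = v # vs"
    by (simp add: basis_completion_def Let_def)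
  have hd: "hd ws = v"
    using gram_schmidt_hd[OF v, of vs] unfolding ws_def vs by simp
  have wsc: "ws ! i \<in> carrier_vec n" if "i < n" for i using ws len that by auto
  have pos: "norm2 (ws ! i) \<noteq> 0" if "i < n" for i
  proof -
    have "ws ! i \<bullet>c ws ! i \<noteq> 0" using corthogonalD[OF orth, of i i] that len by auto
    then show ?thesis by (simp add: cscalar_prod_self)
  qed
  define W where "W = mat n n (\<lambda>(r, c). complex_of_real (1 / norm2 (ws ! c)) * (ws ! c) $ r)"
  have W: "W \<in> carrier_mat n n" by (simp add: W_def)
  have colW: "col W c = complex_of_real (1 / norm2 (ws ! c)) \<cdot>\<^sub>v ws ! c" if "c < n" for c
    using that wsc[OF that] by (intro eq_vecI) (auto simp: W_def)
  have "mat_adjoint W * W = 1\<^sub>m n"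
  proof (rule eq_matI)
    fix i j assume "i < dim_row (1\<^sub>m n :: complex mat)" "j < dim_col (1\<^sub>m n :: complex mat)"
    then have ij: "i < n" "j < n" by auto
    have "(mat_adjoint W * W) $$ (i, j) = col W j \<bullet>c col W i"
      using adjoint_mult_index[OF W W ij] .
    also have "\<dots> = complex_of_real (1 / norm2 (ws ! i)) * complex_of_real (1 / norm2 (ws ! j))
        * (ws ! j \<bullet>c ws ! i)"
      using wsc[OF ij(1)] wsc[OF ij(2)]
      by (simp add: colW ij conjugate_smult_vec)
    also have "\<dots> = (1\<^sub>m n :: complex mat) $$ (i, j)"
    proof (cases "i = j")
      case True
      then show ?thesis using ij pos[OF ij(1)]
        by (simp add: cscalar_prod_self power2_eq_square)
    next
      case False
      then show ?thesis using corthogonalD[OF orth, of j i] ij len by auto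
    qed
    finally show "(mat_adjoint W * W) $$ (i, j) = (1\<^sub>m n :: complex mat) $$ (i, j)" .
  qed (use W in auto)
  moreover have "col W 0 = complex_of_real (1 / norm2 v) \<cdot>\<^sub>v v"
    using colW[OF n] hd n len by (simp add: hd_conv_nth flip: length_greater_0_conv)
  ultimately show ?thesis using that W by blast
qed

lemma unitary_right:
  fixes W :: "complex mat"
  assumes "W \<in> carrier_mat n n" "mat_adjoint W * W = 1\<^sub>m n"
  shows "W * mat_adjoint W = 1\<^sub>m n"
  using mat_mult_left_right_inverse[of "mat_adjoint W" n W] assms by simp

text \<open>The relation behind the choice in \<open>mat_fun\<close>, named so that existence and
  independence of the choice can be stated.\<close>

definition eigendecomposition :: "complex mat \<Rightarrow> complex mat \<Rightarrow> (nat \<Rightarrow> complex) \<Rightarrow> bool" where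
  "eigendecomposition H W d \<longleftrightarrow>
     W \<in> carrier_mat (dim_row H) (dim_row H) \<and> mat_adjoint W * W = 1\<^sub>m (dim_row H) \<and>
     H = W * mat_diag (dim_row H) d * mat_adjoint W"

section \<open>Functional calculus of Hermitian matrices\<close>

lemma eigendecomposition_conjugate:
  assumes W0: "W0 \<in> carrier_mat n n" "mat_adjoint W0 * W0 = 1\<^sub>m n"
    and H: "H \<in> carrier_mat n n"
    and ed: "eigendecomposition (mat_adjoint W0 * H * W0) P d"
  shows "eigendecomposition H (W0 * P) d"
proof -
  have P: "P \<in> carrier_mat n n" "mat_adjoint P * P = 1\<^sub>m n"
    "mat_adjoint W0 * H * W0 = P * mat_diag n d * mat_adjoint P"
    using ed W0 by (auto simp: eigendecomposition_def)
  define W0' where "W0' = mat_adjoint W0"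
  define P' where "P' = mat_adjoint P"
  have c: "W0' \<in> carrier_mat n n" "P' \<in> carrier_mat n n" using W0 P by (auto simp: W0'_def P'_def)
  have adj: "mat_adjoint (W0 * P) = P' * W0'"
    using mat_adjoint_mult[OF W0(1) P(1)] by (simp add: W0'_def P'_def)
  have r: "W0 * W0' = 1\<^sub>m n" using unitary_right[OF W0] by (simp add: W0'_def)
  have "P' * W0' * (W0 * P) = P' * (W0' * W0) * P"
    using c W0(1) P(1) by (simp add: assoc_mult_mat[of _ n n _ n _ n] mult_carrier_mat[of _ n n _ n])
  also have "\<dots> = 1\<^sub>m n" using c W0 P by (simp add: W0'_def P'_def)
  finally have 1: "mat_adjoint (W0 * P) * (W0 * P) = 1\<^sub>m n" by (simp add: adj)
  have "H = (W0 * W0') * H * (W0 * W0')" using H by (simp add: r)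
  also have "\<dots> = W0 * (W0' * H * W0) * W0'"
    using c W0(1) H by (simp add: assoc_mult_mat[of _ n n _ n _ n] mult_carrier_mat[of _ n n _ n])
  also have "\<dots> = W0 * P * mat_diag n d * (P' * W0')"
    using c W0(1) P(1) P(3)[folded W0'_def P'_def] by (simp add: assoc_mult_mat[of _ n n _ n _ n] mult_carrier_mat[of _ n n _ n])
  finally show ?thesis using 1 H W0 P by (auto simp: eigendecomposition_def adj)
qed

lemma mult_block_diag:
  assumes "A \<in> carrier_mat p p" "C \<in> carrier_mat p p" "B \<in> carrier_mat n n" "D \<in> carrier_mat n n"
  shows "four_block_mat A (0\<^sub>m p n) (0\<^sub>m n p) B * four_block_mat C (0\<^sub>m p n) (0\<^sub>m n p) D =
    four_block_mat (A * C) (0\<^sub>m p n) (0\<^sub>m n p) (B * D)"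
  using assms
  by (subst mult_four_block_mat[of _ p p _ n _ n _ _ p _ n])
    (auto simp: mult_carrier_mat[of _ p p _ p] mult_carrier_mat[of _ n n _ n])

text \<open>Spectral theorem by deflation. With a unit eigenvector as first column of
  \<open>W\<close>, the first column of \<open>B\<close> is a multiple of the first unit vector;
  Hermitian symmetry clears the first row as well, and the remaining block \<open>B3\<close> is
  Hermitian of size \<open>n\<close>.\<close>

lemma hermitian_eigendecomposition_exists:
  assumes "H \<in> carrier_mat n n" "mat_adjoint H = H"
  shows "\<exists>W d. eigendecomposition H W d"
  using assms
proof (induction n arbitrary: H)
  case 0
  have "eigendecomposition H (1\<^sub>m 0) (\<lambda>_. 0)"
    using 0 by (auto simp: eigendecomposition_def intro!: eq_matI)
  then show ?case by blast
next
  case (Suc n)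
  note H = Suc.prems
  obtain e where "eigenvalue H e"
    using spectrum_non_empty[OF H(1)] by (auto simp: spectrum_def)
  then obtain v where v: "v \<in> carrier_vec (Suc n)" "v \<noteq> 0\<^sub>v (Suc n)" "H *\<^sub>v v = e \<cdot>\<^sub>v v"
    using H by (auto simp: eigenvalue_def eigenvector_def)
  obtain W where W: "W \<in> carrier_mat (Suc n) (Suc n)" "mat_adjoint W * W = 1\<^sub>m (Suc n)"
    and W0: "col W 0 = complex_of_real (1 / norm2 v) \<cdot>\<^sub>v v"
    using unitary_completion[OF v(1,2)] by blast
  define B where "B = mat_adjoint W * H * W"
  have B: "B \<in> carrier_mat (Suc n) (Suc n)" using W H by (auto simp: B_def)
  have Badj: "mat_adjoint B = B"
    using W H by (simp add: B_def mat_adjoint_mult[of _ "Suc n" "Suc n" _ "Suc n"]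
        assoc_mult_mat[of _ "Suc n" "Suc n" _ "Suc n" _ "Suc n"]
        mult_carrier_mat[of _ "Suc n" "Suc n" _ "Suc n"])
  have "H *\<^sub>v col W 0 = e \<cdot>\<^sub>v col W 0"
    using H v by (simp add: W0 mult_mat_vec[of _ "Suc n" "Suc n"] smult_smult_assoc mult.commute)
  then have colHW: "col (H * W) 0 = e \<cdot>\<^sub>v col W 0"
    using W H by (simp add: col_mult2[of _ "Suc n" "Suc n" _ "Suc n"] del: col_mult)
  have B0: "B $$ (i, 0) = (if i = 0 then e else 0)" if "i < Suc n" for i
  proof -
    have cW: "col W i \<in> carrier_vec (Suc n)" "col W 0 \<in> carrier_vec (Suc n)"
      using W(1) col_dim[of W] by auto
    have "B $$ (i, 0) = (mat_adjoint W * (H * W)) $$ (i, 0)"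
      using W H by (simp add: B_def assoc_mult_mat[of _ "Suc n" "Suc n" _ "Suc n" _ "Suc n"]
        mult_carrier_mat[of _ "Suc n" "Suc n" _ "Suc n"])
    also have "\<dots> = e * (col W 0 \<bullet>c col W i)"
      using adjoint_mult_index[of "H * W" "Suc n" "Suc n" W "Suc n" i 0] W H that cW
      by (simp add: colHW)
    also have "col W 0 \<bullet>c col W i = (mat_adjoint W * W) $$ (i, 0)"
      using adjoint_mult_index[of W "Suc n" "Suc n" W "Suc n" i 0] W that by simp
    finally show ?thesis using W that by simp
  qed
  have B0': "B $$ (0, i) = (if i = 0 then cnj e else 0)" if "i < Suc n" for i
    using B0[OF that] that B arg_cong[OF Badj, of "\<lambda>M. M $$ (0, i)"] by auto
  have e: "cnj e = e" using B0[of 0] B0'[of 0] by simp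
  define B3 where "B3 = mat n n (\<lambda>(i, j). B $$ (Suc i, Suc j))"
  have B3: "B3 \<in> carrier_mat n n" "mat_adjoint B3 = B3"
    using B arg_cong[OF Badj, of "\<lambda>M. M $$ (Suc _, Suc _)"]
    by (auto simp: B3_def intro!: eq_matI)
      (metis Badj Suc_less_eq carrier_matD index_mat_adjoint)
  obtain W3 d where ed: "eigendecomposition B3 W3 d" using Suc.IH[OF B3] by blast
  have W3: "W3 \<in> carrier_mat n n" "mat_adjoint W3 * W3 = 1\<^sub>m n"
      "B3 = W3 * mat_diag n d * mat_adjoint W3"
    using ed B3 by (auto simp: eigendecomposition_def)
  define P where "P = four_block_mat (1\<^sub>m 1) (0\<^sub>m 1 n) (0\<^sub>m n 1) W3"
  have Padj: "mat_adjoint P = four_block_mat (1\<^sub>m 1) (0\<^sub>m 1 n) (0\<^sub>m n 1) (mat_adjoint W3)"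
    using W3(1) by (intro eq_matI) (auto simp: P_def four_block_mat_def Let_def)
  have diag: "mat_diag (Suc n) (case_nat e d) =
      four_block_mat (mat_diag 1 (\<lambda>_. e)) (0\<^sub>m 1 n) (0\<^sub>m n 1) (mat_diag n d)"
    by (rule eq_matI) (auto simp: mat_diag_def four_block_mat_def Let_def split: nat.splits)
  have Beq: "B = four_block_mat (mat_diag 1 (\<lambda>_. e)) (0\<^sub>m 1 n) (0\<^sub>m n 1) B3"
    using B B0 B0' e
    by (intro eq_matI) (auto simp: mat_diag_def four_block_mat_def Let_def B3_def)
  have PP: "mat_adjoint P * P = 1\<^sub>m (Suc n)"
    unfolding Padj unfolding P_def using W3(1,2)
    by (subst mult_four_block_mat[of _ 1 1 _ n _ n _ _ 1 _ n])
      (auto simp: four_block_one_mat)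
  have "P * mat_diag (Suc n) (case_nat e d) * mat_adjoint P = B"
    unfolding Padj diag Beq unfolding P_def W3(3)
    using W3(1) left_mult_one_mat[OF mat_diag_dim[of "Suc 0" "\<lambda>_. e"]]
      right_mult_one_mat[OF mat_diag_dim[of "Suc 0" "\<lambda>_. e"]]
    by (simp add: mult_block_diag[of _ "Suc 0" _ _ n] mult_carrier_mat[of _ n n _ n])
  then have "eigendecomposition B P (case_nat e d)"
    using PP B W3(1) by (auto simp: eigendecomposition_def P_def)
  then show ?case
    using eigendecomposition_conjugate[OF W H(1)] unfolding B_def by blast
qed

text \<open>Entrywise the hypothesis reads \<open>d' i * M $$ (i, j) = M $$ (i, j) * d j\<close>, so
  \<open>d' i = d j\<close> wherever the entry of \<open>M\<close> is nonzero, and there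
  \<open>f\<close> takes equal values too.\<close>

lemma mat_diag_intertwine:
  assumes M: "M \<in> carrier_mat n n" and eq: "mat_diag n d' * M = M * mat_diag n d"
  shows "mat_diag n (\<lambda>i. f (d' i)) * M = M * mat_diag n (\<lambda>i. f (d i :: complex))"
proof (rule eq_matI)
  fix i j assume "i < dim_row (M * mat_diag n (\<lambda>i. f (d i)))" "j < dim_col (M * mat_diag n (\<lambda>i. f (d i)))"
  then have ij: "i < n" "j < n" using M by (auto simp: mat_diag_def)
  have "d' i * M $$ (i, j) = M $$ (i, j) * d j"
    using arg_cong[OF eq, of "\<lambda>X. X $$ (i, j)"] ij
    by (simp add: mat_diag_mult_left[OF M] mat_diag_mult_right[OF M])
  then have "f (d' i) * M $$ (i, j) = M $$ (i, j) * f (d j)"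
    by (cases "M $$ (i, j) = 0") auto
  then show "(mat_diag n (\<lambda>i. f (d' i)) * M) $$ (i, j) = (M * mat_diag n (\<lambda>i. f (d i))) $$ (i, j)"
    using ij by (simp add: mat_diag_mult_left[OF M] mat_diag_mult_right[OF M])
qed (use M in \<open>auto simp: mat_diag_def\<close>)

text \<open>The change of basis \<open>mat_adjoint W' * W\<close> intertwines the two diagonal
  matrices, hence also their images under \<open>f\<close>. This makes the choice in
  \<open>mat_fun\<close> immaterial.\<close>

lemma eigendecomposition_unique:
  assumes "eigendecomposition H W d" "eigendecomposition H W' d'"
  shows "W' * mat_diag (dim_row H) (\<lambda>i. f (d' i)) * mat_adjoint W' =
    W * mat_diag (dim_row H) (\<lambda>i. f (d i)) * mat_adjoint W"
proof -
  define n where "n = dim_row H"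
  have W: "W \<in> carrier_mat n n" "mat_adjoint W * W = 1\<^sub>m n"
      "H = W * mat_diag n d * mat_adjoint W"
    and W': "W' \<in> carrier_mat n n" "mat_adjoint W' * W' = 1\<^sub>m n"
      "H = W' * mat_diag n d' * mat_adjoint W'"
    using assms by (auto simp: eigendecomposition_def n_def)
  define X where "X = mat_adjoint W"
  define X' where "X' = mat_adjoint W'"
  define M where "M = X' * W"
  define D where "D = mat_diag n d"
  define D' where "D' = mat_diag n d'"
  have c: "X \<in> carrier_mat n n" "X' \<in> carrier_mat n n" "M \<in> carrier_mat n n"
      "D \<in> carrier_mat n n" "D' \<in> carrier_mat n n"
    using W W' by (auto simp: X_def X'_def M_def D_def D'_def)
  note assoc = assoc_mult_mat[of _ n n _ n _ n] mult_carrier_mat[of _ n n _ n]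
  have 1: "X * W = 1\<^sub>m n" "X' * W' = 1\<^sub>m n" "W * X = 1\<^sub>m n" "W' * X' = 1\<^sub>m n"
    using W W' unitary_right[of W n] unitary_right[of W' n] by (auto simp: X_def X'_def)
  have "X' * (W' * D' * X') * W = X' * (W * D * X) * W"
    using W(3) W'(3) by (simp add: D_def D'_def X_def X'_def)
  moreover have "X' * (W' * D' * X') * W = (X' * W') * D' * M"
    using c W(1) W'(1) by (simp add: M_def assoc)
  moreover have "X' * (W * D * X) * W = M * D * (X * W)"
    using c W(1) W'(1) by (simp add: M_def assoc)
  ultimately have "D' * M = M * D" using c by (simp add: 1)
  then have int: "mat_diag n (\<lambda>i. f (d' i)) * M = M * mat_diag n (\<lambda>i. f (d i))"
    unfolding D_def D'_def by (rule mat_diag_intertwine[OF c(3)])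
  have "W' * mat_diag n (\<lambda>i. f (d' i)) * X' = W' * mat_diag n (\<lambda>i. f (d' i)) * X' * (W * X)"
    using c W'(1) by (simp add: 1 assoc)
  also have "\<dots> = W' * (mat_diag n (\<lambda>i. f (d' i)) * M) * X"
    using c W(1) W'(1) by (simp add: M_def assoc)
  also have "\<dots> = W' * (M * mat_diag n (\<lambda>i. f (d i))) * X" by (simp add: int)
  also have "\<dots> = (W' * X') * W * mat_diag n (\<lambda>i. f (d i)) * X"
    using c W(1) W'(1) by (simp add: M_def assoc)
  also have "\<dots> = W * mat_diag n (\<lambda>i. f (d i)) * X" using c W(1) by (simp add: 1 assoc)
  finally show ?thesis by (simp add: n_def X_def X'_def)
qed

lemma mat_fun_eq:
  assumes "eigendecomposition H W d"
  shows "mat_fun f H = W * mat_diag (dim_row H) (\<lambda>i. f (d i)) * mat_adjoint W"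
proof -
  have *: "mat_fun f H = (SOME F. \<exists>W d. eigendecomposition H W d \<and>
      F = W * mat_diag (dim_row H) (\<lambda>i. f (d i)) * mat_adjoint W)"
    unfolding mat_fun_def eigendecomposition_def by (simp add: conj_assoc)
  show ?thesis
    unfolding * by (rule some_equality) (use assms eigendecomposition_unique in \<open>blast+\<close>)
qed

text \<open>A single decomposition computes \<open>mat_fun f H\<close> for every \<open>f\<close>,
  so the laws below reduce to statements on diagonal matrices.\<close>

lemma hermitianD:
  assumes "hermitian H" "H \<in> carrier_mat n n"
  obtains W d where "eigendecomposition H W d" "W \<in> carrier_mat n n" "mat_adjoint W * W = 1\<^sub>m n"
    "W * mat_adjoint W = 1\<^sub>m n" "H = W * mat_diag n d * mat_adjoint W"
    "\<And>f. mat_fun f H = W * mat_diag n (\<lambda>i. f (d i)) * mat_adjoint W"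
proof -
  obtain W d where ed: "eigendecomposition H W d"
    using hermitian_eigendecomposition_exists[OF assms(2)] assms(1) by (auto simp: hermitian_def)
  have c: "W \<in> carrier_mat n n" "mat_adjoint W * W = 1\<^sub>m n" "H = W * mat_diag n d * mat_adjoint W"
    using ed assms(2) by (auto simp: eigendecomposition_def)
  show ?thesis
    using that[OF ed c(1,2) unitary_right[OF c(1,2)] c(3)] mat_fun_eq[OF ed] assms(2) by auto
qed

lemma hermitian_adjoint: "hermitian H \<Longrightarrow> mat_adjoint H = H"
  by (simp add: hermitian_def)

lemma mat_fun_carrier:
  assumes "hermitian H" "H \<in> carrier_mat n n"
  shows "mat_fun f H \<in> carrier_mat n n"
  by (rule hermitianD[OF assms]) auto

section \<open>Algebraic laws and bounds of the functional calculus\<close>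

lemma mat_fun_add:
  assumes "hermitian H" "H \<in> carrier_mat n n"
  shows "mat_fun (\<lambda>x. f x + g x) H = mat_fun f H + mat_fun g H"
proof (rule hermitianD[OF assms])
  fix W d assume W: "W \<in> carrier_mat n n"
    and eq: "\<And>f. mat_fun f H = W * mat_diag n (\<lambda>i. f (d i)) * mat_adjoint W"
  have "mat_diag n (\<lambda>i. f (d i) + g (d i)) = mat_diag n (\<lambda>i. f (d i)) + mat_diag n (\<lambda>i. g (d i))"
    by (rule eq_matI) (auto simp: mat_diag_def)
  then show ?thesis using W
    by (simp add: eq mult_add_distrib_mat[of _ n n _ n] add_mult_distrib_mat[of _ n n _ _ n])
qed

lemma mat_fun_mult:
  assumes "hermitian H" "H \<in> carrier_mat n n"
  shows "mat_fun (\<lambda>x. f x * g x) H = mat_fun f H * mat_fun g H"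
proof (rule hermitianD[OF assms])
  fix W d assume W: "W \<in> carrier_mat n n" "mat_adjoint W * W = 1\<^sub>m n"
    and eq: "\<And>f. mat_fun f H = W * mat_diag n (\<lambda>i. f (d i)) * mat_adjoint W"
  define X where "X = mat_adjoint W"
  define D where "D = mat_diag n (\<lambda>i. f (d i))"
  define E where "E = mat_diag n (\<lambda>i. g (d i))"
  have c: "X \<in> carrier_mat n n" "D \<in> carrier_mat n n" "E \<in> carrier_mat n n"
    using W by (auto simp: X_def D_def E_def)
  note assoc = assoc_mult_mat[of _ n n _ n _ n] mult_carrier_mat[of _ n n _ n]
  have "W * D * X * (W * E * X) = W * D * (X * W) * E * X"
    using c W(1) by (simp add: assoc)
  also have "\<dots> = W * (D * E) * X" using c W by (simp add: assoc X_def)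
  finally show ?thesis by (simp add: eq X_def D_def E_def)
qed

lemma mat_fun_const:
  assumes "hermitian H" "H \<in> carrier_mat n n"
  shows "mat_fun (\<lambda>x. c) H = c \<cdot>\<^sub>m 1\<^sub>m n"
proof (rule hermitianD[OF assms])
  fix W d assume W: "W \<in> carrier_mat n n" "W * mat_adjoint W = 1\<^sub>m n"
    and eq: "\<And>f. mat_fun f H = W * mat_diag n (\<lambda>i. f (d i)) * mat_adjoint W"
  have "mat_diag n (\<lambda>i. c) = c \<cdot>\<^sub>m 1\<^sub>m n" by (rule eq_matI) (auto simp: mat_diag_def)
  then show ?thesis using W
    by (simp add: eq mult_smult_distrib[of _ n n _ n] mult_smult_assoc_mat[of _ n n _ n])
qed

lemma mat_fun_id:
  assumes "hermitian H" "H \<in> carrier_mat n n"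
  shows "mat_fun (\<lambda>x. x) H = H"
  by (rule hermitianD[OF assms]) simp

lemma mat_fun_adjoint:
  assumes "hermitian H" "H \<in> carrier_mat n n"
  shows "mat_adjoint (mat_fun f H) = mat_fun (\<lambda>x. cnj (f x)) H"
proof (rule hermitianD[OF assms])
  fix W d assume W: "W \<in> carrier_mat n n"
    and eq: "\<And>f. mat_fun f H = W * mat_diag n (\<lambda>i. f (d i)) * mat_adjoint W"
  show ?thesis using W unfolding eq
    by (simp add: mat_adjoint_mult[of _ n n _ n] assoc_mult_mat[of _ n n _ n _ n] mult_carrier_mat[of _ n n _ n])
qed

lemma eigendecomposition_eigenvalue:
  assumes "eigendecomposition H W d" "i < dim_row H"
  shows "eigenvalue H (d i)"
proof -
  define n where "n = dim_row H"
  have W: "W \<in> carrier_mat n n" "mat_adjoint W * W = 1\<^sub>m n" "H = W * mat_diag n d * mat_adjoint W"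
    and i: "i < n" using assms by (auto simp: eigendecomposition_def n_def)
  have HW: "H * W = W * mat_diag n d"
    using W(1,2) right_mult_one_mat[OF mat_diag_dim[of n d]]
    by (subst W(3)) (simp add: assoc_mult_mat[of _ n n _ n _ n] mult_carrier_mat[of _ n n _ n])
  have H: "H \<in> carrier_mat n n" by (subst W(3)) (use W in auto)
  have "H *\<^sub>v col W i = col (W * mat_diag n d) i"
    using W(1) H i by (simp add: col_mult2[OF H W(1) i] del: col_mult flip: HW)
  also have "\<dots> = d i \<cdot>\<^sub>v col W i"
    using i W(1) by (intro eq_vecI) (auto simp: mat_diag_mult_right)
  finally have "H *\<^sub>v col W i = d i \<cdot>\<^sub>v col W i" .
  moreover have "col W i \<bullet>c col W i = 1"
    using adjoint_mult_index[of W n n W n i i] W(1) i by (simp add: W(2))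
  then have "col W i \<noteq> 0\<^sub>v n" using W(1) by auto
  ultimately show ?thesis
    using W(1) H i by (auto simp: eigenvalue_def eigenvector_def intro!: exI[of _ "col W i"])
qed

lemma mat_fun_cong:
  assumes "hermitian H" "H \<in> carrier_mat n n" "\<And>x. eigenvalue H x \<Longrightarrow> f x = g x"
  shows "mat_fun f H = mat_fun g H"
proof (rule hermitianD[OF assms(1,2)])
  fix W d assume W: "W \<in> carrier_mat n n" and ed: "eigendecomposition H W d"
    and eq: "\<And>f. mat_fun f H = W * mat_diag n (\<lambda>i. f (d i)) * mat_adjoint W"
  have "mat_diag n (\<lambda>i. f (d i)) = mat_diag n (\<lambda>i. g (d i))"
    using eigendecomposition_eigenvalue[OF ed] assms(2,3)
    by (intro eq_matI) (auto simp: mat_diag_def)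
  then show ?thesis by (simp add: eq)
qed

lemma norm2_mat_fun_le:
  assumes H: "hermitian H" "H \<in> carrier_mat n n" and x: "x \<in> carrier_vec n"
    and f: "\<And>z. eigenvalue H z \<Longrightarrow> cmod (f z) \<le> e" and e: "e \<ge> 0"
  shows "norm2 (mat_fun f H *\<^sub>v x) \<le> e * norm2 x"
proof (rule hermitianD[OF H])
  fix W d assume W: "W \<in> carrier_mat n n" "mat_adjoint W * W = 1\<^sub>m n" and ed: "eigendecomposition H W d"
    and eq: "\<And>f. mat_fun f H = W * mat_diag n (\<lambda>i. f (d i)) * mat_adjoint W"
  define c where "c = mat_adjoint W *\<^sub>v x"
  have c: "c \<in> carrier_vec n" using W x by (auto simp: c_def intro!: carrier_vecI)
  define D where "D = mat_diag n (\<lambda>i. f (d i))"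
  have D: "D \<in> carrier_mat n n" by (simp add: D_def)
  have Dc: "(D *\<^sub>v c) $ i = f (d i) * c $ i" if "i < n" for i
  proof -
    have "row D i = vec n (\<lambda>j. if j = i then f (d i) else 0)"
      using that by (intro eq_vecI) (auto simp: D_def mat_diag_def)
    then show ?thesis using that c D by (simp add: scalar_prod_def if_distrib if_distribR cong: if_cong)
  qed
  have "mat_fun f H *\<^sub>v x = W *\<^sub>v (D *\<^sub>v c)"
    using W(1) x D c
    by (simp add: eq assoc_mult_mat_vec[of _ n n _ n] mult_carrier_mat[of _ n n _ n]
        flip: c_def D_def)
  then have "norm2 (mat_fun f H *\<^sub>v x) = norm2 (D *\<^sub>v c)"
    using norm2_isometry[OF W, of "D *\<^sub>v c"] mult_mat_vec_carrier[OF D c] by simp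
  also have "\<dots> \<le> L2_set (\<lambda>i. e * cmod (c $ i)) {..<n}"
    unfolding norm2_def using D c Dc eigendecomposition_eigenvalue[OF ed] H(2) f
    by (auto intro!: L2_set_mono mult_right_mono simp: norm_mult)
  also have "\<dots> = e * norm2 c" using e c by (simp add: norm2_def L2_set_right_distrib)
  also have "\<dots> \<le> e * norm2 x"
    using norm2_adjoint_isometry_le[OF W x] e by (simp add: c_def mult_left_mono)
  finally show ?thesis .
qed

lemma eigenvalue_in_field_of_values:
  assumes H: "H \<in> carrier_mat n n" and e: "eigenvalue H e"
  shows "e \<in> field_of_values H"
proof -
  obtain v where v: "v \<in> carrier_vec n" "v \<noteq> 0\<^sub>v n" "H *\<^sub>v v = e \<cdot>\<^sub>v v"
    using e H by (auto simp: eigenvalue_def eigenvector_def)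
  define c where "c = complex_of_real (1 / norm2 v)"
  have pos: "norm2 v \<noteq> 0" using norm2_eq_0_iff v by blast
  define u where "u = c \<cdot>\<^sub>v v"
  have u: "u \<in> carrier_vec n" "norm2 u = 1"
    using v pos by (auto simp: u_def norm2_smult c_def norm_divide)
  have "H *\<^sub>v u = e \<cdot>\<^sub>v u"
    using H v by (simp add: u_def mult_mat_vec[of _ n n] smult_smult_assoc mult.commute)
  then have "(H *\<^sub>v u) \<bullet>c u = e" using u by (simp add: cscalar_prod_self)
  then show ?thesis using u H by (auto simp: field_of_values_def)
qed

text \<open>Realness is what lets the conjugate of a polynomial value be computed by conjugating
  coefficients.\<close>

lemma field_of_values_hermitian_real:
  assumes "hermitian A" "x \<in> field_of_values A"
  shows "cnj x = x"
proof -
  define n where "n = dim_row A"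
  obtain u where u: "u \<in> carrier_vec n" "x = (A *\<^sub>v u) \<bullet>c u"
    using assms(2) by (auto simp: field_of_values_def n_def)
  have A: "A \<in> carrier_mat n n" "mat_adjoint A = A" using assms(1) by (auto simp: hermitian_def n_def)
  have "x = u \<bullet>c (A *\<^sub>v u)" using cscalar_prod_mult_mat_vec[OF A(1) u(1) u(1)] A u by simp
  also have "\<dots> = cnj x" using cscalar_prod_commute[of u n "A *\<^sub>v u"] u mult_mat_vec_carrier[OF A(1) u(1)] by simp
  finally show ?thesis by simp
qed

section \<open>Rational Krylov spaces of Hermitian matrices\<close>

lemma mat_fun_one:
  assumes "hermitian H" "H \<in> carrier_mat n n"
  shows "mat_fun (\<lambda>x. 1) H = 1\<^sub>m n"
proof -
  have "1 \<cdot>\<^sub>m 1\<^sub>m n = (1\<^sub>m n :: complex mat)" by (rule eq_matI) auto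
  then show ?thesis using mat_fun_const[OF assms, of 1] by simp
qed

lemma dim_mat_fun [simp]:
  assumes "hermitian H"
  shows "dim_row (mat_fun f H) = dim_row H" "dim_col (mat_fun f H) = dim_row H"
proof -
  have "H \<in> carrier_mat (dim_row H) (dim_row H)" using assms unfolding hermitian_def by blast
  from mat_fun_carrier[OF assms this, of f]
  show "dim_row (mat_fun f H) = dim_row H" "dim_col (mat_fun f H) = dim_row H"
    unfolding carrier_mat_def by blast+
qed

lemma mat_fun_power:
  assumes "hermitian H" "H \<in> carrier_mat n n"
  shows "mat_fun (\<lambda>x. x ^ d) H = H ^\<^sub>m d"
proof (induction d)
  case 0
  then show ?case using mat_fun_one[OF assms] assms by simp
next
  case (Suc d)
  then show ?case
    using mat_fun_mult[OF assms, of "\<lambda>x. x ^ d" "\<lambda>x. x"] by (simp add: mat_fun_id[OF assms] mult.commute)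
qed

lemma mat_fun_cmult:
  assumes "hermitian H" "H \<in> carrier_mat n n"
  shows "mat_fun (\<lambda>x. c * f x) H = c \<cdot>\<^sub>m mat_fun f H"
  using mat_fun_mult[OF assms, of "\<lambda>_. c" f] mat_fun_const[OF assms, of c] mat_fun_carrier[OF assms, of f]
  by (simp add: mult_smult_assoc_mat[of _ n n _ n])

lemma index_mat_fun_sum:
  assumes "hermitian H" "H \<in> carrier_mat n n" "i < n" "j < n" "finite D"
  shows "mat_fun (\<lambda>x. \<Sum>d\<in>D. f d x) H $$ (i, j) = (\<Sum>d\<in>D. mat_fun (f d) H $$ (i, j))"
  using assms(5)
proof (induction D rule: finite_induct)
  case empty
  then show ?case using mat_fun_const[OF assms(1,2), of 0] assms by simp
next
  case (insert e D)
  then show ?case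
    using mat_fun_add[OF assms(1,2), of "f e" "\<lambda>x. \<Sum>d\<in>D. f d x"]
      assms
    by simp
qed

text \<open>Connects the entrywise sum in \<open>poly_mat\<close> with the functional calculus, in
  which rational Krylov spaces are then expressed.\<close>

lemma poly_mat_hermitian:
  assumes "hermitian H" "H \<in> carrier_mat n n"
  shows "poly_mat p H = mat_fun (poly p) H"
proof (rule eq_matI)
  fix i j assume "i < dim_row (mat_fun (poly p) H)" "j < dim_col (mat_fun (poly p) H)"
  then have ij: "i < n" "j < n" using mat_fun_carrier[OF assms, of "poly p"] by auto
  have "poly p = (\<lambda>x. \<Sum>d\<le>degree p. coeff p d * x ^ d)" by (rule ext) (rule poly_altdef)
  then have "mat_fun (poly p) H $$ (i, j) = (\<Sum>d\<le>degree p. mat_fun (\<lambda>x. coeff p d * x ^ d) H $$ (i, j))"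
    using index_mat_fun_sum[OF assms ij, of "{..degree p}" "\<lambda>d x. coeff p d * x ^ d"] by simp
  also have "\<dots> = (\<Sum>d\<le>degree p. coeff p d * (H ^\<^sub>m d) $$ (i, j))"
    using ij assms(2) by (intro sum.cong) (auto simp: mat_fun_cmult[OF assms] mat_fun_power[OF assms])
  finally show "poly_mat p H $$ (i, j) = mat_fun (poly p) H $$ (i, j)"
    using ij assms(2) by (simp add: poly_mat_def)
qed (use assms in \<open>auto simp: poly_mat_def\<close>)

lemma the_mat_inverse:
  fixes X Y :: "complex mat"
  assumes X: "X \<in> carrier_mat n n" and Y: "Y \<in> carrier_mat n n" and XY: "X * Y = 1\<^sub>m n"
  shows "the (mat_inverse X) = Y"
proof (cases "mat_inverse X")
  case None
  have "Y * X = 1\<^sub>m n" using mat_mult_left_right_inverse[OF X Y XY] .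
  then have "X \<in> Units (ring_mat TYPE(complex) n ())"
    using X Y XY by (auto simp: Units_def ring_mat_simps)
  then show ?thesis using mat_inverse(1)[OF X None, of "()"] by blast
next
  case (Some B)
  then have B: "B * X = 1\<^sub>m n" "B \<in> carrier_mat n n" using mat_inverse(2)[OF X] by auto
  have "B = B * (X * Y)" using B by (simp add: XY)
  also have "\<dots> = (B * X) * Y" by (rule assoc_mult_mat[symmetric]) (use B X Y in auto)
  also have "\<dots> = Y" using B(1) Y by simp
  finally show ?thesis by (simp add: Some)
qed

lemma poly_pole_poly_eq_0_iff: "poly (pole_poly \<zeta>s) x = 0 \<longleftrightarrow> Some x \<in> set \<zeta>s"
  by (induction \<zeta>s) (auto simp: pole_poly_def split: option.splits)

lemma pole_poly_nonzero [simp]: "pole_poly \<zeta>s \<noteq> 0"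
  by (induction \<zeta>s) (auto simp: pole_poly_def split: option.splits)

lemma degree_pole_poly_le: "degree (pole_poly \<zeta>s) \<le> length \<zeta>s"
proof (induction \<zeta>s)
  case (Cons z \<zeta>s)
  have "pole_poly (z # \<zeta>s) = (case z of None \<Rightarrow> 1 | Some z \<Rightarrow> [:- z, 1:]) * pole_poly \<zeta>s"
    by (simp add: pole_poly_def)
  also have "degree \<dots> \<le> degree (case z of None \<Rightarrow> 1 | Some z \<Rightarrow> [:- z, 1:]) + degree (pole_poly \<zeta>s)"
    by (rule degree_mult_le)
  finally show ?case using Cons by (auto split: option.splits)
qed (simp add: pole_poly_def)

text \<open>Admissibility keeps \<open>q\<close> nonzero on the spectrum, so \<open>1/q\<close>
  under the functional calculus is the inverse of \<open>q(N)\<close>. The value 0 that HOL gives to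
  \<open>p/q\<close> at a zero of \<open>q\<close> never enters, since only eigenvalues
  count.\<close>

lemma rational_krylov_eq:
  assumes H: "hermitian N" "N \<in> carrier_mat n n" and c: "c \<in> carrier_vec n"
    and adm: "poles_admissible N \<zeta>s"
  shows "rational_krylov N c \<zeta>s =
    {mat_fun r N *\<^sub>v c |r. r \<in> rational_functions (length \<zeta>s) \<zeta>s}"
proof -
  define q where "q = pole_poly \<zeta>s"
  have q: "poly q x \<noteq> 0" if "eigenvalue N x" for x
    using adm that by (auto simp: poles_admissible_def q_def poly_pole_poly_eq_0_iff)
  define Y where "Y = mat_fun (\<lambda>x. 1 / poly q x) N"
  have Y: "Y \<in> carrier_mat n n" using mat_fun_carrier[OF H] by (simp add: Y_def)
  have "poly_mat q N * Y = mat_fun (\<lambda>x. poly q x * (1 / poly q x)) N"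
    using mat_fun_mult[OF H, of "poly q" "\<lambda>x. 1 / poly q x"] by (simp add: Y_def poly_mat_hermitian[OF H])
  also have "\<dots> = 1\<^sub>m n"
    using mat_fun_cong[OF H, of "\<lambda>x. poly q x * (1 / poly q x)" "\<lambda>_. 1"] q mat_fun_one[OF H]
    by simp
  finally have inv: "the (mat_inverse (poly_mat q N)) = Y"
    using Y H by (intro the_mat_inverse[of _ n]) (auto simp: poly_mat_def)
  have "Y *\<^sub>v (poly_mat p N *\<^sub>v c) = mat_fun (\<lambda>x. poly p x / poly q x) N *\<^sub>v c" for p
  proof -
    have "mat_fun (\<lambda>x. poly p x / poly q x) N = Y * poly_mat p N"
      using mat_fun_mult[OF H, of "\<lambda>x. 1 / poly q x" "poly p"] by (simp add: Y_def poly_mat_hermitian[OF H])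
    then show ?thesis
      using Y c mat_fun_carrier[OF H, of "poly p"]
      by (simp add: poly_mat_hermitian[OF H] assoc_mult_mat_vec[of _ n n _ n])
  qed
  then show ?thesis
    unfolding rational_krylov_def rational_functions_def q_def[symmetric] inv by (auto; metis)
qed

text \<open>Conjugating coefficients sends the factor of a pole to the factor of the conjugate pole
  (1 for infinity). The product depends only on the multiset of factors, which conjugation
  preserves.\<close>

lemma cnj_closed_pole_poly:
  assumes "cnj_closed \<zeta>s"
  shows "map_poly cnj (pole_poly \<zeta>s) = pole_poly \<zeta>s"
proof -
  have hom: "map_poly cnj (p * q) = map_poly cnj p * map_poly cnj q" for p q :: "complex poly"
    by (rule poly_eqI) (simp add: coeff_map_poly coeff_mult)
  define g where "g = (\<lambda>\<zeta>. case \<zeta> of None \<Rightarrow> 1 | Some (z :: complex) \<Rightarrow> [:- z, 1:])"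
  have "map_poly cnj (g \<zeta>) = g (map_option cnj \<zeta>)" for \<zeta>
    by (cases \<zeta>) (simp_all add: g_def map_poly_pCons map_poly_1')
  then have "map_poly cnj (pole_poly \<zeta>s) = pole_poly (map (map_option cnj) \<zeta>s)"
    unfolding pole_poly_def g_def[symmetric]
    by (induction \<zeta>s) (simp_all add: hom map_poly_1')
  also have "\<dots> = prod_mset (image_mset g (mset (map (map_option cnj) \<zeta>s)))"
    unfolding pole_poly_def g_def[symmetric]
    by (metis mset_map prod_mset_prod_list)
  also have "\<dots> = pole_poly \<zeta>s"
    using assms unfolding cnj_closed_def pole_poly_def g_def[symmetric]
    by (metis mset_map prod_mset_prod_list)
  finally show ?thesis .
qed

section \<open>Functions of compressions\<close>

lemma compress_carrier: "V \<in> carrier_mat n a \<Longrightarrow> compress V A \<in> carrier_mat a a"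
  by (auto simp: compress_def)

lemma dim_compress [simp]:
  "dim_row (compress V A) = dim_col V" "dim_col (compress V A) = dim_col V"
  by (simp_all add: compress_def)

lemma compress_hermitian:
  assumes "hermitian A" "A \<in> carrier_mat n n" "V \<in> carrier_mat n a"
  shows "hermitian (compress V A)"
proof -
  have V: "mat_adjoint V \<in> carrier_mat a n" using assms(3) by simp
  have "mat_adjoint (compress V A) = mat_adjoint V * mat_adjoint (mat_adjoint V * A)"
    unfolding compress_def by (rule mat_adjoint_mult[OF mult_carrier_mat[OF V assms(2)] assms(3)])
  also have "\<dots> = mat_adjoint V * (A * V)"
    using mat_adjoint_mult[OF V assms(2)] assms(1) by (simp add: hermitian_def)
  also have "\<dots> = compress V A"
    unfolding compress_def using assoc_mult_mat[OF V assms(2,3)] by simp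
  finally have "mat_adjoint (compress V A) = compress V A" .
  moreover have "compress V A \<in> carrier_mat (dim_row (compress V A)) (dim_row (compress V A))"
    by (rule carrier_matI) simp_all
  ultimately show ?thesis unfolding hermitian_def by blast
qed

lemma compress_mult_vec:
  assumes "A \<in> carrier_mat n n" "V \<in> carrier_mat n a" "x \<in> carrier_vec a"
  shows "compress V A *\<^sub>v x = mat_adjoint V *\<^sub>v (A *\<^sub>v (V *\<^sub>v x))"
proof -
  have V: "mat_adjoint V \<in> carrier_mat a n" using assms(2) by simp
  have "compress V A *\<^sub>v x = (mat_adjoint V * A) *\<^sub>v (V *\<^sub>v x)"
    unfolding compress_def by (rule assoc_mult_mat_vec[OF mult_carrier_mat[OF V assms(1)] assms(2,3)])
  also have "\<dots> = mat_adjoint V *\<^sub>v (A *\<^sub>v (V *\<^sub>v x))"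
    by (rule assoc_mult_mat_vec[OF V assms(1) mult_mat_vec_carrier[OF assms(2,3)]])
  finally show ?thesis .
qed

text \<open>An isometry turns Rayleigh quotients of the compression into Rayleigh quotients of
  \<open>A\<close>. Hence a bound, or the absence of poles, on the field of values of
  \<open>A\<close> serves all compressions at once.\<close>

lemma field_of_values_compress:
  assumes A: "A \<in> carrier_mat n n" and V: "V \<in> carrier_mat n a" and VV: "mat_adjoint V * V = 1\<^sub>m a"
  shows "field_of_values (compress V A) \<subseteq> field_of_values A"
proof
  fix z assume "z \<in> field_of_values (compress V A)"
  then obtain x where x: "x \<in> carrier_vec a" "norm2 x = 1" "z = (compress V A *\<^sub>v x) \<bullet>c x"
    using compress_carrier[OF V, of A] by (auto simp: field_of_values_def)
  have Vx: "V *\<^sub>v x \<in> carrier_vec n" using V x by simp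
  have "z = (A *\<^sub>v (V *\<^sub>v x)) \<bullet>c (V *\<^sub>v x)"
    using cscalar_prod_mult_mat_vec[of "mat_adjoint V" a n "A *\<^sub>v (V *\<^sub>v x)" x] V x Vx
      mult_mat_vec_carrier[OF A Vx]
    by (simp add: compress_mult_vec[OF A V])
  then show "z \<in> field_of_values A"
    using Vx A norm2_isometry[OF V VV x(1)] x(2) by (auto simp: field_of_values_def)
qed

lemma smult_mat_mult_vec:
  fixes M :: "complex mat"
  assumes "M \<in> carrier_mat m n" "x \<in> carrier_vec n"
  shows "(c \<cdot>\<^sub>m M) *\<^sub>v x = c \<cdot>\<^sub>v (M *\<^sub>v x)"
  using assms by (intro eq_vecI) auto

section \<open>Orthogonal projections and projected matrix functions\<close>

definition isometry_mat :: "nat \<Rightarrow> complex mat \<Rightarrow> bool" where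
  "isometry_mat n V \<longleftrightarrow> dim_row V = n \<and> mat_adjoint V * V = 1\<^sub>m (dim_col V)"

text \<open>The orthogonal projection onto the column range when the columns are orthonormal.
  Membership in that range becomes the coordinate-free equation
  \<open>orth_proj V x = x\<close>.\<close>

definition orth_proj :: "complex mat \<Rightarrow> complex vec \<Rightarrow> complex vec" where
  "orth_proj V x = V *\<^sub>v (mat_adjoint V *\<^sub>v x)"

text \<open>
  If the columns of \<open>V\<close> are orthonormal, \<open>proj_fun A V g b\<close> is \<open>V g(V\<^sup>H A V) V\<^sup>H b\<close>. Every vector
  occurring in the algorithm has this form, which replaces the growing coordinate vectors by
  vectors of fixed length.
\<close>

definition proj_fun ::
  "complex mat \<Rightarrow> complex mat \<Rightarrow> (complex \<Rightarrow> complex) \<Rightarrow> complex vec \<Rightarrow> complex vec" where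
  "proj_fun A V g b = V *\<^sub>v (mat_fun g (compress V A) *\<^sub>v (mat_adjoint V *\<^sub>v b))"

lemma dim_orth_proj [simp]: "dim_vec (orth_proj V x) = dim_row V"
  by (simp add: orth_proj_def)

lemma dim_proj_fun [simp]: "dim_vec (proj_fun A V g b) = dim_row V"
  by (simp add: proj_fun_def)

lemma isometry_mat_carrier: "isometry_mat n V \<Longrightarrow> V \<in> carrier_mat n (dim_col V)"
  by (rule carrier_matI) (simp_all add: isometry_mat_def)

lemma isometry_mat_dim: "isometry_mat n V \<Longrightarrow> dim_row V = n"
  unfolding isometry_mat_def by blast

lemma isometry_matD: "isometry_mat n V \<Longrightarrow> mat_adjoint V * V = 1\<^sub>m (dim_col V)"
  by (simp add: isometry_mat_def)

lemma adjoint_mult_vec_carrier: "dim_col V = a \<Longrightarrow> mat_adjoint V *\<^sub>v x \<in> carrier_vec a"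
  by (rule carrier_vecI) simp

lemma isometry_mat_cancel:
  assumes "isometry_mat n V" "x \<in> carrier_vec (dim_col V)"
  shows "mat_adjoint V *\<^sub>v (V *\<^sub>v x) = x"
  using assoc_mult_mat_vec[of "mat_adjoint V" "dim_col V" n V "dim_col V" x]
    mat_adjoint_carrier[OF isometry_mat_carrier[OF assms(1)]] isometry_mat_carrier[OF assms(1)]
    assms(2) by (simp only: isometry_matD[OF assms(1)] one_mult_mat_vec)

lemma orth_proj_carrier [simp]: "dim_row V = n \<Longrightarrow> orth_proj V x \<in> carrier_vec n"
  by (rule carrier_vecI) (simp add: orth_proj_def)

lemma orth_proj_mult [simp]:
  assumes "isometry_mat n V" "x \<in> carrier_vec (dim_col V)"
  shows "orth_proj V (V *\<^sub>v x) = V *\<^sub>v x"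
  using isometry_mat_cancel[OF assms] by (simp add: orth_proj_def)

lemma orth_proj_idem [simp]:
  assumes "isometry_mat n V"
  shows "orth_proj V (orth_proj V x) = orth_proj V x"
  unfolding orth_proj_def[of V x]
  by (rule orth_proj_mult[OF assms]) (rule adjoint_mult_vec_carrier[OF refl])

lemma
  assumes "isometry_mat n V" "x \<in> carrier_vec n"
  shows orth_proj_add: "y \<in> carrier_vec n \<Longrightarrow> orth_proj V (x + y) = orth_proj V x + orth_proj V y"
    and orth_proj_diff: "y \<in> carrier_vec n \<Longrightarrow> orth_proj V (x - y) = orth_proj V x - orth_proj V y"
    and orth_proj_smult: "orth_proj V (c \<cdot>\<^sub>v x) = c \<cdot>\<^sub>v orth_proj V x"
proof -
  define a where "a = dim_col V"
  have V: "V \<in> carrier_mat n a" "mat_adjoint V \<in> carrier_mat a n"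
    using isometry_mat_carrier[OF assms(1)] mat_adjoint_carrier[OF isometry_mat_carrier[OF assms(1)]]
    unfolding a_def by blast+
  note c = adjoint_mult_vec_carrier[of V a, OF a_def[symmetric]]
  show "y \<in> carrier_vec n \<Longrightarrow> orth_proj V (x + y) = orth_proj V x + orth_proj V y"
    using V c assms(2)
    by (simp add: orth_proj_def mult_add_distrib_mat_vec[of _ a n] mult_add_distrib_mat_vec[of _ n a])
  show "y \<in> carrier_vec n \<Longrightarrow> orth_proj V (x - y) = orth_proj V x - orth_proj V y"
    using V c assms(2)
    by (simp add: orth_proj_def mult_minus_distrib_mat_vec[of _ a n] mult_minus_distrib_mat_vec[of _ n a])
  show "orth_proj V (c \<cdot>\<^sub>v x) = c \<cdot>\<^sub>v orth_proj V x"
    using V c assms(2)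
    by (simp add: orth_proj_def mult_mat_vec[of _ a n] mult_mat_vec[of _ n a])
qed

lemma orth_proj_zero [simp]:
  assumes V: "isometry_mat n V"
  shows "orth_proj V (0\<^sub>v n) = 0\<^sub>v n"
proof -
  have 0: "0 \<cdot>\<^sub>v x = 0\<^sub>v n" if "x \<in> carrier_vec n" for x :: "complex vec"
    using that by (intro eq_vecI) auto
  have "orth_proj V (0 \<cdot>\<^sub>v 0\<^sub>v n) = 0 \<cdot>\<^sub>v orth_proj V (0\<^sub>v n)"
    by (rule orth_proj_smult[OF V]) simp
  then show ?thesis using V by (simp add: 0 isometry_mat_def)
qed

lemma orth_proj_sym:
  assumes "isometry_mat n V" "x \<in> carrier_vec n" "y \<in> carrier_vec n"
  shows "orth_proj V x \<bullet>c y = x \<bullet>c orth_proj V y"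
proof -
  define a where "a = dim_col V"
  have V: "V \<in> carrier_mat n a" "mat_adjoint V \<in> carrier_mat a n"
    using isometry_mat_carrier[OF assms(1)] mat_adjoint_carrier[OF isometry_mat_carrier[OF assms(1)]]
    unfolding a_def by blast+
  note c = adjoint_mult_vec_carrier[of V a, OF a_def[symmetric]]
  have "orth_proj V x \<bullet>c y = (mat_adjoint V *\<^sub>v x) \<bullet>c (mat_adjoint V *\<^sub>v y)"
    unfolding orth_proj_def by (rule cscalar_prod_mult_mat_vec[OF V(1) c assms(3)])
  also have "\<dots> = x \<bullet>c orth_proj V y"
    using cscalar_prod_mult_mat_vec[OF V(2) assms(2) c] by (simp add: orth_proj_def)
  finally show ?thesis .
qed

locale hermitian_mat =
  fixes A :: "complex mat" and n :: nat
  assumes A: "A \<in> carrier_mat n n" and hermitian: "hermitian A"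
begin

lemma op_carrier [simp]: "A *\<^sub>v x \<in> carrier_vec n"
  using A by (intro carrier_vecI) simp

lemma
  assumes "x \<in> carrier_vec n"
  shows op_add: "y \<in> carrier_vec n \<Longrightarrow> A *\<^sub>v (x + y) = A *\<^sub>v x + A *\<^sub>v y"
    and op_diff: "y \<in> carrier_vec n \<Longrightarrow> A *\<^sub>v (x - y) = A *\<^sub>v x - A *\<^sub>v y"
    and op_smult: "A *\<^sub>v (c \<cdot>\<^sub>v x) = c \<cdot>\<^sub>v (A *\<^sub>v x)"
  using assms A
  by (auto simp: mult_add_distrib_mat_vec[of _ n n] mult_minus_distrib_mat_vec[of _ n n] mult_mat_vec[of _ n n])

context
  fixes V assumes V: "isometry_mat n V"
begin

lemma dim_V [simp]: "dim_row V = n" using V by (simp add: isometry_mat_def)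

lemma compress_V: "compress V A \<in> carrier_mat (dim_col V) (dim_col V)" "hermitian (compress V A)"
  using compress_carrier[OF isometry_mat_carrier[OF V]]
    compress_hermitian[OF hermitian A isometry_mat_carrier[OF V]] by blast+

lemma eigenvalue_compress: "eigenvalue (compress V A) z \<Longrightarrow> z \<in> field_of_values A"
  using eigenvalue_in_field_of_values[OF compress_V(1)]
    field_of_values_compress[OF A isometry_mat_carrier[OF V] isometry_matD[OF V]] by blast

lemma mat_fun_vec_carrier: "mat_fun g (compress V A) *\<^sub>v x \<in> carrier_vec (dim_col V)"
  using compress_V(2) by (intro carrier_vecI) simp

lemma proj_fun_carrier [simp]: "proj_fun A V g b \<in> carrier_vec n"
  by (intro carrier_vecI) (simp add: proj_fun_def)

lemma orth_proj_proj_fun [simp]: "orth_proj V (proj_fun A V g b) = proj_fun A V g b"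
  unfolding proj_fun_def by (rule orth_proj_mult[OF V mat_fun_vec_carrier])

text \<open>Multiplying the symbol by x amounts to applying \<open>A\<close> and projecting back.
  The recursions in the exactness proof all come from this identity.\<close>

lemma proj_fun_mult_id:
  assumes b: "b \<in> carrier_vec n"
  shows "proj_fun A V (\<lambda>x. x * g x) b = orth_proj V (A *\<^sub>v proj_fun A V g b)"
proof -
  define a where "a = dim_col V"
  have c: "V \<in> carrier_mat n a" "mat_adjoint V \<in> carrier_mat a n" "compress V A \<in> carrier_mat a a"
      "mat_adjoint V *\<^sub>v b \<in> carrier_vec a" "mat_fun g (compress V A) \<in> carrier_mat a a"
    using isometry_mat_carrier[OF V] compress_V adjoint_mult_vec_carrier[OF refl]
      mat_fun_carrier[OF compress_V(2,1)] mat_adjoint_carrier[OF isometry_mat_carrier[OF V]]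
    unfolding a_def by blast+
  have "proj_fun A V (\<lambda>x. x * g x) b =
      V *\<^sub>v (compress V A *\<^sub>v (mat_fun g (compress V A) *\<^sub>v (mat_adjoint V *\<^sub>v b)))"
    using mat_fun_mult[OF compress_V(2,1), of "\<lambda>x. x" g] c mat_fun_id[OF compress_V(2,1)]
    by (simp add: proj_fun_def assoc_mult_mat_vec[of _ a a _ a])
  then show ?thesis
    using compress_mult_vec[OF A c(1) mat_fun_vec_carrier[of g, folded a_def]]
    by (simp add: orth_proj_def proj_fun_def)
qed

lemma proj_fun_add:
  assumes b: "b \<in> carrier_vec n"
  shows "proj_fun A V (\<lambda>x. f x + g x) b = proj_fun A V f b + proj_fun A V g b"
proof -
  define a where "a = dim_col V"
  have c: "V \<in> carrier_mat n a" "mat_adjoint V *\<^sub>v b \<in> carrier_vec a"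
      "mat_fun g (compress V A) \<in> carrier_mat a a" "mat_fun f (compress V A) \<in> carrier_mat a a"
    using isometry_mat_carrier[OF V] compress_V adjoint_mult_vec_carrier[OF refl]
      mat_fun_carrier[OF compress_V(2,1)] mat_adjoint_carrier[OF isometry_mat_carrier[OF V]]
    unfolding a_def by blast+
  show ?thesis
    using mat_fun_add[OF compress_V(2,1), of f g] c mat_fun_vec_carrier[folded a_def]
    by (simp add: proj_fun_def add_mult_distrib_mat_vec[of _ a a] mult_add_distrib_mat_vec[of _ n a])
qed

lemma proj_fun_cmult:
  assumes b: "b \<in> carrier_vec n"
  shows "proj_fun A V (\<lambda>x. c * f x) b = c \<cdot>\<^sub>v proj_fun A V f b"
proof -
  define a where "a = dim_col V"
  have c: "V \<in> carrier_mat n a" "mat_adjoint V *\<^sub>v b \<in> carrier_vec a"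
      "mat_fun f (compress V A) \<in> carrier_mat a a"
    using isometry_mat_carrier[OF V] compress_V adjoint_mult_vec_carrier[OF refl]
      mat_fun_carrier[OF compress_V(2,1)] mat_adjoint_carrier[OF isometry_mat_carrier[OF V]]
    unfolding a_def by blast+
  have "mat_fun (\<lambda>x. c * f x) (compress V A) *\<^sub>v (mat_adjoint V *\<^sub>v b) =
      c \<cdot>\<^sub>v (mat_fun f (compress V A) *\<^sub>v (mat_adjoint V *\<^sub>v b))"
    using c by (simp add: mat_fun_cmult[OF compress_V(2,1)] smult_mat_mult_vec[of _ a a])
  then show ?thesis
    using c mat_fun_vec_carrier[folded a_def] by (simp add: proj_fun_def mult_mat_vec[of _ n a])
qed

lemma proj_fun_cong:
  assumes "\<And>x. x \<in> field_of_values A \<Longrightarrow> f x = g x"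
  shows "proj_fun A V f b = proj_fun A V g b"
  using mat_fun_cong[OF compress_V(2,1), of f g] eigenvalue_compress assms by (simp add: proj_fun_def)

lemma proj_fun_one:
  assumes b: "b \<in> carrier_vec n"
  shows "proj_fun A V (\<lambda>_. 1) b = orth_proj V b"
  using mat_fun_one[OF compress_V(2,1)] adjoint_mult_vec_carrier[of V "dim_col V" b]
  by (simp add: proj_fun_def orth_proj_def)

lemma proj_fun_const:
  assumes b: "b \<in> carrier_vec n"
  shows "proj_fun A V (\<lambda>_. c) b = c \<cdot>\<^sub>v orth_proj V b"
  using proj_fun_cmult[OF b, of c "\<lambda>_. 1"] proj_fun_one[OF b] by simp

text \<open>The compression is Hermitian, so a function of it has the conjugate function as adjoint.
  This moves the function from the starting vector to the coupling vector.\<close>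

lemma proj_fun_adjoint:
  assumes b: "b \<in> carrier_vec n" and h: "h \<in> carrier_vec n"
  shows "proj_fun A V g b \<bullet>c h = b \<bullet>c proj_fun A V (\<lambda>x. cnj (g x)) h"
proof -
  define a where "a = dim_col V"
  have c: "V \<in> carrier_mat n a" "mat_adjoint V \<in> carrier_mat a n"
    "mat_fun g (compress V A) \<in> carrier_mat a a"
    using isometry_mat_carrier[OF V] compress_V
      mat_fun_carrier[OF compress_V(2,1)] mat_adjoint_carrier[OF isometry_mat_carrier[OF V]]
    unfolding a_def by blast+
  note cv = adjoint_mult_vec_carrier[of V a, OF a_def[symmetric]] mat_fun_vec_carrier[folded a_def]
  have "proj_fun A V g b \<bullet>c h =
      (mat_fun g (compress V A) *\<^sub>v (mat_adjoint V *\<^sub>v b)) \<bullet>c (mat_adjoint V *\<^sub>v h)"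
    unfolding proj_fun_def by (rule cscalar_prod_mult_mat_vec[OF c(1) cv(2) h])
  also have "\<dots> = (mat_adjoint V *\<^sub>v b) \<bullet>c
      (mat_fun (\<lambda>x. cnj (g x)) (compress V A) *\<^sub>v (mat_adjoint V *\<^sub>v h))"
    using cscalar_prod_mult_mat_vec[OF c(3) cv(1) cv(1), of b h] mat_fun_adjoint[OF compress_V(2,1), of g]
    by simp
  also have "\<dots> = b \<bullet>c proj_fun A V (\<lambda>x. cnj (g x)) h"
    using cscalar_prod_mult_mat_vec[OF c(2) b cv(2)] by (simp add: proj_fun_def)
  finally show ?thesis .
qed

lemma norm2_proj_fun_le:
  assumes b: "b \<in> carrier_vec n" and e: "e \<ge> 0"
    and f: "\<And>z. z \<in> field_of_values A \<Longrightarrow> cmod (f z) \<le> e"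
  shows "norm2 (proj_fun A V f b) \<le> e * norm2 b"
proof -
  note cV = isometry_mat_carrier[OF V] isometry_matD[OF V]
  have "norm2 (proj_fun A V f b) = norm2 (mat_fun f (compress V A) *\<^sub>v (mat_adjoint V *\<^sub>v b))"
    unfolding proj_fun_def by (rule norm2_isometry[OF cV mat_fun_vec_carrier])
  also have "\<dots> \<le> e * norm2 (mat_adjoint V *\<^sub>v b)"
    by (rule norm2_mat_fun_le[OF compress_V(2,1) adjoint_mult_vec_carrier[OF refl]])
      (use f e eigenvalue_compress in auto)
  also have "\<dots> \<le> e * norm2 b"
    by (rule mult_left_mono[OF norm2_adjoint_isometry_le[OF cV b] e])
  finally show ?thesis .
qed

text \<open>The difference \<open>e\<close> of two solutions lies in the range of \<open>V\<close>
  and satisfies \<open>(A *\<^sub>v e) \<bullet>c e = z * (norm2 e)\<^sup>2\<close>; if it were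
  nonzero, \<open>z\<close> would be a Rayleigh quotient of \<open>A\<close>. This uniqueness takes
  the place of inverting shifted compressions when a factor x - z is divided out.\<close>

lemma shifted_compression_inj:
  assumes x: "x \<in> carrier_vec n" "orth_proj V x = x" and y: "y \<in> carrier_vec n" "orth_proj V y = y"
    and eq: "orth_proj V (A *\<^sub>v x) - z \<cdot>\<^sub>v x = orth_proj V (A *\<^sub>v y) - z \<cdot>\<^sub>v y"
    and z: "z \<notin> field_of_values A"
  shows "x = y"
proof (rule ccontr)
  assume "x \<noteq> y"
  define e where "e = x - y"
  have e: "e \<in> carrier_vec n" using x y by (simp add: e_def)
  have e0: "e \<noteq> 0\<^sub>v n"
  proof
    assume "e = 0\<^sub>v n"
    then have "vec_index e i = 0" if "i < n" for i using that by simp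
    then have "x $ i = y $ i" if "i < n" for i using that x y by (simp add: e_def)
    then show False using \<open>x \<noteq> y\<close> x y by (metis carrier_vecD eq_vecI)
  qed
  have Pe: "orth_proj V e = e"
    using orth_proj_diff[OF V, of x y] x y by (simp add: e_def)
  have "orth_proj V (A *\<^sub>v e) = orth_proj V (A *\<^sub>v x) - orth_proj V (A *\<^sub>v y)"
    using x y by (simp add: e_def op_diff orth_proj_diff[OF V])
  also have "\<dots> = z \<cdot>\<^sub>v e"
  proof (rule eq_vecI)
    fix i assume "i < dim_vec (z \<cdot>\<^sub>v e)"
    then have i: "i < n" using e by simp
    have "orth_proj V (A *\<^sub>v x) $ i - z * x $ i = orth_proj V (A *\<^sub>v y) $ i - z * y $ i"
      using arg_cong[OF eq, of "\<lambda>v. vec_index v i"] i x(1) y(1) by simp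
    then have "orth_proj V (A *\<^sub>v x) $ i = orth_proj V (A *\<^sub>v y) $ i - z * y $ i + z * x $ i"
      by (simp only: diff_eq_eq)
    then have "orth_proj V (A *\<^sub>v x) $ i - orth_proj V (A *\<^sub>v y) $ i = z * (x $ i - y $ i)"
      by (simp add: right_diff_distrib)
    then show "(orth_proj V (A *\<^sub>v x) - orth_proj V (A *\<^sub>v y)) $ i = (z \<cdot>\<^sub>v e) $ i"
      using i x(1) y(1) by (simp add: e_def)
  qed (use e in simp)
  finally have "(A *\<^sub>v e) \<bullet>c e = (z \<cdot>\<^sub>v e) \<bullet>c e"
    using orth_proj_sym[OF V, of "A *\<^sub>v e" e] e Pe by simp
  also have "\<dots> = z * (norm2 e)\<^sup>2" using e by (simp add: cscalar_prod_self)
  finally have Ae: "(A *\<^sub>v e) \<bullet>c e = z * (norm2 e)\<^sup>2" .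
  have pos: "norm2 e \<noteq> 0" using norm2_eq_0_iff e e0 by blast
  define u where "u = complex_of_real (1 / norm2 e) \<cdot>\<^sub>v e"
  have u: "u \<in> carrier_vec n" "norm2 u = 1"
    using e pos by (auto simp: u_def norm2_smult norm_divide)
  have "(A *\<^sub>v u) \<bullet>c u = complex_of_real (1 / norm2 e) * (complex_of_real (1 / norm2 e) * ((A *\<^sub>v e) \<bullet>c e))"
    using e by (simp add: u_def op_smult conjugate_smult_vec smult_scalar_prod_distrib[of _ n]
        scalar_prod_smult_distrib[of _ n])
  also have "\<dots> = z" using pos by (simp add: Ae power2_eq_square)
  finally show False using z u A by (auto simp: field_of_values_def)
qed

end

end

section \<open>Exactness of one compression step\<close>

lemma smult_zero_vec_right [simp]: "(c :: complex) \<cdot>\<^sub>v 0\<^sub>v n = 0\<^sub>v n"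
  by (rule eq_vecI) auto

lemma diff_zero_vec_right [simp]: "(x :: complex vec) \<in> carrier_vec n \<Longrightarrow> x - 0\<^sub>v n = x"
  by (rule eq_vecI) auto

context hermitian_mat
begin

lemma dim_A [simp]: "dim_row A = n" using A by simp

text \<open>The gain from the larger space \<open>Y\<close> over the smaller space \<open>W\<close>,
  which in the applications is contained in it.\<close>

definition proj_fun_diff where
  "proj_fun_diff Y W r b = proj_fun A Y r b - proj_fun A W r b"

lemma dim_proj_fun_diff [simp]: "dim_vec (proj_fun_diff Y W r b) = dim_row W"
  by (simp add: proj_fun_diff_def)

context
  fixes Y W :: "complex mat" and b t :: "complex vec" and \<kappa> :: complex
  assumes Y: "isometry_mat n Y" and W: "isometry_mat n W" and b: "b \<in> carrier_vec n"
    and t: "t \<in> carrier_vec n"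
begin

lemma dims_YW [simp]: "dim_row Y = n" "dim_row W = n"
  using Y W by (auto simp: isometry_mat_def)

lemma proj_fun_diff_carrier [simp]: "proj_fun_diff Y W r b \<in> carrier_vec n"
  by (rule carrier_vecI) (simp add: proj_fun_diff_def)

lemma proj_fun_diff_add:
  "proj_fun_diff Y W (\<lambda>x. f x + g x) b = proj_fun_diff Y W f b + proj_fun_diff Y W g b"
  by (rule eq_vecI) (auto simp: proj_fun_diff_def proj_fun_add[OF Y b] proj_fun_add[OF W b])

lemma proj_fun_diff_cmult:
  "proj_fun_diff Y W (\<lambda>x. c * f x) b = c \<cdot>\<^sub>v proj_fun_diff Y W f b"
  by (rule eq_vecI)
    (auto simp: proj_fun_diff_def proj_fun_cmult[OF Y b] proj_fun_cmult[OF W b] algebra_simps)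

lemma proj_fun_diff_cong:
  "(\<And>x. x \<in> field_of_values A \<Longrightarrow> f x = g x) \<Longrightarrow> proj_fun_diff Y W f b = proj_fun_diff Y W g b"
  unfolding proj_fun_diff_def using proj_fun_cong[OF Y, of f g] proj_fun_cong[OF W, of f g] by simp

text \<open>The hypothesis says that, seen from \<open>Y\<close>, applying \<open>A\<close> leaves
  the range of \<open>W\<close> only along \<open>t\<close>. So the gain obeys the recursion of
  \<open>Y\<close> with the multiple of \<open>t\<close> as source.\<close>

lemma proj_fun_diff_mult_id:
  assumes "orth_proj Y (A *\<^sub>v proj_fun A W r b) = orth_proj W (A *\<^sub>v proj_fun A W r b) + \<kappa> \<cdot>\<^sub>v t"
  shows "proj_fun_diff Y W (\<lambda>x. x * r x) b = orth_proj Y (A *\<^sub>v proj_fun_diff Y W r b) + \<kappa> \<cdot>\<^sub>v t"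
proof -
  define a where "a = proj_fun A Y r b"
  define c where "c = proj_fun A W r b"
  have ac: "a \<in> carrier_vec n" "c \<in> carrier_vec n" using Y W by (simp_all add: a_def c_def)
  have "orth_proj Y (A *\<^sub>v (a - c)) = orth_proj Y (A *\<^sub>v a) - orth_proj Y (A *\<^sub>v c)"
    using ac by (simp add: op_diff orth_proj_diff[OF Y])
  then show ?thesis
    using assms t
    by (intro eq_vecI)
      (auto simp: proj_fun_diff_def proj_fun_mult_id[OF Y b] proj_fun_mult_id[OF W b] simp flip: a_def c_def)
qed

text \<open>The recursion read backwards: on the field of values
  \<open>x * r' x = z * r' x + r x\<close>, which turns it into a shifted equation for the gain of
  \<open>r'\<close>.\<close>

lemma proj_fun_diff_div:
  assumes "orth_proj Y (A *\<^sub>v proj_fun A W r' b) = orth_proj W (A *\<^sub>v proj_fun A W r' b) + \<kappa> \<cdot>\<^sub>v t"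
    and r: "\<And>x. x \<in> field_of_values A \<Longrightarrow> (x - z) * r' x = r x"
  shows "orth_proj Y (A *\<^sub>v proj_fun_diff Y W r' b) - z \<cdot>\<^sub>v proj_fun_diff Y W r' b =
    proj_fun_diff Y W r b - \<kappa> \<cdot>\<^sub>v t"
proof -
  have "proj_fun_diff Y W (\<lambda>x. x * r' x) b = proj_fun_diff Y W (\<lambda>x. z * r' x + r x) b"
    by (rule proj_fun_diff_cong) (use r in \<open>auto simp: algebra_simps eq_diff_eq\<close>)
  also have "\<dots> = z \<cdot>\<^sub>v proj_fun_diff Y W r' b + proj_fun_diff Y W r b"
    by (simp add: proj_fun_diff_add proj_fun_diff_cmult)
  finally have eq: "orth_proj Y (A *\<^sub>v proj_fun_diff Y W r' b) + \<kappa> \<cdot>\<^sub>v t =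
      z \<cdot>\<^sub>v proj_fun_diff Y W r' b + proj_fun_diff Y W r b"
    using proj_fun_diff_mult_id[OF assms(1)] by simp
  show ?thesis
  proof (rule eq_vecI)
    fix i assume "i < dim_vec (proj_fun_diff Y W r b - \<kappa> \<cdot>\<^sub>v t)"
    then have "i < n" using t by simp
    then show "(orth_proj Y (A *\<^sub>v proj_fun_diff Y W r' b) - z \<cdot>\<^sub>v proj_fun_diff Y W r' b) $ i =
        (proj_fun_diff Y W r b - \<kappa> \<cdot>\<^sub>v t) $ i"
      using arg_cong[OF eq, of "\<lambda>v. vec_index v i"] t by (simp add: algebra_simps)
  qed (use t in simp)
qed

end

end

text \<open>
  One step replaces the range of \<open>V\<close> by the smaller range of \<open>V'\<close>; the columns of \<open>T\<close> are the basis
  vectors not yet processed, \<open>Z\<close> and \<open>Z'\<close> span the ranges of \<open>V\<close> and \<open>V'\<close> together with that of \<open>T\<close>.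
  The coupling between \<open>V\<close> and \<open>T\<close> has rank one and is carried by \<open>h = V\<beta>\<close> and the first column \<open>t\<close>
  of \<open>T\<close>. With \<open>D r\<close> and \<open>D' r\<close> the effects of this coupling before and after the step, the step is
  exact for \<open>r\<close> iff \<open>D r = D' r\<close>. Both sides obey the same recursion under \<open>r \<mapsto> x r\<close> and
  \<open>r \<mapsto> r/(x - z)\<close>, provided that the component of \<open>D r\<close> in the range of \<open>V\<close> stays in the range of \<open>V'\<close>.
\<close>

locale galerkin_step = hermitian_mat A n for A n +
  fixes V V' T Z Z' :: "complex mat" and h t b :: "complex vec"
  assumes V: "isometry_mat n V" and V': "isometry_mat n V'" and T: "isometry_mat n T"
    and Z: "isometry_mat n Z" and Z': "isometry_mat n Z'"
    and h: "h \<in> carrier_vec n" "orth_proj V h = h"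
    and t: "t \<in> carrier_vec n" "orth_proj T t = t"
    and b: "b \<in> carrier_vec n"
    and PZ: "\<And>x. x \<in> carrier_vec n \<Longrightarrow> orth_proj Z x = orth_proj V x + orth_proj T x"
    and PZ': "\<And>x. x \<in> carrier_vec n \<Longrightarrow> orth_proj Z' x = orth_proj V' x + orth_proj T x"
    and VV': "\<And>x. x \<in> carrier_vec n \<Longrightarrow> orth_proj V (orth_proj V' x) = orth_proj V' x"
    and V'V: "\<And>x. x \<in> carrier_vec n \<Longrightarrow> orth_proj V' (orth_proj V x) = orth_proj V' x"
    and VT: "\<And>x. x \<in> carrier_vec n \<Longrightarrow> orth_proj V (orth_proj T x) = 0\<^sub>v n"
    and TV: "\<And>x. x \<in> carrier_vec n \<Longrightarrow> orth_proj T (orth_proj V x) = 0\<^sub>v n"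
    and VAT: "\<And>x. \<lbrakk>x \<in> carrier_vec n; orth_proj T x = x\<rbrakk> \<Longrightarrow> orth_proj V (A *\<^sub>v x) = (x \<bullet>c t) \<cdot>\<^sub>v h"
    and TAV: "\<And>x. \<lbrakk>x \<in> carrier_vec n; orth_proj V x = x\<rbrakk> \<Longrightarrow> orth_proj T (A *\<^sub>v x) = (x \<bullet>c h) \<cdot>\<^sub>v t"
begin

lemma dims [simp]: "dim_row V = n" "dim_row V' = n" "dim_row T = n" "dim_row Z = n" "dim_row Z' = n"
  using V V' T Z Z' unfolding isometry_mat_def by blast+

abbreviation "X \<equiv> field_of_values A"
abbreviation "D r \<equiv> proj_fun_diff Z V r b"
abbreviation "D' r \<equiv> proj_fun_diff Z' V' r b"

lemma pf_carriers [simp]: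
  "proj_fun A V r y \<in> carrier_vec n" "proj_fun A V' r y \<in> carrier_vec n"
  "proj_fun A Z r y \<in> carrier_vec n" "proj_fun A Z' r y \<in> carrier_vec n"
  using V V' Z Z' by simp_all

lemma D_carriers [simp]: "D r \<in> carrier_vec n" "D' r \<in> carrier_vec n"
  by (rule carrier_vecI, simp add: proj_fun_diff_def)+

lemma pf_ranges [simp]:
  "orth_proj V (proj_fun A V r y) = proj_fun A V r y"
  "orth_proj V' (proj_fun A V' r y) = proj_fun A V' r y"
  "orth_proj Z (proj_fun A Z r y) = proj_fun A Z r y"
  "orth_proj Z' (proj_fun A Z' r y) = proj_fun A Z' r y"
  using V V' Z Z' by simp_all

lemma V_pf_V' [simp]: "orth_proj V (proj_fun A V' r y) = proj_fun A V' r y"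
  using VV'[of "proj_fun A V' r y"] by simp

lemma V'T: "x \<in> carrier_vec n \<Longrightarrow> orth_proj V' (orth_proj T x) = 0\<^sub>v n"
  using V'V[of "orth_proj T x"] VT[of x] V' by simp

lemma TV': "x \<in> carrier_vec n \<Longrightarrow> orth_proj T (orth_proj V' x) = 0\<^sub>v n"
  using TV[of "orth_proj V' x"] VV'[of x] by simp

lemma T_pf: "orth_proj T (proj_fun A V r y) = 0\<^sub>v n" "orth_proj T (proj_fun A V' r y) = 0\<^sub>v n"
  using TV[of "proj_fun A V r y"] TV'[of "proj_fun A V' r y"] by simp_all

lemma coupling_V:
  "orth_proj Z (A *\<^sub>v proj_fun A V r b) =
    orth_proj V (A *\<^sub>v proj_fun A V r b) + (proj_fun A V r b \<bullet>c h) \<cdot>\<^sub>v t"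
  using PZ[of "A *\<^sub>v proj_fun A V r b"] TAV[of "proj_fun A V r b"] by simp

lemma coupling_V':
  "orth_proj Z' (A *\<^sub>v proj_fun A V' r b) =
    orth_proj V' (A *\<^sub>v proj_fun A V' r b) + (proj_fun A V' r b \<bullet>c h) \<cdot>\<^sub>v t"
  using PZ'[of "A *\<^sub>v proj_fun A V' r b"] TAV[of "proj_fun A V' r b"] by simp

lemma Z_D: "orth_proj Z (D r) = D r"
proof -
  have "orth_proj Z (proj_fun A V r b) = proj_fun A V r b"
    using PZ[of "proj_fun A V r b"] T_pf by simp
  then show ?thesis by (simp add: proj_fun_diff_def orth_proj_diff[OF Z])
qed

lemma Z'_D': "orth_proj Z' (D' r) = D' r"
proof -
  have "orth_proj Z' (proj_fun A V' r b) = proj_fun A V' r b"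
    using PZ'[of "proj_fun A V' r b"] T_pf by simp
  then show ?thesis by (simp add: proj_fun_diff_def orth_proj_diff[OF Z'])
qed

lemma D_split: "D r = orth_proj V (D r) + orth_proj T (D r)"
  using Z_D[of r] PZ[of "D r"] by simp

lemma VZ: "x \<in> carrier_vec n \<Longrightarrow> orth_proj V (orth_proj Z x) = orth_proj V x"
  using V VT[of x] by (simp add: PZ orth_proj_add[OF V])

lemma Z'Z: "x \<in> carrier_vec n \<Longrightarrow> orth_proj Z' (orth_proj Z x) = orth_proj Z' x"
  using T VT[of x] TV[of x] V'T[of x] V'V[of x]
  by (simp add: PZ PZ' orth_proj_add[OF V'] orth_proj_add[OF T])

lemma V_t: "orth_proj V t = 0\<^sub>v n"
  using VT[of t] t by simp

lemma Z'_t: "orth_proj Z' t = t"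
  using V'T[of t] t by (simp add: PZ')

text \<open>The component along \<open>T\<close> is shared by \<open>Z\<close> and
  \<open>Z'\<close>, so only the component in the range of \<open>V\<close> decides.\<close>

lemma in_range_Z':
  assumes "orth_proj V' (orth_proj V (D r)) = orth_proj V (D r)"
  shows "orth_proj Z' (D r) = D r"
  using assms V'V[of "D r"] D_split[of r] PZ'[of "D r"] by simp

lemma D_mult_id: "D (\<lambda>x. x * r x) = orth_proj Z (A *\<^sub>v D r) + (proj_fun A V r b \<bullet>c h) \<cdot>\<^sub>v t"
  by (rule proj_fun_diff_mult_id[OF Z V b t(1) coupling_V])

lemma D'_mult_id: "D' (\<lambda>x. x * r x) = orth_proj Z' (A *\<^sub>v D' r) + (proj_fun A V' r b \<bullet>c h) \<cdot>\<^sub>v t"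
  by (rule proj_fun_diff_mult_id[OF Z' V' b t(1) coupling_V'])

text \<open>By \<open>VAT\<close> the part of \<open>D r\<close> along \<open>T\<close> feeds back
  into \<open>V\<close> only as a multiple of \<open>h\<close>.\<close>

lemma V_op_D: "orth_proj V (A *\<^sub>v D r) =
  orth_proj V (A *\<^sub>v orth_proj V (D r)) + (orth_proj T (D r) \<bullet>c t) \<cdot>\<^sub>v h"
  using VAT[of "orth_proj T (D r)"] T
  by (subst D_split) (simp add: op_add orth_proj_add[OF V])

text \<open>The feedback adds a constant to the symbol applied to \<open>h\<close>. The component in
  \<open>V\<close> thus remains a function of the compression applied to \<open>h\<close>, and a
  polynomial symbol gains one degree.\<close>

lemma contain_mult_id:
  assumes "orth_proj V (D r) = proj_fun A V g h"
  shows "orth_proj V (D (\<lambda>x. x * r x)) =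
    proj_fun A V (\<lambda>x. x * g x + orth_proj T (D r) \<bullet>c t) h"
proof -
  have "orth_proj V (D (\<lambda>x. x * r x)) = orth_proj V (A *\<^sub>v D r)"
    using t(1) by (simp add: D_mult_id orth_proj_add[OF V] orth_proj_smult[OF V] VZ V_t)
  then show ?thesis
    using h by (simp add: V_op_D assms proj_fun_add[OF V] proj_fun_mult_id[OF V] proj_fun_const[OF V])
qed

text \<open>Projecting the shifted equation for \<open>D r'\<close> to \<open>V\<close> leaves an
  equation on the range of \<open>V\<close> whose solution is unique as \<open>z \<notin> X\<close>;
  the right-hand side \<open>y\<close> solves it too.\<close>

lemma contain_div:
  assumes z: "z \<notin> X" and r: "\<And>x. x \<in> X \<Longrightarrow> (x - z) * r' x = r x"
    and g: "orth_proj V (D r) = proj_fun A V g h"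
  shows "orth_proj V (D r') = proj_fun A V (\<lambda>x. (g x - orth_proj T (D r') \<bullet>c t) / (x - z)) h"
proof -
  \<comment> \<open>This scalar depends on the unknown \<open>D r'\<close> itself. That is no
    circularity: what matters later is that it is constant in x.\<close>
  define \<mu> where "\<mu> = orth_proj T (D r') \<bullet>c t"
  define w where "w = (\<lambda>x. (g x - \<mu>) / (x - z))"
  define y where "y = proj_fun A V w h"
  have y: "y \<in> carrier_vec n" by (simp add: y_def)
  have "orth_proj V (orth_proj Z (A *\<^sub>v D r') - z \<cdot>\<^sub>v D r') =
      orth_proj V (D r - (proj_fun A V r' b \<bullet>c h) \<cdot>\<^sub>v t)"
    by (simp add: proj_fun_diff_div[OF Z V b t(1) coupling_V r])
  then have eq: "orth_proj V (A *\<^sub>v orth_proj V (D r')) + \<mu> \<cdot>\<^sub>v h - z \<cdot>\<^sub>v orth_proj V (D r') = proj_fun A V g h"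
    using t(1) by (simp add: orth_proj_diff[OF V] orth_proj_smult[OF V] VZ V_t V_op_D g \<mu>_def)
  have "orth_proj V (A *\<^sub>v y) = proj_fun A V (\<lambda>x. z * w x + (g x + - \<mu>)) h"
    unfolding y_def proj_fun_mult_id[OF V h(1), symmetric]
    by (rule proj_fun_cong[OF V]) (use z in \<open>auto simp: w_def divide_simps; simp add: algebra_simps\<close>)
  also have "\<dots> = z \<cdot>\<^sub>v y + (proj_fun A V g h + (- \<mu>) \<cdot>\<^sub>v h)"
    by (simp only: proj_fun_add[OF V h(1)] proj_fun_cmult[OF V h(1)] proj_fun_const[OF V h(1)] h(2) y_def)
  finally have eq2: "orth_proj V (A *\<^sub>v y) = z \<cdot>\<^sub>v y + (proj_fun A V g h + (- \<mu>) \<cdot>\<^sub>v h)" .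
  have "orth_proj V (D r') = y"
  proof (rule shifted_compression_inj[OF V _ _ y _ _ z])
    show "orth_proj V (A *\<^sub>v orth_proj V (D r')) - z \<cdot>\<^sub>v orth_proj V (D r') =
        orth_proj V (A *\<^sub>v y) - z \<cdot>\<^sub>v y"
    proof (rule eq_vecI)
      fix i assume "i < dim_vec (orth_proj V (A *\<^sub>v y) - z \<cdot>\<^sub>v y)"
      then have i: "i < n" using y by simp
      have "orth_proj V (A *\<^sub>v orth_proj V (D r')) $ i + \<mu> * h $ i - z * orth_proj V (D r') $ i =
          proj_fun A V g h $ i"
        using arg_cong[OF eq, of "\<lambda>v. vec_index v i"] i h(1) by simp
      then have e1: "orth_proj V (A *\<^sub>v orth_proj V (D r')) $ i =
          proj_fun A V g h $ i + z * orth_proj V (D r') $ i - \<mu> * h $ i"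
        by (simp only: diff_eq_eq eq_diff_eq)
      have e2: "orth_proj V (A *\<^sub>v y) $ i = z * y $ i + (proj_fun A V g h $ i - \<mu> * h $ i)"
        using arg_cong[OF eq2, of "\<lambda>v. vec_index v i"] i h(1) y by simp
      show "(orth_proj V (A *\<^sub>v orth_proj V (D r')) - z \<cdot>\<^sub>v orth_proj V (D r')) $ i =
          (orth_proj V (A *\<^sub>v y) - z \<cdot>\<^sub>v y) $ i"
        using i h(1) y by (simp add: e1 e2)
    qed (use y in simp)
  qed (use V in \<open>simp_all add: y_def\<close>)
  then show ?thesis by (simp add: y_def w_def \<mu>_def)
qed

text \<open>Projecting the recursion of \<open>D\<close> to \<open>Z'\<close> turns it into that of
  \<open>D'\<close>. The source terms agree by the pairing hypothesis, and the range condition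
  ensures that the projection loses nothing.\<close>

lemma exact_mult_id:
  assumes "D r = D' r" "proj_fun A V r b \<bullet>c h = proj_fun A V' r b \<bullet>c h"
    and "orth_proj V' (orth_proj V (D (\<lambda>x. x * r x))) = orth_proj V (D (\<lambda>x. x * r x))"
  shows "D (\<lambda>x. x * r x) = D' (\<lambda>x. x * r x)"
proof -
  have "D (\<lambda>x. x * r x) = orth_proj Z' (D (\<lambda>x. x * r x))"
    using in_range_Z'[OF assms(3)] by simp
  also have "\<dots> = orth_proj Z' (A *\<^sub>v D r) + (proj_fun A V r b \<bullet>c h) \<cdot>\<^sub>v t"
    using t(1) by (simp add: D_mult_id orth_proj_add[OF Z'] orth_proj_smult[OF Z'] Z'Z Z'_t)
  finally show ?thesis using assms(1,2) by (simp add: D'_mult_id)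
qed

text \<open>\<open>D r'\<close> and \<open>D' r'\<close> both lie in the range of \<open>Z'\<close>
  and solve the same shifted equation there, whose solution is unique as
  \<open>z \<notin> X\<close>.\<close>

lemma exact_div:
  assumes z: "z \<notin> X" and r: "\<And>x. x \<in> X \<Longrightarrow> (x - z) * r' x = r x"
    and "D r = D' r" "proj_fun A V r' b \<bullet>c h = proj_fun A V' r' b \<bullet>c h"
    and "orth_proj V' (orth_proj V (D r')) = orth_proj V (D r')"
  shows "D r' = D' r'"
proof (rule shifted_compression_inj[OF Z' _ in_range_Z'[OF assms(5)] _ Z'_D' _ z])
  have "orth_proj Z' (D r) = D r" using Z'_D'[of r] assms(3) by simp
  then have "orth_proj Z' (D r - (proj_fun A V r' b \<bullet>c h) \<cdot>\<^sub>v t) = D r - (proj_fun A V r' b \<bullet>c h) \<cdot>\<^sub>v t"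
    using t(1) by (simp add: orth_proj_diff[OF Z'] orth_proj_smult[OF Z'] Z'_t)
  moreover have "orth_proj Z' (orth_proj Z (A *\<^sub>v D r') - z \<cdot>\<^sub>v D r') =
      orth_proj Z' (A *\<^sub>v D r') - z \<cdot>\<^sub>v D r'"
    using in_range_Z'[OF assms(5)] by (simp add: orth_proj_diff[OF Z'] orth_proj_smult[OF Z'] Z'Z)
  ultimately show "orth_proj Z' (A *\<^sub>v D r') - z \<cdot>\<^sub>v D r' =
      orth_proj Z' (A *\<^sub>v D' r') - z \<cdot>\<^sub>v D' r'"
    using proj_fun_diff_div[OF Z V b t(1) coupling_V r] proj_fun_diff_div[OF Z' V' b t(1) coupling_V' r]
      assms(3,4) by simp
qed simp_all

text \<open>Start of both recursions: for the constant 1 the gain is the projection of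
  \<open>b\<close> to \<open>T\<close>, whichever of the two spaces is enlarged.\<close>

lemma D_one: "D (\<lambda>_. 1) = D' (\<lambda>_. 1)" "orth_proj V (D (\<lambda>_. 1)) = 0\<^sub>v n"
proof -
  have "D (\<lambda>_. 1) = orth_proj T b" "D' (\<lambda>_. 1) = orth_proj T b"
    using b by (auto simp: proj_fun_diff_def proj_fun_one[OF Z b] proj_fun_one[OF V b]
        proj_fun_one[OF Z' b] proj_fun_one[OF V' b] PZ PZ' intro!: eq_vecI)
  then show "D (\<lambda>_. 1) = D' (\<lambda>_. 1)" "orth_proj V (D (\<lambda>_. 1)) = 0\<^sub>v n"
    using VT[OF b] by simp_all
qed

text \<open>Krylov exactness for functions applied to \<open>h\<close>. Equality is asked only after
  projection to \<open>V'\<close>, so that the constant 1 qualifies: \<open>h\<close> need not lie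
  in the range of \<open>V'\<close>, since 1 is not a fraction p/q with deg p < k when all k inner
  poles are finite.\<close>

definition galerkin_exact where
  "galerkin_exact r \<longleftrightarrow> orth_proj V' (proj_fun A V r h) = proj_fun A V' r h"

lemma galerkin_exact_one: "galerkin_exact (\<lambda>_. 1)"
  using V'V[OF h(1)] h by (simp add: galerkin_exact_def proj_fun_one[OF V h(1)] proj_fun_one[OF V' h(1)])

lemma galerkin_exact_add: "galerkin_exact f \<Longrightarrow> galerkin_exact g \<Longrightarrow> galerkin_exact (\<lambda>x. f x + g x)"
  by (simp add: galerkin_exact_def proj_fun_add[OF V h(1)] proj_fun_add[OF V' h(1)] orth_proj_add[OF V'])

lemma galerkin_exact_cmult: "galerkin_exact f \<Longrightarrow> galerkin_exact (\<lambda>x. c * f x)"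
  by (simp add: galerkin_exact_def proj_fun_cmult[OF V h(1)] proj_fun_cmult[OF V' h(1)] orth_proj_smult[OF V'])

lemma galerkin_exact_cong:
  "(\<And>x. x \<in> X \<Longrightarrow> f x = g x) \<Longrightarrow> galerkin_exact f \<longleftrightarrow> galerkin_exact g"
  unfolding galerkin_exact_def using proj_fun_cong[OF V, of f g] proj_fun_cong[OF V', of f g] by simp

text \<open>Projecting to \<open>V'\<close> absorbs the projection to \<open>V\<close>, so one
  factor x can be gained beyond the range condition.\<close>

lemma galerkin_exact_mult_id:
  assumes "galerkin_exact r" "orth_proj V' (proj_fun A V r h) = proj_fun A V r h"
  shows "galerkin_exact (\<lambda>x. x * r x)"
  using assms V'V[of "A *\<^sub>v proj_fun A V r h"]
  by (simp add: galerkin_exact_def proj_fun_mult_id[OF V h(1)] proj_fun_mult_id[OF V' h(1)])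

text \<open>Both vectors solve the same shifted equation on the range of \<open>V'\<close>. In
  contrast to multiplication by x, the range condition concerns the new function
  \<open>r'\<close>.\<close>

lemma galerkin_exact_div:
  assumes z: "z \<notin> X" and r: "\<And>x. x \<in> X \<Longrightarrow> (x - z) * r' x = r x"
    and "galerkin_exact r" and ran: "orth_proj V' (proj_fun A V r' h) = proj_fun A V r' h"
  shows "galerkin_exact r'"
proof -
  have *: "orth_proj W (A *\<^sub>v proj_fun A W r' h) = z \<cdot>\<^sub>v proj_fun A W r' h + proj_fun A W r h"
    if W: "isometry_mat n W" for W
  proof -
    have "proj_fun A W (\<lambda>x. x * r' x) h = proj_fun A W (\<lambda>x. z * r' x + r x) h"
      by (rule proj_fun_cong[OF W]) (use r in \<open>auto simp: algebra_simps eq_diff_eq\<close>)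
    then show ?thesis
      by (simp add: proj_fun_mult_id[OF W h(1)] proj_fun_add[OF W h(1)] proj_fun_cmult[OF W h(1)])
  qed
  have "proj_fun A V r' h = proj_fun A V' r' h"
  proof (rule shifted_compression_inj[OF V' _ ran _ _ _ z])
    have "orth_proj V' (A *\<^sub>v proj_fun A V r' h) = orth_proj V' (orth_proj V (A *\<^sub>v proj_fun A V r' h))"
      by (simp add: V'V)
    also have "\<dots> = z \<cdot>\<^sub>v proj_fun A V r' h + proj_fun A V' r h"
      using assms(3) ran by (simp add: *[OF V] orth_proj_add[OF V'] orth_proj_smult[OF V'] galerkin_exact_def)
    finally show "orth_proj V' (A *\<^sub>v proj_fun A V r' h) - z \<cdot>\<^sub>v proj_fun A V r' h =
        orth_proj V' (A *\<^sub>v proj_fun A V' r' h) - z \<cdot>\<^sub>v proj_fun A V' r' h"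
      by (intro eq_vecI) (simp_all add: *[OF V'])
  qed simp_all
  then show ?thesis using ran by (simp add: galerkin_exact_def)
qed

text \<open>The function is moved as its conjugate from \<open>b\<close>, which is arbitrary, to
  \<open>h\<close>, where Krylov exactness is available.\<close>

lemma pairing_eq:
  assumes "galerkin_exact (\<lambda>x. cnj (r x))"
    "orth_proj V' (proj_fun A V (\<lambda>x. cnj (r x)) h) = proj_fun A V (\<lambda>x. cnj (r x)) h"
  shows "proj_fun A V r b \<bullet>c h = proj_fun A V' r b \<bullet>c h"
  using assms by (simp add: proj_fun_adjoint[OF V b h(1)] proj_fun_adjoint[OF V' b h(1)] galerkin_exact_def)

end

text \<open>The degree condition says that p times the cofactor q/d has degree below
  \<open>k\<close>, so \<open>p/d\<close> is an element of the rational space in lowest enough terms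
  to avoid zeros of the denominator on \<open>X\<close>. Invariance of \<open>q\<close> under
  conjugation keeps conjugate denominators available for the pairings.\<close>

locale rational_step = galerkin_step +
  fixes q :: "complex poly" and k :: nat
  assumes q: "degree q \<le> k" "map_poly cnj q = q"
    and krylov: "\<And>d p. \<lbrakk>d dvd q; \<And>x. x \<in> X \<Longrightarrow> poly d x \<noteq> 0; p = 0 \<or> degree p + degree q < degree d + k\<rbrakk>
      \<Longrightarrow> orth_proj V' (proj_fun A V (\<lambda>x. poly p x / poly d x) h) = proj_fun A V (\<lambda>x. poly p x / poly d x) h"
begin

text \<open>
  Only denominators \<open>d\<close> without zeros on \<open>X\<close> are admitted, as \<open>q\<close> itself may vanish there. Then
  \<open>p/d\<close> lies in \<open>\<Pi>\<^bsub>k-1\<^esub>/q\<close> iff \<open>numer d p\<close>.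
\<close>

definition denom :: "complex poly \<Rightarrow> bool" where
  "denom d \<longleftrightarrow> d dvd q \<and> (\<forall>x\<in>X. poly d x \<noteq> 0)"

definition numer :: "complex poly \<Rightarrow> complex poly \<Rightarrow> bool" where
  "numer d p \<longleftrightarrow> p = 0 \<or> degree p + degree q < degree d + k"

lemma krylov_denom:
  "denom d \<Longrightarrow> numer d p \<Longrightarrow>
    orth_proj V' (proj_fun A V (\<lambda>x. poly p x / poly d x) h) = proj_fun A V (\<lambda>x. poly p x / poly d x) h"
  using krylov by (auto simp: denom_def numer_def)

lemma krylov_poly:
  assumes "numer 1 p"
  shows "orth_proj V' (proj_fun A V (poly p) h) = proj_fun A V (poly p) h"
proof -
  have "denom 1" by (simp add: denom_def)
  from krylov_denom[OF this assms] show ?thesis by simp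
qed

lemma X_real: "x \<in> X \<Longrightarrow> cnj x = x"
  using field_of_values_hermitian_real[OF hermitian] .

lemma numer_pCons: "numer 1 (pCons c p) \<Longrightarrow> numer 1 p"
  by (auto simp: numer_def split: if_splits)

text \<open>A root of \<open>d\<close>, supplied by the fundamental theorem of algebra, lies outside
  \<open>X\<close>, as division by x - z requires. Nonempty \<open>X\<close> rules out
  \<open>d = 0\<close>.\<close>

lemma denom_induct [consumes 1, case_names const linear]:
  assumes "denom d"
    and const: "\<And>c. c \<noteq> 0 \<Longrightarrow> denom [:c:] \<Longrightarrow> P [:c:]"
    and linear: "\<And>z d. \<lbrakk>denom ([:- z, 1:] * d); denom d; d \<noteq> 0; z \<notin> X; P d\<rbrakk> \<Longrightarrow> P ([:- z, 1:] * d)"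
    and X: "X \<noteq> {}"
  shows "P d"
  using assms(1)
proof (induction "degree d" arbitrary: d rule: less_induct)
  case less
  have d0: "d \<noteq> 0" using less.prems X by (auto simp: denom_def)
  show ?case
  proof (cases "degree d = 0")
    case True
    then obtain c where "d = [:c:]" by (metis degree_eq_zeroE)
    then show ?thesis using const less.prems d0 by auto
  next
    case False
    then obtain z where z: "poly d z = 0"
      using fundamental_theorem_of_algebra[of d] by (auto simp: constant_degree)
    then obtain e where e: "d = [:- z, 1:] * e" by (auto simp: poly_eq_0_iff_dvd elim: dvdE)
    have e0: "e \<noteq> 0" using d0 e by auto
    have "denom e" using less.prems dvd_mult_right[of "[:- z, 1:]" e q] by (auto simp: denom_def e)
    moreover have "degree e < degree d" using e0 by (simp add: e degree_mult_eq del: mult_pCons_left)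
    moreover have "z \<notin> X" using less.prems z by (auto simp: denom_def)
    ultimately show ?thesis using less.hyps linear less.prems e0 unfolding e by blast
  qed
qed

lemma degree_linear_mult: "d \<noteq> 0 \<Longrightarrow> degree ([:- z, 1:] * d) = Suc (degree d)" for d :: "complex poly"
  by (simp add: degree_mult_eq del: mult_pCons_left)

text \<open>Since deg q <= k, the reciprocal of any nonconstant denominator lies in the rational
  space even when the constant 1 does not. Reciprocals can therefore be reached by repeated division
  starting from 1, for which exactness always holds.\<close>

lemma numer_one: "d \<noteq> 0 \<Longrightarrow> numer ([:- z, 1:] * d) 1"
  unfolding numer_def by (subst degree_linear_mult) (use q(1) in auto)

lemma galerkin_exact_poly: "numer 1 p \<Longrightarrow> galerkin_exact (poly p)"
proof (induction p)
  case 0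
  have "poly (0 :: complex poly) = (\<lambda>x. 0 * 1)" by auto
  then show ?case using galerkin_exact_cmult[OF galerkin_exact_one, of 0] by simp
next
  case (pCons c p)
  have "galerkin_exact (\<lambda>x. x * poly p x)"
    using galerkin_exact_mult_id pCons krylov_poly numer_pCons by blast
  moreover have "galerkin_exact (\<lambda>x. c)" using galerkin_exact_cmult[OF galerkin_exact_one, of c] by simp
  ultimately have "galerkin_exact (\<lambda>x. c + x * poly p x)" by (rule galerkin_exact_add[rotated])
  then show ?case by (simp add: fun_eq_iff[of "poly (pCons c p)"] poly_pCons ext)
qed

section \<open>Exactness for rational functions by induction on numerator and denominator\<close>

context
  assumes X_nonempty: "X \<noteq> {}"
begin

lemma galerkin_exact_inverse: "denom d \<Longrightarrow> galerkin_exact (\<lambda>x. 1 / poly d x)"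
proof (induction d rule: denom_induct)
  case (const c)
  then show ?case using galerkin_exact_cmult[OF galerkin_exact_one, of "1 / c"] by simp
next
  case (linear z d)
  have nz: "x \<noteq> z" if "x \<in> X" for x using linear that by auto
  show ?case
  proof (rule galerkin_exact_div[OF \<open>z \<notin> X\<close> _ \<open>galerkin_exact (\<lambda>x. 1 / poly d x)\<close>])
    show "(x - z) * (1 / poly ([:- z, 1:] * d) x) = 1 / poly d x" if "x \<in> X" for x
      using nz[OF that] by (simp add: divide_simps) (simp add: algebra_simps)
    show "orth_proj V' (proj_fun A V (\<lambda>x. 1 / poly ([:- z, 1:] * d) x) h) =
        proj_fun A V (\<lambda>x. 1 / poly ([:- z, 1:] * d) x) h"
      using krylov_denom[OF linear(1) numer_one[OF \<open>d \<noteq> 0\<close>]] by (simp only: poly_1)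
  qed
qed (rule X_nonempty)

lemma degree_map_poly_cnj: "degree (map_poly cnj p) = degree p"
  by (rule degree_map_poly) simp

lemma cnj_poly_X: "x \<in> X \<Longrightarrow> cnj (poly p x) = poly (map_poly cnj p) x"
  by (simp add: X_real)

lemma map_poly_cnj_mult: "map_poly cnj (p * r) = map_poly cnj p * map_poly cnj r"
  by (rule poly_eqI) (simp add: coeff_map_poly coeff_mult)

text \<open>Invariance of \<open>q\<close> under conjugation preserves divisibility, and realness of
  \<open>X\<close> preserves the absence of zeros there.\<close>

lemma denom_cnj: "denom d \<Longrightarrow> denom (map_poly cnj d)"
  using q(2) cnj_poly_X[of _ d] unfolding denom_def dvd_def
  by (metis complex_cnj_zero_iff map_poly_cnj_mult)

lemma pairing_poly:
  assumes "numer 1 p"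
  shows "proj_fun A V (poly p) b \<bullet>c h = proj_fun A V' (poly p) b \<bullet>c h"
proof -
  have n: "numer 1 (map_poly cnj p)" using assms by (auto simp: numer_def degree_map_poly_cnj)
  have "galerkin_exact (\<lambda>x. cnj (poly p x))"
    using galerkin_exact_poly[OF n] galerkin_exact_cong[of "\<lambda>x. cnj (poly p x)" "poly (map_poly cnj p)"]
      cnj_poly_X by blast
  moreover have "proj_fun A V (\<lambda>x. cnj (poly p x)) h = proj_fun A V (poly (map_poly cnj p)) h"
    by (rule proj_fun_cong[OF V]) (rule cnj_poly_X)
  ultimately show ?thesis using pairing_eq[of "poly p"] krylov_poly[OF n] by simp
qed

lemma pairing_inverse:
  assumes d: "denom d" and n: "numer d 1"
  shows "proj_fun A V (\<lambda>x. 1 / poly d x) b \<bullet>c h = proj_fun A V' (\<lambda>x. 1 / poly d x) b \<bullet>c h"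
proof -
  define e where "e = map_poly cnj d"
  have e: "denom e" "numer e 1" using denom_cnj[OF d] n by (auto simp: e_def numer_def degree_map_poly_cnj)
  have eq: "cnj (1 / poly d x) = 1 / poly e x" if "x \<in> X" for x
    using cnj_poly_X[OF that, of d] by (simp add: e_def)
  have "galerkin_exact (\<lambda>x. cnj (1 / poly d x))"
    using galerkin_exact_inverse[OF e(1)]
      galerkin_exact_cong[of "\<lambda>x. cnj (1 / poly d x)" "\<lambda>x. 1 / poly e x"] eq by blast
  moreover have "proj_fun A V (\<lambda>x. cnj (1 / poly d x)) h = proj_fun A V (\<lambda>x. 1 / poly e x) h"
    by (rule proj_fun_cong[OF V]) (rule eq)
  ultimately show ?thesis
    using pairing_eq[of "\<lambda>x. 1 / poly d x"] krylov_denom[OF e] by simp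
qed

lemma D_add: "D (\<lambda>x. f x + g x) = D f + D g" "D' (\<lambda>x. f x + g x) = D' f + D' g"
  using proj_fun_diff_add[OF Z V b t(1)] proj_fun_diff_add[OF Z' V' b t(1)] by auto

lemma D_cmult: "D (\<lambda>x. c * f x) = c \<cdot>\<^sub>v D f" "D' (\<lambda>x. c * f x) = c \<cdot>\<^sub>v D' f"
  using proj_fun_diff_cmult[OF Z V b t(1)] proj_fun_diff_cmult[OF Z' V' b t(1)] by auto

lemma D_const: "D (\<lambda>x. c) = D' (\<lambda>x. c)" "orth_proj V (D (\<lambda>x. c)) = 0\<^sub>v n"
proof -
  show "D (\<lambda>x. c) = D' (\<lambda>x. c)" using D_cmult[of c "\<lambda>_. 1"] D_one by simp
  show "orth_proj V (D (\<lambda>x. c)) = 0\<^sub>v n"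
    using D_cmult(1)[of c "\<lambda>_. 1"] D_one(2) orth_proj_smult[OF V, of "D (\<lambda>_. 1)" c] by simp
qed

lemma proj_fun_zero: "proj_fun A V (\<lambda>x. 0) h = 0\<^sub>v n"
  using proj_fun_const[OF V h(1), of 0] h by (auto intro!: eq_vecI)

lemma proj_fun_poly_zero: "proj_fun A V (poly 0) h = 0\<^sub>v n"
proof -
  have "poly (0 :: complex poly) = (\<lambda>x. 0)" by auto
  then show ?thesis using proj_fun_zero by simp
qed

text \<open>The claim about \<open>g\<close> strengthens the induction.
  \<open>contain_mult_id\<close> carries it over to the product with x, whose component in
  \<open>V\<close> is then a polynomial of admissible degree applied to \<open>h\<close>; this is
  the range condition of \<open>exact_mult_id\<close>.\<close>

lemma exact_poly:
  "numer 1 p \<Longrightarrow> D (poly p) = D' (poly p) \<and>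
    (\<exists>g. orth_proj V (D (poly p)) = proj_fun A V (poly g) h \<and> (g = 0 \<or> degree g < degree p))"
proof (induction p)
  case 0
  have "poly (0 :: complex poly) = (\<lambda>x. 0)" by auto
  then show ?case using D_const[of 0] proj_fun_poly_zero by (auto intro!: exI[of _ 0])
next
  case (pCons c p)
  have p: "numer 1 p" using pCons.prems by (rule numer_pCons)
  obtain g where ex: "D (poly p) = D' (poly p)" and g: "orth_proj V (D (poly p)) = proj_fun A V (poly g) h"
      "g = 0 \<or> degree g < degree p"
    using pCons.IH[OF p] by blast
  define r where "r = (\<lambda>x. x * poly p x)"
  have pc: "poly (pCons c p) = (\<lambda>x. c + r x)" by (rule ext) (simp add: r_def)
  have D_pc: "orth_proj V (D (poly (pCons c p))) = orth_proj V (D r)"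
    by (simp add: pc D_add D_const(2) orth_proj_add[OF V])
  define \<mu> where "\<mu> = orth_proj T (D (poly p)) \<bullet>c t"
  show ?case
  proof (cases "p = 0")
    case True
    then have "poly (pCons c p) = (\<lambda>x. c)" by auto
    then show ?thesis using D_const[of c] proj_fun_poly_zero by (auto intro!: exI[of _ 0])
  next
    case False
    \<comment> \<open>The symbol that \<open>contain_mult_id\<close> produces from \<open>g\<close>:
      multiplied by x, plus the feedback constant.\<close>
    define g' where "g' = pCons \<mu> g"
    have Dr: "orth_proj V (D r) = proj_fun A V (poly g') h"
    proof -
      have "poly g' = (\<lambda>x. x * poly g x + \<mu>)" by (rule ext) (simp add: g'_def)
      then show ?thesis using contain_mult_id[OF g(1)] by (simp add: r_def \<mu>_def)
    qed
    have deg: "degree g' < degree (pCons c p)" using g(2) False by (auto simp: g'_def)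
    have n: "numer 1 g'" using pCons.prems deg pCons.hyps by (auto simp: numer_def)
    have "D r = D' r"
      unfolding r_def
      by (rule exact_mult_id[OF ex pairing_poly[OF p]])
        (use krylov_poly[OF n] Dr in \<open>simp flip: r_def\<close>)
    then have "D (poly (pCons c p)) = D' (poly (pCons c p))"
      by (simp add: pc D_add D_const)
    moreover have "orth_proj V (D (poly (pCons c p))) = proj_fun A V (poly g') h"
      using D_pc Dr by (rule trans)
    ultimately show ?thesis using deg by blast
  qed
qed

text \<open>Here the strengthening says that the component in \<open>V\<close> comes from a proper
  fraction over the same denominator; proper fractions lie in the rational space because deg q <=
  k.\<close>

lemma exact_inverse:
  "denom d \<Longrightarrow> D (\<lambda>x. 1 / poly d x) = D' (\<lambda>x. 1 / poly d x) \<and>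
    (\<exists>g. orth_proj V (D (\<lambda>x. 1 / poly d x)) = proj_fun A V (\<lambda>x. poly g x / poly d x) h \<and>
      (g = 0 \<or> degree g < degree d))"
proof (induction d rule: denom_induct)
  case (const c)
  then show ?case using D_const[of "1 / c"] proj_fun_zero by (auto intro!: exI[of _ 0])
next
  case (linear z d)
  have nz: "x \<noteq> z" if "x \<in> X" for x using linear that by auto
  have dz: "poly d x \<noteq> 0" if "x \<in> X" for x using linear(2) that by (auto simp: denom_def)
  define d' where "d' = [:- z, 1:] * d"
  have pd': "poly d' x = (x - z) * poly d x" for x by (simp add: d'_def algebra_simps)
  have d': "denom d'" "numer d' 1" "degree d' = Suc (degree d)"
    using linear(1) numer_one[OF \<open>d \<noteq> 0\<close>] degree_linear_mult[OF \<open>d \<noteq> 0\<close>] unfolding d'_def by blast+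
  obtain g where ex: "D (\<lambda>x. 1 / poly d x) = D' (\<lambda>x. 1 / poly d x)"
    and g: "orth_proj V (D (\<lambda>x. 1 / poly d x)) = proj_fun A V (\<lambda>x. poly g x / poly d x) h"
      "g = 0 \<or> degree g < degree d"
    using linear by blast
  define r where "r = (\<lambda>x. 1 / poly d' x)"
  have r: "(x - z) * r x = 1 / poly d x" if "x \<in> X" for x
    using nz[OF that] by (simp add: r_def pd')
  define \<mu> where "\<mu> = orth_proj T (D r) \<bullet>c t"
  \<comment> \<open>Numerator of \<open>(g/d - \<mu>) / (x - z)\<close> over the common denominator
    \<open>d'\<close>.\<close>
  define g' where "g' = g - Polynomial.smult \<mu> d"
  have "degree g' \<le> degree d"
    unfolding g'_def using g(2) by (intro degree_diff_le) (auto simp: degree_smult_le)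
  then have deg: "degree g' < degree d'" using d'(3) by simp
  have Dr: "orth_proj V (D r) = proj_fun A V (\<lambda>x. poly g' x / poly d' x) h"
  proof -
    have "orth_proj V (D r) = proj_fun A V (\<lambda>x. (poly g x / poly d x - \<mu>) / (x - z)) h"
      using contain_div[OF \<open>z \<notin> X\<close> r g(1)] by (simp add: \<mu>_def)
    also have "\<dots> = proj_fun A V (\<lambda>x. poly g' x / poly d' x) h"
      by (rule proj_fun_cong[OF V]) (use nz dz in \<open>auto simp: pd' g'_def divide_simps\<close>)
    finally show ?thesis .
  qed
  have n: "numer d' g'" using deg q(1) by (simp add: numer_def)
  have "D r = D' r"
    by (rule exact_div[OF \<open>z \<notin> X\<close> r ex])
      (use pairing_inverse[OF d'(1,2)] krylov_denom[OF d'(1) n] Dr in \<open>simp_all add: r_def\<close>)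
  then show ?case using Dr deg unfolding r_def d'_def by blast
qed (rule X_nonempty)

text \<open>Dividing \<open>p\<close> by x - z with remainder \<open>c\<close> gives
  \<open>p/d' = p1/d + c/d'\<close>. The first fraction has a shorter denominator, the second is
  covered by \<open>exact_inverse\<close>.\<close>

lemma exact_rational:
  assumes "denom d" "numer d p"
  shows "D (\<lambda>x. poly p x / poly d x) = D' (\<lambda>x. poly p x / poly d x)"
  using assms
proof (induction d arbitrary: p rule: denom_induct)
  case (const c)
  have "poly (Polynomial.smult (1 / c) p) = (\<lambda>x. poly p x / poly [:c:] x)" by auto
  moreover have "numer 1 (Polynomial.smult (1 / c) p)" using const by (auto simp: numer_def)
  ultimately show ?case using exact_poly by metis
next
  case (linear z d)
  have nz: "x \<noteq> z" if "x \<in> X" for x using linear that by auto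
  have dz: "poly d x \<noteq> 0" if "x \<in> X" for x using linear(2) that by (auto simp: denom_def)
  define d' where "d' = [:- z, 1:] * d"
  have pd': "poly d' x = (x - z) * poly d x" for x by (simp add: d'_def algebra_simps)
  have d': "denom d'" "degree d' = Suc (degree d)"
    using linear(1) degree_linear_mult[OF \<open>d \<noteq> 0\<close>] unfolding d'_def by blast+
  define p1 where "p1 = synthetic_div p z"
  define c where "c = poly p z"
  have p: "poly p x = (x - z) * poly p1 x + c" for x
    using arg_cong[OF synthetic_div_correct'[of z p], of "\<lambda>r. poly r x"]
    by (simp add: p1_def c_def algebra_simps)
  \<comment> \<open>Numerator and denominator both lose one degree, which preserves the degree
    condition; a constant \<open>p\<close> leaves \<open>p1 = 0\<close>.\<close>
  have "numer d p1"
  proof (cases "degree p = 0")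
    case True
    then show ?thesis using synthetic_div_eq_0_iff[of p z] by (simp add: numer_def p1_def)
  next
    case False
    moreover have "numer d' p" using linear.prems by (simp only: d'_def)
    ultimately show ?thesis using d'(2) by (auto simp: numer_def p1_def degree_synthetic_div)
  qed
  then have IH: "D (\<lambda>x. poly p1 x / poly d x) = D' (\<lambda>x. poly p1 x / poly d x)" using linear.IH by blast
  define r where "r = (\<lambda>x. poly p1 x / poly d x + c * (1 / poly d' x))"
  have "D r = D' r" unfolding r_def D_add D_cmult using IH exact_inverse[OF d'(1)] by simp
  moreover have eq: "poly p x / poly d' x = r x" if "x \<in> X" for x
    using nz[OF that] dz[OF that] by (simp add: r_def p pd' add_divide_distrib)
  have "D (\<lambda>x. poly p x / poly d' x) = D r" "D' (\<lambda>x. poly p x / poly d' x) = D' r"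
    by (rule proj_fun_diff_cong[OF Z V b t(1)], erule eq)
      (rule proj_fun_diff_cong[OF Z' V' b t(1)], erule eq)
  ultimately show ?case by (simp only: d'_def)
qed (rule X_nonempty)

lemma step_bound:
  assumes d: "denom d" "numer d p" and e: "e \<ge> 0"
    and f: "\<And>x. x \<in> X \<Longrightarrow> cmod (f x - poly p x / poly d x) \<le> e"
  shows "norm2 (D f - D' f) \<le> 4 * e * norm2 b"
proof -
  define r where "r = (\<lambda>x. poly p x / poly d x)"
  define g where "g = (\<lambda>x. f x - r x)"
  have fg: "f = (\<lambda>x. g x + r x)" by (auto simp: g_def)
  have "D f - D' f = D g - D' g"
    unfolding fg D_add using exact_rational[OF d]
    by (intro eq_vecI) (auto simp: proj_fun_diff_def simp flip: r_def)
  have g: "\<And>x. x \<in> X \<Longrightarrow> cmod (g x) \<le> e" using f by (simp add: g_def r_def)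
  have "norm2 (D g) \<le> e * norm2 b + e * norm2 b"
    unfolding proj_fun_diff_def using norm2_diff_le[of "proj_fun A Z g b" n "proj_fun A V g b"]
      norm2_proj_fun_le[OF Z b e, of g] g norm2_proj_fun_le[OF V b e, of g] g by simp
  moreover have "norm2 (D' g) \<le> e * norm2 b + e * norm2 b"
    unfolding proj_fun_diff_def using norm2_diff_le[of "proj_fun A Z' g b" n "proj_fun A V' g b"]
      norm2_proj_fun_le[OF Z' b e, of g] g norm2_proj_fun_le[OF V' b e, of g] g by simp
  moreover have "norm2 (D g - D' g) \<le> norm2 (D g) + norm2 (D' g)"
    by (rule norm2_diff_le[of _ n]) simp_all
  ultimately show ?thesis by (simp add: \<open>D f - D' f = D g - D' g\<close>)
qed

end

end

section \<open>Compression with orthonormal columns\<close>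

lemma isometry_mat_iff:
  "isometry_mat n V \<longleftrightarrow> dim_row V = n \<and>
    (\<forall>i<dim_col V. \<forall>j<dim_col V. col V i \<bullet>c col V j = (if i = j then 1 else 0))"
proof -
  have *: "(mat_adjoint V * V) $$ (i, j) = col V j \<bullet>c col V i" if "i < dim_col V" "j < dim_col V" for i j
    using adjoint_mult_index[of V "dim_row V" "dim_col V" V "dim_col V" i j] that by blast
  have "mat_adjoint V * V = 1\<^sub>m (dim_col V) \<longleftrightarrow>
      (\<forall>i<dim_col V. \<forall>j<dim_col V. col V j \<bullet>c col V i = (if i = j then 1 else 0))"
    (is "?L \<longleftrightarrow> ?R")
  proof
    assume L: ?L
    show ?R
    proof (intro allI impI)
      fix i j assume ij: "i < dim_col V" "j < dim_col V"
      have "col V j \<bullet>c col V i = (1\<^sub>m (dim_col V) :: complex mat) $$ (i, j)"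
        using *[OF ij] unfolding L by (rule sym)
      then show "col V j \<bullet>c col V i = (if i = j then 1 else 0)" using ij by simp
    qed
  next
    assume R: ?R
    show ?L by (rule eq_matI) (use R * in simp_all)
  qed
  then show ?thesis unfolding isometry_mat_def by auto
qed

lemma adjoint_mult_vec_eq_0_iff:
  fixes V :: "complex mat"
  assumes "dim_vec x = dim_row V" "dim_col V = a"
  shows "mat_adjoint V *\<^sub>v x = 0\<^sub>v a \<longleftrightarrow> (\<forall>j<a. x \<bullet>c col V j = 0)"
proof
  assume L: "mat_adjoint V *\<^sub>v x = 0\<^sub>v a"
  show "\<forall>j<a. x \<bullet>c col V j = 0"
  proof (intro allI impI)
    fix j assume j: "j < a"
    then have "x \<bullet>c col V j = (mat_adjoint V *\<^sub>v x) $ j"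
      using index_mat_adjoint_mult_vec[of j V x] assms by simp
    then show "x \<bullet>c col V j = 0" unfolding L using j by simp
  qed
next
  assume R: "\<forall>j<a. x \<bullet>c col V j = 0"
  show "mat_adjoint V *\<^sub>v x = 0\<^sub>v a"
    by (rule eq_vecI) (use R assms index_mat_adjoint_mult_vec[of _ V x] in simp_all)
qed

section \<open>Joining and cutting blocks of columns\<close>

lemma join_cols_dims [simp]:
  "dim_row (join_cols B C) = dim_row B" "dim_col (join_cols B C) = dim_col B + dim_col C"
  by (simp_all add: join_cols_def)

lemma col_join_cols:
  assumes "dim_row B = dim_row C" "j < dim_col B + dim_col C"
  shows "col (join_cols B C) j = (if j < dim_col B then col B j else col C (j - dim_col B))"
  unfolding join_cols_def using assms col_dim[of B j] col_dim[of C "j - dim_col B"]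
  by (subst col_mat_of_cols) (auto simp: nth_append)

lemma index_join_cols:
  assumes "dim_row B = dim_row C" "i < dim_row B" "j < dim_col B + dim_col C"
  shows "join_cols B C $$ (i, j) = (if j < dim_col B then B $$ (i, j) else C $$ (i, j - dim_col B))"
proof -
  have "join_cols B C $$ (i, j) = col (join_cols B C) j $ i" using assms by simp
  also have "\<dots> = (if j < dim_col B then B $$ (i, j) else C $$ (i, j - dim_col B))"
    unfolding col_join_cols[OF assms(1,3)] using assms by (auto simp: col_def)
  finally show ?thesis .
qed

lemma join_cols_assoc:
  assumes "dim_row B = dim_row C" "dim_row C = dim_row E"
  shows "join_cols (join_cols B C) E = join_cols B (join_cols C E)"
proof (rule mat_col_eqI)
  fix j assume "j < dim_col (join_cols B (join_cols C E))"
  then show "col (join_cols (join_cols B C) E) j = col (join_cols B (join_cols C E)) j"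
    using assms by (auto simp: col_join_cols)
qed simp_all

lemma col_range_dims [simp]: "dim_row (col_range B c d) = dim_row B" "dim_col (col_range B c d) = d - c"
  by (simp_all add: col_range_def)

lemma col_col_range: "j < d - c \<Longrightarrow> col (col_range B c d) j = col B (c + j)"
  unfolding col_range_def by (subst col_mat_of_cols) auto

lemma col_range_full: "dim_col B = d \<Longrightarrow> col_range B 0 d = B"
  by (rule mat_col_eqI) (auto simp: col_col_range)

lemma join_col_range:
  assumes "c \<le> d" "d \<le> e"
  shows "join_cols (col_range B c d) (col_range B d e) = col_range B c e"
  by (rule mat_col_eqI) (use assms in \<open>auto simp: col_join_cols col_col_range add.commute\<close>)

lemma join_cols_empty: "dim_row B = dim_row C \<Longrightarrow> dim_col C = 0 \<Longrightarrow> join_cols B C = B"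
  by (rule mat_col_eqI) (auto simp: col_join_cols)

lemma adjoint_join_cols_mult_vec:
  assumes "dim_row B = dim_row C" "dim_vec x = dim_row B"
  shows "mat_adjoint (join_cols B C) *\<^sub>v x = (mat_adjoint B *\<^sub>v x) @\<^sub>v (mat_adjoint C *\<^sub>v x)"
proof (rule eq_vecI)
  fix j assume j: "j < dim_vec ((mat_adjoint B *\<^sub>v x) @\<^sub>v (mat_adjoint C *\<^sub>v x))"
  then have "(mat_adjoint (join_cols B C) *\<^sub>v x) $ j = x \<bullet>c col (join_cols B C) j"
    using assms by (intro index_mat_adjoint_mult_vec) auto
  also have "\<dots> = ((mat_adjoint B *\<^sub>v x) @\<^sub>v (mat_adjoint C *\<^sub>v x)) $ j"
    using j assms index_mat_adjoint_mult_vec[of j B x] index_mat_adjoint_mult_vec[of "j - dim_col B" C x]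
    by (simp add: col_join_cols)
  finally show "(mat_adjoint (join_cols B C) *\<^sub>v x) $ j =
      ((mat_adjoint B *\<^sub>v x) @\<^sub>v (mat_adjoint C *\<^sub>v x)) $ j" .
qed simp

lemma isometry_join_cols:
  assumes B: "isometry_mat n B" and C: "isometry_mat n C"
    and BC: "\<And>j. j < dim_col C \<Longrightarrow> mat_adjoint B *\<^sub>v col C j = 0\<^sub>v (dim_col B)"
  shows "isometry_mat n (join_cols B C)"
proof -
  have dims: "dim_row B = n" "dim_row C = n" using B C unfolding isometry_mat_def by blast+
  have orth: "col C j \<bullet>c col B i = 0" if "i < dim_col B" "j < dim_col C" for i j
    using BC[OF that(2)] adjoint_mult_vec_eq_0_iff[of "col C j" B "dim_col B"] that dims by simp
  then have orth': "col B i \<bullet>c col C j = 0" if "i < dim_col B" "j < dim_col C" for i j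
    using cscalar_prod_commute[of "col B i" n "col C j"] that col_dim[of B i] col_dim[of C j] dims by simp
  have "col B i \<bullet>c col B j = (if i = j then 1 else 0)" if "i < dim_col B" "j < dim_col B" for i j
    using B that unfolding isometry_mat_iff by blast
  moreover have "col C i \<bullet>c col C j = (if i = j then 1 else 0)" if "i < dim_col C" "j < dim_col C" for i j
    using C that unfolding isometry_mat_iff by blast
  ultimately show ?thesis
    unfolding isometry_mat_iff using dims orth orth'
    by (auto simp: col_join_cols)
qed

lemma orth_proj_index:
  assumes "i < dim_row V" "dim_vec x = dim_row V"
  shows "orth_proj V x $ i = (\<Sum>j<dim_col V. V $$ (i, j) * (x \<bullet>c col V j))"
proof -
  have "orth_proj V x $ i = (\<Sum>j<dim_col V. V $$ (i, j) * (mat_adjoint V *\<^sub>v x) $ j)"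
    using assms(1) by (simp add: orth_proj_def scalar_prod_def lessThan_atLeast0)
  then show ?thesis using assms(2) index_mat_adjoint_mult_vec[of _ V x] by simp
qed

lemma orth_proj_join_cols:
  assumes "dim_row B = dim_row C" "dim_vec x = dim_row B"
  shows "orth_proj (join_cols B C) x = orth_proj B x + orth_proj C x"
proof (rule eq_vecI)
  fix i assume "i < dim_vec (orth_proj B x + orth_proj C x)"
  then have i: "i < dim_row B" using assms by simp
  define g where "g = (\<lambda>j. join_cols B C $$ (i, j) * (x \<bullet>c col (join_cols B C) j))"
  have "orth_proj (join_cols B C) x $ i = sum g {..<dim_col B + dim_col C}"
    using orth_proj_index[of i "join_cols B C" x] i assms by (simp add: g_def)
  also have "\<dots> = sum g {..<dim_col B} + (\<Sum>j<dim_col C. g (j + dim_col B))"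
    using sum.atLeastLessThan_concat[of 0 "dim_col B" "dim_col B + dim_col C" g]
      sum.shift_bounds_nat_ivl[of g 0 "dim_col B" "dim_col C"]
    by (simp add: lessThan_atLeast0 add.commute)
  also have "\<dots> = (\<Sum>j<dim_col B. B $$ (i, j) * (x \<bullet>c col B j)) + (\<Sum>j<dim_col C. C $$ (i, j) * (x \<bullet>c col C j))"
    using i assms by (simp add: g_def index_join_cols col_join_cols)
  also have "\<dots> = (orth_proj B x + orth_proj C x) $ i"
    using orth_proj_index[of i B x] orth_proj_index[of i C x] i assms by simp
  finally show "orth_proj (join_cols B C) x $ i = (orth_proj B x + orth_proj C x) $ i" .
qed (use assms in simp)

lemma adjoint_mult_mult_vec:
  fixes V U :: "complex mat"
  assumes "V \<in> carrier_mat n a" "U \<in> carrier_mat a c" "x \<in> carrier_vec n"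
  shows "mat_adjoint (V * U) *\<^sub>v x = mat_adjoint U *\<^sub>v (mat_adjoint V *\<^sub>v x)"
  unfolding mat_adjoint_mult[OF assms(1,2)]
  by (rule assoc_mult_mat_vec[OF mat_adjoint_carrier[OF assms(2)] mat_adjoint_carrier[OF assms(1)] assms(3)])

lemma isometry_mult:
  assumes V: "isometry_mat n V" and U: "isometry_mat (dim_col V) U"
  shows "isometry_mat n (V * U)"
proof -
  define a where "a = dim_col V"
  define c where "c = dim_col U"
  have cV: "V \<in> carrier_mat n a" "mat_adjoint V \<in> carrier_mat a n" and cU: "U \<in> carrier_mat a c" "mat_adjoint U \<in> carrier_mat c a"
    using isometry_mat_carrier[OF V] isometry_mat_carrier[OF U] mat_adjoint_carrier
    unfolding a_def c_def by blast+
  have "mat_adjoint (V * U) * (V * U) = mat_adjoint U * (mat_adjoint V * (V * U))"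
    unfolding mat_adjoint_mult[OF cV(1) cU(1)]
    by (rule assoc_mult_mat[OF cU(2) cV(2) mult_carrier_mat[OF cV(1) cU(1)]])
  also have "mat_adjoint V * (V * U) = (mat_adjoint V * V) * U"
    by (rule assoc_mult_mat[OF cV(2,1) cU(1), symmetric])
  also have "\<dots> = U" unfolding isometry_matD[OF V] using cU(1) by (simp add: a_def)
  also have "mat_adjoint U * U = 1\<^sub>m c" using isometry_matD[OF U] by (simp add: c_def)
  finally show ?thesis using cV(1) unfolding isometry_mat_def c_def by simp
qed

lemma compress_mult:
  assumes "A \<in> carrier_mat n n" "V \<in> carrier_mat n a" "U \<in> carrier_mat a c"
  shows "compress (V * U) A = compress U (compress V A)"
proof -
  have c: "mat_adjoint V \<in> carrier_mat a n" "mat_adjoint U \<in> carrier_mat c a" using assms by auto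
  note VA = mult_carrier_mat[OF c(1) assms(1)]
  have "compress (V * U) A = mat_adjoint U * mat_adjoint V * A * (V * U)"
    unfolding compress_def mat_adjoint_mult[OF assms(2,3)] ..
  also have "\<dots> = mat_adjoint U * (mat_adjoint V * A) * (V * U)"
    by (simp only: assoc_mult_mat[OF c(2,1) assms(1)])
  also have "\<dots> = mat_adjoint U * ((mat_adjoint V * A) * (V * U))"
    by (rule assoc_mult_mat[OF c(2) VA mult_carrier_mat[OF assms(2,3)]])
  also have "(mat_adjoint V * A) * (V * U) = mat_adjoint V * A * V * U"
    by (rule assoc_mult_mat[OF VA assms(2,3), symmetric])
  also have "mat_adjoint U * (mat_adjoint V * A * V * U) = mat_adjoint U * (mat_adjoint V * A * V) * U"
    by (rule assoc_mult_mat[OF c(2) mult_carrier_mat[OF VA assms(2)] assms(3), symmetric])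
  finally show ?thesis unfolding compress_def .
qed

lemma index_compress:
  assumes "A \<in> carrier_mat n n" "V \<in> carrier_mat n a" "i < a" "j < a"
  shows "compress V A $$ (i, j) = (A *\<^sub>v col V j) \<bullet>c col V i"
proof -
  have "compress V A = mat_adjoint V * (A * V)"
    unfolding compress_def by (rule assoc_mult_mat[OF mat_adjoint_carrier[OF assms(2)] assms(1,2)])
  then show ?thesis
    using adjoint_mult_index[OF mult_carrier_mat[OF assms(1,2)] assms(2,3,4)]
    by (simp only: col_mult2[OF assms(1,2,4)])
qed

context hermitian_mat
begin

lemma op_sym:
  assumes "x \<in> carrier_vec n" "y \<in> carrier_vec n"
  shows "(A *\<^sub>v x) \<bullet>c y = x \<bullet>c (A *\<^sub>v y)"
  using cscalar_prod_mult_mat_vec[OF A assms] hermitian_adjoint[OF hermitian] by simp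

lemma op_sym_cnj:
  assumes "x \<in> carrier_vec n" "y \<in> carrier_vec n"
  shows "(A *\<^sub>v x) \<bullet>c y = cnj ((A *\<^sub>v y) \<bullet>c x)"
  using op_sym[OF assms] cscalar_prod_commute[OF assms(1) op_carrier] by simp

text \<open>Translates data given by columns into the projections of \<open>rational_step\<close>.
  The rank-one coupling is carried by \<open>h = V *\<^sub>v \<beta>\<close> and the first column of
  \<open>T\<close>, the only one that \<open>A\<close> links to the range of
  \<open>V\<close>.\<close>

lemma compression_step_bound:
  assumes V: "isometry_mat n V" and U: "isometry_mat (dim_col V) U" and T: "isometry_mat n T"
    and T_pos: "dim_col T > 0" and \<beta>: "\<beta> \<in> carrier_vec (dim_col V)" and b: "b \<in> carrier_vec n"
    and VT: "\<And>j. j < dim_col T \<Longrightarrow> mat_adjoint V *\<^sub>v col T j = 0\<^sub>v (dim_col V)"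
    and VAT: "\<And>j. j < dim_col T \<Longrightarrow>
      mat_adjoint V *\<^sub>v (A *\<^sub>v col T j) = (if j = 0 then \<beta> else 0\<^sub>v (dim_col V))"
    and poles: "length \<xi>s = k" "k > 0" "cnj_closed \<xi>s" "poles_admissible (compress V A) \<xi>s"
    and krylov: "\<And>r. r \<in> rational_functions k \<xi>s \<Longrightarrow>
      \<exists>x\<in>carrier_vec (dim_col U). mat_fun r (compress V A) *\<^sub>v \<beta> = U *\<^sub>v x"
    and X: "field_of_values A \<noteq> {}"
    and d: "d dvd pole_poly \<xi>s" "\<And>x. x \<in> field_of_values A \<Longrightarrow> poly d x \<noteq> 0"
    and p: "p = 0 \<or> degree p + degree (pole_poly \<xi>s) < degree d + k"
    and e: "e \<ge> 0" "\<And>x. x \<in> field_of_values A \<Longrightarrow> cmod (f x - poly p x / poly d x) \<le> e"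
  shows "norm2 (proj_fun_diff (join_cols V T) V f b - proj_fun_diff (join_cols (V * U) T) (V * U) f b)
    \<le> 4 * e * norm2 b"
proof -
  define a where "a = dim_col V"
  define c where "c = dim_col T"
  define u where "u = dim_col U"
  define h where "h = V *\<^sub>v \<beta>"
  define t where "t = col T 0"
  note carrs = isometry_mat_carrier[OF V, folded a_def] isometry_mat_carrier[OF T, folded c_def]
    isometry_mat_carrier[OF U, folded a_def u_def]
  have dims: "dim_row V = n" "dim_row T = n" "dim_row U = a" "dim_col V = a" "dim_col T = c" "dim_col U = u"
    using carrs by (simp_all only: carrier_matD)
  have \<beta>': "\<beta> \<in> carrier_vec a" using \<beta> by (simp only: dims)
  have h: "h \<in> carrier_vec n" "orth_proj V h = h"
    using carrs(1) \<beta>' orth_proj_mult[OF V \<beta>] by (auto simp: h_def)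
  have Vh: "mat_adjoint V *\<^sub>v h = \<beta>" using isometry_mat_cancel[OF V \<beta>] by (simp add: h_def)
  have t: "t \<in> carrier_vec n" using col_dim[of T 0] dims by (simp add: t_def)
  have colT: "col T j \<in> carrier_vec n" for j using col_dim[of T j] dims by simp
  have colV: "col V j \<in> carrier_vec n" for j using col_dim[of V j] dims by simp
  have "T *\<^sub>v unit_vec c 0 = t"
    using T_pos by (intro eq_vecI) (auto simp: t_def dims)
  then have Tt: "orth_proj T t = t"
    using orth_proj_mult[OF T, of "unit_vec c 0"] by (simp add: dims)
  have orth: "col T j \<bullet>c col V i = 0" if "i < a" "j < c" for i j
    using VT[of j] adjoint_mult_vec_eq_0_iff[of "col T j" V a] that dims by (simp add: dims)
  have VT0: "orth_proj V (orth_proj T x) = 0\<^sub>v n" and TV0: "orth_proj T (orth_proj V x) = 0\<^sub>v n"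
    if x: "x \<in> carrier_vec n" for x
  proof -
    have P: "(V *\<^sub>v y) \<bullet>c col T j = 0" if "j < c" "y \<in> carrier_vec a" for y j
    proof -
      have "(V *\<^sub>v y) \<bullet>c col T j = y \<bullet>c (mat_adjoint V *\<^sub>v col T j)"
        by (rule cscalar_prod_mult_mat_vec[OF carrs(1) that(2) colT])
      then show ?thesis using VT[of j] that by (simp add: dims)
    qed
    have "mat_adjoint T *\<^sub>v (V *\<^sub>v y) = 0\<^sub>v c" if "y \<in> carrier_vec a" for y
      using adjoint_mult_vec_eq_0_iff[of "V *\<^sub>v y" T c] P that dims by (simp add: dims)
    moreover have c: "mat_adjoint V *\<^sub>v x \<in> carrier_vec a" by (rule adjoint_mult_vec_carrier) (simp add: dims)
    ultimately have "mat_adjoint T *\<^sub>v orth_proj V x = 0\<^sub>v c" by (simp add: orth_proj_def)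
    then show TV: "orth_proj T (orth_proj V x) = 0\<^sub>v n"
      using carrs(2) orth_proj_def[of T "orth_proj V x"] by (auto intro!: eq_vecI)
    have "mat_adjoint V *\<^sub>v (T *\<^sub>v y) = 0\<^sub>v a" if y: "y \<in> carrier_vec c" for y
    proof -
      have "mat_adjoint T *\<^sub>v col V i = 0\<^sub>v c" if "i < a" for i
        using adjoint_mult_vec_eq_0_iff[of "col V i" T c] orth[OF that] dims
          cscalar_prod_commute[OF colV colT, of i] by (simp add: dims)
      then have "(T *\<^sub>v y) \<bullet>c col V i = 0" if "i < a" for i
        using cscalar_prod_mult_mat_vec[OF carrs(2) y colV, of i] that y by simp
      then show ?thesis using adjoint_mult_vec_eq_0_iff[of "T *\<^sub>v y" V a] dims by (simp add: dims)
    qed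
    moreover have "mat_adjoint T *\<^sub>v x \<in> carrier_vec c" by (rule adjoint_mult_vec_carrier) (simp add: dims)
    ultimately have "mat_adjoint V *\<^sub>v orth_proj T x = 0\<^sub>v a" by (simp add: orth_proj_def)
    then show "orth_proj V (orth_proj T x) = 0\<^sub>v n"
      using carrs(1) orth_proj_def[of V "orth_proj T x"] by (auto intro!: eq_vecI)
  qed
  \<comment> \<open>Symmetry of \<open>A\<close> turns the column hypothesis \<open>VAT\<close> into
    the coupling from \<open>V\<close> to \<open>T\<close>; using symmetry once more,
    \<open>VA\<close> below extends the reverse coupling from single columns to the whole range of
    \<open>T\<close>.\<close>
  have TA: "orth_proj T (A *\<^sub>v x) = (x \<bullet>c h) \<cdot>\<^sub>v t" if x: "x \<in> carrier_vec n" "orth_proj V x = x" for x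
  proof -
    have vx: "mat_adjoint V *\<^sub>v x \<in> carrier_vec a" by (rule adjoint_mult_vec_carrier) (simp add: dims)
    have "(A *\<^sub>v x) \<bullet>c col T j = (if j = 0 then x \<bullet>c h else 0)" if j: "j < c" for j
    proof -
      have "(A *\<^sub>v x) \<bullet>c col T j = (V *\<^sub>v (mat_adjoint V *\<^sub>v x)) \<bullet>c (A *\<^sub>v col T j)"
        using op_sym[OF x(1) colT] x(2) by (simp add: orth_proj_def)
      also have "\<dots> = (mat_adjoint V *\<^sub>v x) \<bullet>c (mat_adjoint V *\<^sub>v (A *\<^sub>v col T j))"
        by (rule cscalar_prod_mult_mat_vec[OF carrs(1) vx op_carrier])
      also have "\<dots> = (if j = 0 then (mat_adjoint V *\<^sub>v x) \<bullet>c (mat_adjoint V *\<^sub>v h) else 0)"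
        using VAT[of j] j vx Vh by (simp add: dims)
      also have "(mat_adjoint V *\<^sub>v x) \<bullet>c (mat_adjoint V *\<^sub>v h) = x \<bullet>c h"
        using cscalar_prod_mult_mat_vec[OF carrs(1) vx h(1)] x(2) by (simp add: orth_proj_def)
      finally show ?thesis .
    qed
    then have "mat_adjoint T *\<^sub>v (A *\<^sub>v x) = (x \<bullet>c h) \<cdot>\<^sub>v unit_vec c 0"
      using index_mat_adjoint_mult_vec[of _ T "A *\<^sub>v x"] dims
      by (intro eq_vecI) (auto simp: dims)
    then show ?thesis
      using mult_mat_vec[OF carrs(2), of "unit_vec c 0"] \<open>T *\<^sub>v unit_vec c 0 = t\<close>
      by (simp add: orth_proj_def)
  qed
  have VA: "orth_proj V (A *\<^sub>v x) = (x \<bullet>c t) \<cdot>\<^sub>v h" if x: "x \<in> carrier_vec n" "orth_proj T x = x" for x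
  proof -
    have "(A *\<^sub>v x) \<bullet>c col V i = (x \<bullet>c t) * \<beta> $ i" if i: "i < a" for i
    proof -
      have "V *\<^sub>v unit_vec a i = col V i"
        using carrs(1) i by (intro eq_vecI) auto
      then have Vi: "orth_proj V (col V i) = col V i"
        using orth_proj_mult[OF V, of "unit_vec a i"] by (simp add: dims)
      have "(A *\<^sub>v x) \<bullet>c col V i = orth_proj T x \<bullet>c (A *\<^sub>v col V i)"
        using op_sym[OF x(1) colV] x(2) by simp
      also have "\<dots> = x \<bullet>c orth_proj T (A *\<^sub>v col V i)"
        by (rule orth_proj_sym[OF T x(1) op_carrier])
      also have "\<dots> = x \<bullet>c ((col V i \<bullet>c h) \<cdot>\<^sub>v t)" using TA[OF colV Vi] by simp
      also have "\<dots> = cnj (col V i \<bullet>c h) * (x \<bullet>c t)"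
        using x t by (simp add: conjugate_smult_vec scalar_prod_smult_distrib[of _ n])
      also have "cnj (col V i \<bullet>c h) = (mat_adjoint V *\<^sub>v h) $ i"
        using cscalar_prod_commute[OF h(1) colV, of i] index_mat_adjoint_mult_vec[of i V h] i h dims
        by (simp add: dims)
      finally show ?thesis by (simp add: Vh mult.commute)
    qed
    then have "mat_adjoint V *\<^sub>v (A *\<^sub>v x) = (x \<bullet>c t) \<cdot>\<^sub>v \<beta>"
      using index_mat_adjoint_mult_vec[of _ V "A *\<^sub>v x"] dims \<beta>'
      by (intro eq_vecI) (auto simp: dims)
    then show ?thesis
      using mult_mat_vec[OF carrs(1) \<beta>'] by (simp add: orth_proj_def h_def)
  qed
  note VU = isometry_mult[OF V U]
  have VUx: "orth_proj (V * U) x = V *\<^sub>v (U *\<^sub>v (mat_adjoint U *\<^sub>v (mat_adjoint V *\<^sub>v x)))"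
    if "x \<in> carrier_vec n" for x
    using adjoint_mult_mult_vec[OF carrs(1,3) that]
      assoc_mult_mat_vec[OF carrs(1,3), of "mat_adjoint U *\<^sub>v (mat_adjoint V *\<^sub>v x)"]
      adjoint_mult_vec_carrier[of U u] by (simp add: orth_proj_def dims)
  have VVU: "orth_proj V (orth_proj (V * U) x) = orth_proj (V * U) x" if x: "x \<in> carrier_vec n" for x
    unfolding VUx[OF x]
    by (rule orth_proj_mult[OF V]) (use carrs(3) in \<open>auto simp: dims intro!: carrier_vecI\<close>)
  have VUV: "orth_proj (V * U) (orth_proj V x) = orth_proj (V * U) x" if x: "x \<in> carrier_vec n" for x
    using VUx[OF x] VUx[OF orth_proj_carrier[OF dims(1)], of x]
      isometry_mat_cancel[OF V adjoint_mult_vec_carrier[OF refl], of x]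
    by (simp add: orth_proj_def[of V x])
  have Z: "isometry_mat n (join_cols V T)" by (rule isometry_join_cols[OF V T VT])
  have Z': "isometry_mat n (join_cols (V * U) T)"
  proof (rule isometry_join_cols[OF VU T])
    fix j assume "j < dim_col T"
    then show "mat_adjoint (V * U) *\<^sub>v col T j = 0\<^sub>v (dim_col (V * U))"
      using adjoint_mult_mult_vec[OF carrs(1,3) colT, of j] VT[of j] mat_adjoint_carrier[OF carrs(3)]
      by (auto simp: dims intro!: eq_vecI)
  qed
  \<comment> \<open>The fraction is expanded by the cofactor \<open>d'\<close> to the full
    denominator. Both forms agree on the spectrum of the compression, where admissibility keeps the
    pole polynomial nonzero, although it may vanish elsewhere in the field of values.\<close>
  have kry: "orth_proj (V * U) (proj_fun A V (\<lambda>x. poly p x / poly d x) h) =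
      proj_fun A V (\<lambda>x. poly p x / poly d x) h"
    if d: "d dvd pole_poly \<xi>s" and p: "p = 0 \<or> degree p + degree (pole_poly \<xi>s) < degree d + k" for d p
  proof -
    obtain d' where d': "pole_poly \<xi>s = d * d'" using d by (rule dvdE)
    have nz: "d \<noteq> 0" "d' \<noteq> 0" using d' pole_poly_nonzero[of \<xi>s] by auto
    have "degree (p * d') < k"
    proof (cases "p = 0")
      case False
      then show ?thesis using p nz by (simp add: degree_mult_eq d')
    qed (use poles in simp)
    then have r: "(\<lambda>x. poly (p * d') x / poly (pole_poly \<xi>s) x) \<in> rational_functions k \<xi>s"
      unfolding rational_functions_def by blast
    obtain x where x: "x \<in> carrier_vec u"
      "mat_fun (\<lambda>x. poly (p * d') x / poly (pole_poly \<xi>s) x) (compress V A) *\<^sub>v \<beta> = U *\<^sub>v x"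
      using krylov[OF r] by (auto simp: dims)
    have "mat_fun (\<lambda>x. poly p x / poly d x) (compress V A) =
        mat_fun (\<lambda>x. poly (p * d') x / poly (pole_poly \<xi>s) x) (compress V A)"
    proof (rule mat_fun_cong[OF compress_V(2,1)[OF V]])
      fix z assume "eigenvalue (compress V A) z"
      then have "poly (pole_poly \<xi>s) z \<noteq> 0"
        using poles(4) by (auto simp: poles_admissible_def poly_pole_poly_eq_0_iff)
      then show "poly p z / poly d z = poly (p * d') z / poly (pole_poly \<xi>s) z" by (simp add: d')
    qed
    then have "proj_fun A V (\<lambda>x. poly p x / poly d x) h = (V * U) *\<^sub>v x"
      using x assoc_mult_mat_vec[OF carrs(1,3) x(1)] by (simp add: proj_fun_def Vh)
    then show ?thesis using orth_proj_mult[OF VU, of x] x(1) by (simp add: dims)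
  qed
  interpret rational_step A n V "V * U" T "join_cols V T" "join_cols (V * U) T" h t b "pole_poly \<xi>s" k
  proof unfold_locales
    show "orth_proj (join_cols V T) x = orth_proj V x + orth_proj T x" if "x \<in> carrier_vec n" for x
      using that dims by (intro orth_proj_join_cols) auto
    show "orth_proj (join_cols (V * U) T) x = orth_proj (V * U) x + orth_proj T x" if "x \<in> carrier_vec n" for x
      using that dims by (intro orth_proj_join_cols) auto
    show "degree (pole_poly \<xi>s) \<le> k" using degree_pole_poly_le[of \<xi>s] poles(1) by simp
    show "map_poly cnj (pole_poly \<xi>s) = pole_poly \<xi>s" by (rule cnj_closed_pole_poly[OF poles(3)])
    show "orth_proj (V * U) (proj_fun A V (\<lambda>x. poly p x / poly d x) h) =
        proj_fun A V (\<lambda>x. poly p x / poly d x) h"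
      if "d dvd pole_poly \<xi>s" "\<And>x. x \<in> field_of_values A \<Longrightarrow> poly d x \<noteq> 0"
        "p = 0 \<or> degree p + degree (pole_poly \<xi>s) < degree d + k" for d p
      by (rule kry[OF that(1,3)])
  qed (fact V VU T Z Z' h t Tt b VVU VUV VT0 TV0 VA TA)+
  show ?thesis
    by (rule step_bound[OF X _ _ e]) (use d p in \<open>auto simp: denom_def numer_def\<close>)
qed

end

section \<open>Rational Lanczos bases\<close>

lemma orthonormal_basis_matrixD:
  assumes "orthonormal_basis_matrix U W" "dim_row U = n"
  shows "isometry_mat n U" "W = {U *\<^sub>v x |x. x \<in> carrier_vec (dim_col U)}"
proof -
  show "isometry_mat n U" using assms unfolding orthonormal_basis_matrix_def isometry_mat_def by blast
  have U: "U \<in> carrier_mat n (dim_col U)" using assms(2) by (intro carrier_matI) auto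
  have "W = vec_space.col_space n U" using assms unfolding orthonormal_basis_matrix_def by simp
  also have "\<dots> = {y \<in> carrier_vec (dim_row U). \<exists>x\<in>carrier_vec (dim_col U). U *\<^sub>v x = y}"
    by (rule vec_space.col_space_eq[OF U])
  also have "\<dots> = {U *\<^sub>v x |x. x \<in> carrier_vec (dim_col U)}" by (auto intro!: carrier_vecI)
  finally show "W = {U *\<^sub>v x |x. x \<in> carrier_vec (dim_col U)}" .
qed

lemma pole_poly_append: "pole_poly (xs @ ys) = pole_poly xs * pole_poly ys"
  by (simp add: pole_poly_def)

lemma outer_prod_unit_right:
  assumes "i < dim_vec x" "j < m"
  shows "outer_prod x (unit_vec m 0) $$ (i, j) = (if j = 0 then x $ i else 0)"
  using assms by (auto simp: outer_prod_def)

lemma outer_prod_unit_left: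
  assumes "i < m" "j < dim_vec x"
  shows "outer_prod (unit_vec m 0) x $$ (i, j) = (if i = 0 then cnj (x $ j) else 0)"
  using assms by (auto simp: outer_prod_def)

locale rational_lanczos = hermitian_mat A n for A n +
  fixes b :: "complex vec" and Q :: "complex mat" and \<theta>s :: "pole list" and k m s :: nat
  assumes b: "b \<in> carrier_vec n" and b0: "b \<noteq> 0\<^sub>v n" and pos: "k > 0" "m > 0" "s > 0"
    and len: "length \<theta>s = k + s * m" and inf: "\<And>i. \<lbrakk>1 \<le> i; i < s\<rbrakk> \<Longrightarrow> \<theta>s ! (k + i * m) = None"
    and adm: "poles_admissible A \<theta>s" and basis: "rational_lanczos_basis A b \<theta>s Q"
begin

abbreviation "M \<equiv> k + s * m"
abbreviation "q \<equiv> col Q"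
abbreviation "blk \<equiv> lanczos_block k m Q"

lemma Q_dims [simp]: "dim_row Q = n" "dim_col Q = M"
  using basis len A by (auto simp: rational_lanczos_basis_def)

lemma Q_isometry: "isometry_mat n Q"
proof -
  have "M \<in> {1..length \<theta>s}" using len pos by simp
  then have "orthonormal_basis_matrix (col_range Q 0 M) (rational_krylov A b (take M \<theta>s))"
    using basis unfolding rational_lanczos_basis_def by blast
  then show ?thesis
    using orthonormal_basis_matrixD(1)[of "col_range Q 0 M" _ n] col_range_full[of Q M] by simp
qed

lemma q_carrier [simp]: "q j \<in> carrier_vec n"
  using col_dim[of Q j] by simp

lemma q_orth: "i < M \<Longrightarrow> j < M \<Longrightarrow> q i \<bullet>c q j = (if i = j then 1 else 0)"
  using Q_isometry unfolding isometry_mat_iff by simp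

lemma q0: "q 0 = complex_of_real (1 / norm2 b) \<cdot>\<^sub>v b"
  using basis by (simp add: rational_lanczos_basis_def)

lemma b_q: "b = complex_of_real (norm2 b) \<cdot>\<^sub>v q 0"
  using b b0 norm2_eq_0_iff[OF b] by (simp add: q0 smult_smult_assoc)

lemma b_q_prod: "j < M \<Longrightarrow> b \<bullet>c q j = (if j = 0 then complex_of_real (norm2 b) else 0)"
  using q_orth[of 0 j] pos by (subst b_q) (simp add: smult_scalar_prod_distrib[of _ n])

text \<open>With l = k + i * m, the infinite pole at index l adds no factor to the denominator but
  one degree to the numerator. So \<open>A\<close> maps the span of the first l columns into that of
  the first l + 1, to which every later column is orthogonal.\<close>

lemma op_q_upper:
  assumes i: "1 \<le> i" "i < s" and c: "c < k + i * m" and j: "k + i * m < j" "j < M"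
  shows "(A *\<^sub>v q c) \<bullet>c q j = 0"
proof -
  define l where "l = k + i * m"
  have l: "1 \<le> l" "Suc l \<le> M" "l < length \<theta>s" using pos c j len unfolding l_def by linarith+
  define B where "B = (\<lambda>l. col_range Q 0 l)"
  have bas: "orthonormal_basis_matrix (B l') (rational_krylov A b (take l' \<theta>s))"
    if "1 \<le> l'" "l' \<le> M" for l'
    using basis len that by (auto simp: rational_lanczos_basis_def B_def)
  have range: "{mat_fun r A *\<^sub>v b |r. r \<in> rational_functions l' (take l' \<theta>s)} =
      {B l' *\<^sub>v x |x. x \<in> carrier_vec l'}" if "1 \<le> l'" "l' \<le> M" for l'
  proof -
    have "poles_admissible A (take l' \<theta>s)"
      using adm by (auto simp: poles_admissible_def dest: in_set_takeD)
    then show ?thesis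
      using orthonormal_basis_matrixD(2)[OF bas[OF that], of n]
        rational_krylov_eq[OF hermitian A b, of "take l' \<theta>s"] that len by (simp add: B_def)
  qed
  have "B l *\<^sub>v unit_vec l c = col (B l) c"
    using c by (intro eq_vecI) (auto simp: B_def l_def)
  also have "\<dots> = q c" unfolding B_def using c by (subst col_col_range) (auto simp: l_def)
  finally have "B l *\<^sub>v unit_vec l c = q c" .
  then have "q c \<in> {B l *\<^sub>v x |x. x \<in> carrier_vec l}" by (metis (mono_tags, lifting) mem_Collect_eq unit_vec_carrier)
  then obtain r where r: "r \<in> rational_functions l (take l \<theta>s)" "q c = mat_fun r A *\<^sub>v b"
    using range[of l] l by auto
  then obtain p where p: "degree p < l" "r = (\<lambda>x. poly p x / poly (pole_poly (take l \<theta>s)) x)"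
    unfolding rational_functions_def by blast
  have "take (Suc l) \<theta>s = take l \<theta>s @ [None]"
    using l inf[OF i] by (simp add: take_Suc_conv_app_nth l_def)
  then have same: "pole_poly (take (Suc l) \<theta>s) = pole_poly (take l \<theta>s)"
    by (simp add: pole_poly_append) (simp add: pole_poly_def)
  have "degree (pCons 0 p) < Suc l" using p(1) by simp
  moreover have "(\<lambda>x. x * r x) = (\<lambda>x. poly (pCons 0 p) x / poly (pole_poly (take (Suc l) \<theta>s)) x)"
    unfolding same p(2) by auto
  ultimately have "(\<lambda>x. x * r x) \<in> rational_functions (Suc l) (take (Suc l) \<theta>s)"
    unfolding rational_functions_def by blast
  moreover have "A *\<^sub>v q c = mat_fun (\<lambda>x. x * r x) A *\<^sub>v b"
    using mat_fun_mult[OF hermitian A, of "\<lambda>x. x" r] mat_fun_carrier[OF hermitian A, of r] A b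
    by (simp add: r(2) mat_fun_id[OF hermitian A] assoc_mult_mat_vec[of _ n n _ n])
  ultimately have "A *\<^sub>v q c \<in> {B (Suc l) *\<^sub>v x |x. x \<in> carrier_vec (Suc l)}"
    using range[of "Suc l"] l by auto
  then obtain x where x: "x \<in> carrier_vec (Suc l)" "A *\<^sub>v q c = B (Suc l) *\<^sub>v x" by blast
  have cB: "B (Suc l) \<in> carrier_mat n (Suc l)" by (intro carrier_matI) (simp_all add: B_def)
  have "mat_adjoint (B (Suc l)) *\<^sub>v q j = 0\<^sub>v (Suc l)"
    using q_orth[of j] j l by (subst adjoint_mult_vec_eq_0_iff) (auto simp: B_def col_col_range l_def)
  then show ?thesis
    using cscalar_prod_mult_mat_vec[OF cB x(1) q_carrier, of j] x by simp
qed

lemma op_q_lower: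
  assumes "1 \<le> i" "i < s" "c < k + i * m" "k + i * m < j" "j < M"
  shows "(A *\<^sub>v q j) \<bullet>c q c = 0"
  using op_sym_cnj[OF q_carrier q_carrier, of j c] op_q_upper[OF assms] by simp

lemma field_of_values_nonempty: "field_of_values A \<noteq> {}"
proof -
  have "norm2 (q 0) = 1"
    using norm2_eq_0_iff[OF b] b0 by (simp add: q0 norm2_smult norm_divide)
  then show ?thesis using A q_carrier[of 0] unfolding field_of_values_def by fastforce
qed

lemma col_range_isometry:
  assumes "d \<le> M"
  shows "isometry_mat n (col_range Q c d)"
  unfolding isometry_mat_iff using q_orth assms by (auto simp: col_col_range)

lemma adjoint_col_range_index:
  assumes "x \<in> carrier_vec n" "j < d - c"
  shows "(mat_adjoint (col_range Q c d) *\<^sub>v x) $ j = x \<bullet>c q (c + j)"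
  using index_mat_adjoint_mult_vec[of j "col_range Q c d" x] assms by (simp add: col_col_range)

lemma adjoint_col_range_eq_0:
  assumes "x \<in> carrier_vec n" "\<And>j. c \<le> j \<Longrightarrow> j < d \<Longrightarrow> x \<bullet>c q j = 0"
  shows "mat_adjoint (col_range Q c d) *\<^sub>v x = 0\<^sub>v (d - c)"
  by (rule eq_vecI) (use assms adjoint_col_range_index[OF assms(1)] in auto)

lemma adjoint_col_range_start:
  assumes "d \<le> M"
  shows "mat_adjoint (col_range Q 0 d) *\<^sub>v b = start_vec b d"
  by (rule eq_vecI)
    (use assms adjoint_col_range_index[OF b, of _ d 0] b_q_prod in \<open>auto simp: start_vec_def\<close>)

lemma blk_1: "blk 1 = col_range Q 0 (k + m)"
  by (simp add: lanczos_block_def)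

lemma blk_Suc: "i \<ge> 1 \<Longrightarrow> blk (Suc i) = col_range Q (k + i * m) (k + Suc i * m)"
  by (simp add: lanczos_block_def)

end

text \<open>Only the first column of \<open>C\<close> is coupled to \<open>B\<close>, so the
  off-diagonal blocks have rank one. This is the shape in which the algorithm assembles its matrices
  \<open>S\<close>.\<close>

lemma compress_join_cols:
  assumes A: "A \<in> carrier_mat n n" "mat_adjoint A = A"
    and B: "B \<in> carrier_mat n p" and C: "C \<in> carrier_mat n m"
    and x: "x \<in> carrier_vec p"
    and BAC: "\<And>j. j < m \<Longrightarrow> mat_adjoint B *\<^sub>v (A *\<^sub>v col C j) = (if j = 0 then x else 0\<^sub>v p)"
  shows "compress (join_cols B C) A = four_block_mat (compress B A) (outer_prod x (unit_vec m 0))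
    (outer_prod (unit_vec m 0) x) (compress C A)"
proof (rule eq_matI)
  interpret hermitian_mat A n using A by unfold_locales (auto simp: hermitian_def)
  have dims: "dim_row B = n" "dim_col B = p" "dim_row C = n" "dim_col C = m" "dim_vec x = p" using B C x by auto
  have dimo: "dim_row (outer_prod x (unit_vec m 0)) = p" "dim_col (outer_prod x (unit_vec m 0)) = m"
    "dim_row (outer_prod (unit_vec m 0) x) = m" "dim_col (outer_prod (unit_vec m 0) x) = p"
    using dims by (simp_all add: outer_prod_def)
  have J: "join_cols B C \<in> carrier_mat n (p + m)" using dims by (intro carrier_matI) simp_all
  have colB: "col B j \<in> carrier_vec n" and colC: "col C j \<in> carrier_vec n" for j
    using col_dim[of B j] col_dim[of C j] dims by simp_all
  have BC: "(A *\<^sub>v col C j) \<bullet>c col B i = (if j = 0 then x $ i else 0)" if "i < p" "j < m" for i j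
  proof -
    have "(A *\<^sub>v col C j) \<bullet>c col B i = (mat_adjoint B *\<^sub>v (A *\<^sub>v col C j)) $ i"
      using index_mat_adjoint_mult_vec[of i B "A *\<^sub>v col C j"] that dims by simp
    then show ?thesis using BAC[OF that(2)] that by simp
  qed
  have CB: "(A *\<^sub>v col B j) \<bullet>c col C i = (if i = 0 then cnj (x $ j) else 0)" if "j < p" "i < m" for i j
    using op_sym_cnj[OF colB colC, of j i] BC[OF that] by simp
  fix i j
  assume "i < dim_row (four_block_mat (compress B A) (outer_prod x (unit_vec m 0))
      (outer_prod (unit_vec m 0) x) (compress C A))"
    "j < dim_col (four_block_mat (compress B A) (outer_prod x (unit_vec m 0))
      (outer_prod (unit_vec m 0) x) (compress C A))"
  then have ij: "i < p + m" "j < p + m" using dims by simp_all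
  have lhs: "compress (join_cols B C) A $$ (i, j) =
      (A *\<^sub>v (if j < p then col B j else col C (j - p))) \<bullet>c (if i < p then col B i else col C (i - p))"
    using index_compress[OF A(1) J ij] ij dims by (simp add: col_join_cols)
  show "compress (join_cols B C) A $$ (i, j) =
      four_block_mat (compress B A) (outer_prod x (unit_vec m 0))
        (outer_prod (unit_vec m 0) x) (compress C A) $$ (i, j)"
    unfolding lhs using ij dims dimo BC[of i "j - p"] CB[of j "i - p"]
      index_compress[OF A(1) B, of i j] index_compress[OF A(1) C, of "i - p" "j - p"]
      outer_prod_unit_right[of i x "j - p" m] outer_prod_unit_left[of "i - p" m j x]
    by (cases "i < p"; cases "j < p") simp_all
qed (use B C in simp_all)

section \<open>Best rational approximation\<close>

text \<open>Values at the nodes serve as coordinates of polynomials in the compactness argument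
  below.\<close>

lemma lagrange_basis_exists:
  assumes "finite Y" "card Y \<le> m"
  obtains l :: "complex \<Rightarrow> complex poly" where
    "\<And>y. y \<in> Y \<Longrightarrow> degree (l y) < m" "\<And>y z. y \<in> Y \<Longrightarrow> z \<in> Y \<Longrightarrow> poly (l y) z = (if y = z then 1 else 0)"
proof
  define l where "l = (\<lambda>y. \<Prod>z\<in>Y - {y}. Polynomial.smult (1 / (y - z)) [:- z, 1:])"
  fix y assume y: "y \<in> Y"
  have "degree (l y) \<le> (\<Sum>z\<in>Y - {y}. degree (Polynomial.smult (1 / (y - z)) [:- z, 1:]))"
    unfolding l_def
    using degree_prod_sum_le[of "Y - {y}" "\<lambda>z. Polynomial.smult (1 / (y - z)) [:- z, 1:]"] assms(1)
    by (simp only: comp_def finite_Diff)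
  also have "\<dots> \<le> (\<Sum>z\<in>Y - {y}. 1)" by (rule sum_mono) auto
  also have "\<dots> < card Y"
  proof -
    have "card Y > 0" using y assms(1) by (auto simp: card_gt_0_iff)
    then show ?thesis using y assms(1) by simp
  qed
  finally show "degree (l y) < m" using assms(2) by simp
  fix z assume z: "z \<in> Y"
  show "poly (l y) z = (if y = z then 1 else 0)"
  proof (cases "y = z")
    case True
    have "poly (Polynomial.smult (1 / (y - x)) [:- x, 1:]) y = 1" if "x \<in> Y - {y}" for x
    proof -
      have "y - x \<noteq> 0" using that by auto
      moreover have "poly (Polynomial.smult (1 / (y - x)) [:- x, 1:]) y = 1 / (y - x) * (y - x)"
        by (simp only: poly_smult) simp
      ultimately show ?thesis by (simp only: nonzero_divide_mult_cancel_right div_by_1 divide_self times_divide_eq_left mult_1_left not_False_eq_True)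
    qed
    then show ?thesis using True unfolding l_def poly_prod by (auto intro!: prod.neutral simp del: smult_pCons)
  next
    case False
    then show ?thesis using z assms(1) by (auto simp: l_def poly_prod intro!: prod_zero bexI[of _ z])
  qed
qed

text \<open>
  A polynomial of degree below \<open>m\<close> is represented on \<open>X\<close> by its values at \<open>min m (card X)\<close> nodes of \<open>X\<close>.
  This covers finite \<open>X\<close>, where the supremum is only a seminorm, and confines minimizing sequences
  to a compact set.
\<close>

lemma best_weighted_approximation_exists:
  fixes f w :: "complex \<Rightarrow> complex" and m :: nat
  assumes w: "\<And>x. x \<in> X \<Longrightarrow> w x \<noteq> 0"
    and bounded: "p0 = 0 \<or> degree p0 < m" "\<And>x. x \<in> X \<Longrightarrow> cmod (f x - poly p0 x * w x) \<le> e0" "e0 \<ge> 0"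
  shows "\<exists>p M. (p = 0 \<or> degree p < m) \<and> M \<ge> 0 \<and> (\<forall>x\<in>X. cmod (f x - poly p x * w x) \<le> M) \<and>
    (\<forall>p' e. (p' = 0 \<or> degree p' < m) \<and> e \<ge> 0 \<and> (\<forall>x\<in>X. cmod (f x - poly p' x * w x) \<le> e) \<longrightarrow> M \<le> e)"
proof -
  define P where "P = {p :: complex poly. p = 0 \<or> degree p < m}"
  define E where "E = {e. e \<ge> 0 \<and> (\<exists>p\<in>P. \<forall>x\<in>X. cmod (f x - poly p x * w x) \<le> e)}"
  define M where "M = Inf E"
  have E: "E \<noteq> {}" "bdd_below E" "\<And>e. e \<in> E \<Longrightarrow> M \<le> e"
    using bounded by (auto simp: E_def P_def M_def intro!: bdd_belowI[of _ 0] cInf_lower)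
  have M: "M \<ge> 0" unfolding M_def using E by (intro cInf_greatest) (auto simp: E_def)
  obtain Y where Y: "finite Y" "Y \<subseteq> X" "card Y \<le> m" "card Y = m \<or> Y = X"
  proof (cases "finite X \<and> card X < m")
    case True
    then show ?thesis using that[of X] by simp
  next
    case False
    then obtain Y where "Y \<subseteq> X" "finite Y" "card Y = m"
      by (metis infinite_arbitrarily_large not_le obtain_subset_with_card_n)
    then show ?thesis using that by blast
  qed
  obtain l :: "complex \<Rightarrow> complex poly" where l: "\<And>y. y \<in> Y \<Longrightarrow> degree (l y) < m"
    "\<And>y z. y \<in> Y \<Longrightarrow> z \<in> Y \<Longrightarrow> poly (l y) z = (if y = z then 1 else 0)"
    using lagrange_basis_exists[OF Y(1,3)] by blast
  define L where "L = (\<lambda>c :: complex \<Rightarrow> complex. \<Sum>y\<in>Y. Polynomial.smult (c y) (l y))"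
  have poly_L: "poly (L c) x = (\<Sum>y\<in>Y. c y * poly (l y) x)" for c x
    by (simp add: L_def poly_sum)
  have L_P: "L c \<in> P" for c
  proof (cases "Y = {}")
    case False
    then have "m > 0" using l(1) by fastforce
    have "degree (L c) < m"
      unfolding L_def by (rule degree_sum_less) (use l \<open>m > 0\<close> in \<open>auto intro: le_less_trans[OF degree_smult_le]\<close>)
    then show ?thesis by (simp add: P_def)
  qed (simp add: L_def P_def)
  have interp: "poly (L (poly p)) x = poly p x" if p: "p \<in> P" and x: "x \<in> X" for p x
  proof -
    have on_Y: "poly (L (poly p)) y = poly p y" if "y \<in> Y" for y
    proof -
      have "poly (L (poly p)) y = (\<Sum>z\<in>Y. if z = y then poly p z else 0)"
        unfolding poly_L using that l(2) by (intro sum.cong) auto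
      then show ?thesis using that Y(1) by simp
    qed
    show ?thesis
    proof (cases "Y = X")
      case False
      then have card: "card Y = m" using Y by blast
      show ?thesis
      proof (cases "m = 0")
        case True
        then show ?thesis using p L_P[of "poly p"] by (simp add: P_def)
      next
        case False
        have "L (poly p) = p"
          by (rule poly_eqI_degree[of Y]) (use on_Y card L_P[of "poly p"] p False in \<open>auto simp: P_def\<close>)
        then show ?thesis by simp
      qed
    qed (use on_Y x in simp)
  qed
  \<comment> \<open>At a node \<open>y\<close> a near-minimizer \<open>p\<close> has
    \<open>cmod (poly p y * w y) <= cmod (f y) + M + 1\<close>, because the tolerances 1 / (j + 1)
    are at most 1.\<close>
  define R where "R = (\<lambda>y. (cmod (f y) + M + 1) / cmod (w y))"
  \<comment> \<open>The coordinates live in the full function space; fixing those outside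
    \<open>Y\<close> to 0 gives a product of compact sets, compact by Tychonoff.\<close>
  define B where "B = PiE UNIV (\<lambda>y. if y \<in> Y then cball 0 (R y) else {0 :: complex})"
  have "compactin (product_topology (\<lambda>_. euclidean) UNIV) B"
    unfolding B_def by (subst compactin_PiE) auto
  then have compact_B: "compact B" by (simp add: euclidean_product_topology)
  \<comment> \<open>Coordinates whose error exceeds the infimum by at most 1 / (j + 1). The sets are
    closed and decreasing, so compactness of \<open>B\<close> yields a common point, which is a
    minimizer.\<close>
  define G where "G = (\<lambda>j :: nat. \<Inter>x\<in>X. {c. cmod (f x - poly (L c) x * w x) \<le> M + 1 / (real j + 1)})"
  have "closed {c. cmod (f x - poly (L c) x * w x) \<le> e}" for x e
    unfolding poly_L by (intro closed_Collect_le continuous_intros continuous_on_product_coordinates)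
  then have closed_G: "closed (G j)" for j
    unfolding G_def by (intro closed_INT) auto
  have nonempty_G: "B \<inter> G j \<noteq> {}" for j
  proof -
    have "\<exists>e\<in>E. e < M + 1 / (real j + 1)"
      using E(1,2) cInf_less_iff[of E "M + 1 / (real j + 1)"] by (simp add: M_def)
    then obtain p where p: "p \<in> P" "\<And>x. x \<in> X \<Longrightarrow> cmod (f x - poly p x * w x) \<le> M + 1 / (real j + 1)"
      by (force simp: E_def)
    define c where "c = (\<lambda>y. if y \<in> Y then poly p y else 0)"
    have Lc: "L c = L (poly p)" unfolding L_def c_def by (intro sum.cong) auto
    have "cmod (c y) \<le> R y" if y: "y \<in> Y" for y
    proof -
      have yX: "y \<in> X" using y Y by auto
      have "cmod (poly p y) * cmod (w y) = cmod (f y - (f y - poly p y * w y))"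
        by (simp add: norm_mult)
      also have "\<dots> \<le> cmod (f y) + (M + 1 / (real j + 1))"
        using norm_triangle_ineq4[of "f y" "f y - poly p y * w y"] p(2)[OF yX] by linarith
      also have "\<dots> \<le> cmod (f y) + M + 1" by simp
      finally show ?thesis using w[OF yX] y by (simp add: R_def c_def pos_le_divide_eq)
    qed
    then have "c \<in> B" by (auto simp: B_def c_def PiE_def)
    moreover have "c \<in> G j" using p interp by (simp add: G_def Lc)
    ultimately show ?thesis by blast
  qed
  have G_mono: "G j \<subseteq> G i" if "i \<le> j" for i j
  proof -
    have "1 / (real j + 1) \<le> 1 / (real i + 1)" using that by (simp add: frac_le)
    then show ?thesis unfolding G_def by (auto intro: order_trans[OF _ add_left_mono])
  qed
  have "B \<inter> (\<Inter>j\<in>UNIV. G j) \<noteq> {}"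
  proof (rule compact_imp_fip_image[OF compact_B closed_G])
    fix J :: "nat set" assume "finite J"
    then obtain j where "\<And>i. i \<in> J \<Longrightarrow> i \<le> j" by (meson finite_nat_set_iff_bounded_le)
    then have "B \<inter> G j \<subseteq> B \<inter> (\<Inter>i\<in>J. G i)" using G_mono by blast
    then show "B \<inter> (\<Inter>i\<in>J. G i) \<noteq> {}" using nonempty_G[of j] by blast
  qed
  then obtain c where c: "\<And>j. c \<in> G j" by auto
  have "cmod (f x - poly (L c) x * w x) \<le> M" if x: "x \<in> X" for x
  proof (rule field_le_epsilon)
    fix e :: real assume "e > 0"
    then obtain j :: nat where j: "1 / (real j + 1) < e"
      using nat_approx_posE[of e] by (metis of_nat_Suc add.commute)
    then show "cmod (f x - poly (L c) x * w x) \<le> M + e"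
      using c[of j] x by (force simp: G_def)
  qed
  then show ?thesis
    using L_P[of c] M E(3) unfolding E_def P_def by (intro exI[of _ "L c"] exI[of _ M]) blast
qed


section \<open>Poles of rational functions on a set and their cancellation\<close>

lemma pole_poly_Cons:
  "pole_poly (None # \<zeta>s) = pole_poly \<zeta>s"
  "pole_poly (Some z # \<zeta>s) = [:- z, 1:] * pole_poly \<zeta>s"
  by (simp_all add: pole_poly_def)

lemma pole_poly_split:
  "pole_poly \<zeta>s = pole_poly (filter P \<zeta>s) * pole_poly (filter (\<lambda>\<zeta>. \<not> P \<zeta>) \<zeta>s)"
proof (induction \<zeta>s)
  case (Cons \<zeta> \<zeta>s)
  then show ?case
    by (cases \<zeta>) (auto simp: pole_poly_Cons mult_ac simp del: mult_pCons_left mult_pCons_right)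
qed (simp add: pole_poly_def)

lemma eventually_poly_nonzero: "q \<noteq> 0 \<Longrightarrow> \<forall>\<^sub>F y in at x. poly q y \<noteq> 0" for q :: "complex poly"
  using islimpt_finite[OF poly_roots_finite, of q x] by (simp add: islimpt_iff_eventually)

lemma analytic_on_poly: "poly p analytic_on S" for p :: "complex poly"
proof -
  have "poly p = (\<lambda>x. \<Sum>i\<le>degree p. coeff p i * x ^ i)" by (rule ext) (rule poly_altdef)
  then show ?thesis by (auto intro!: analytic_intros)
qed

lemma analytic_poly_quotient: "poly d x \<noteq> 0 \<Longrightarrow> (\<lambda>x. poly p x / poly d x) analytic_on {x :: complex}"
  by (intro analytic_on_divide analytic_on_poly) auto

lemma pole_free_imp_dvd:
  assumes "\<And>x. x \<in> X \<Longrightarrow> \<not> is_pole (\<lambda>x. poly p x / poly (pole_poly \<zeta>s) x) x"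
  shows "pole_poly (filter (\<lambda>\<zeta>. \<exists>x\<in>X. \<zeta> = Some x) \<zeta>s) dvd p"
  using assms
proof (induction \<zeta>s arbitrary: p)
  case Nil
  then show ?case by (simp add: pole_poly_def)
next
  case (Cons \<zeta> \<zeta>s)
  show ?case
  proof (cases \<zeta>)
    case None
    then show ?thesis using Cons by (simp add: pole_poly_Cons)
  next
    case (Some z)
    define q where "q = pole_poly \<zeta>s"
    have q0: "q \<noteq> 0" by (simp add: q_def)
    have prem: "\<not> is_pole (\<lambda>x. poly p x / ((x - z) * poly q x)) x" if "x \<in> X" for x
      using Cons.prems[OF that] by (simp add: Some pole_poly_Cons q_def algebra_simps)
    show ?thesis
    proof (cases "z \<in> X")
      case False
      have "\<not> is_pole (\<lambda>x. poly p x / poly q x) x" if x: "x \<in> X" for x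
      proof
        assume "is_pole (\<lambda>x. poly p x / poly q x) x"
        moreover have "(\<lambda>x. 1 / (x - z)) analytic_on {x}" "1 / (x - z) \<noteq> 0"
          using x False by (auto intro!: analytic_intros)
        ultimately have "is_pole (\<lambda>x. 1 / (x - z) * (poly p x / poly q x)) x"
          by (rule is_pole_mult_analytic_nonzero1)
        then show False using prem[OF x] by simp
      qed
      then show ?thesis using Cons.IH[of p] False by (auto simp: Some q_def)
    next
      case True
      have "poly p z = 0"
      proof (rule ccontr)
        assume nz: "poly p z \<noteq> 0"
        have "filterlim (\<lambda>x. (x - z) * poly q x) (at 0) (at z)"
        proof (rule filterlim_atI)
          show "((\<lambda>x. (x - z) * poly q x) \<longlongrightarrow> 0) (at z)"
            by (rule tendsto_eq_intros refl | simp)+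
          have "\<forall>\<^sub>F x in at z. x \<noteq> z \<and> poly q x \<noteq> 0"
            using eventually_conj[OF eventually_neq_at_within[of z z UNIV] eventually_poly_nonzero[OF q0, of z]]
            by simp
          then show "\<forall>\<^sub>F x in at z. (x - z) * poly q x \<noteq> 0" by eventually_elim simp
        qed
        then have "is_pole (\<lambda>x. poly p x / ((x - z) * poly q x)) z"
          using nz by (intro is_pole_divide) auto
        then show False using prem[OF True] by simp
      qed
      then obtain p' where p': "p = [:- z, 1:] * p'" by (auto simp: poly_eq_0_iff_dvd elim: dvdE)
      have "\<not> is_pole (\<lambda>x. poly p' x / poly q x) x" if x: "x \<in> X" for x
      proof -
        have ev: "\<forall>\<^sub>F y in at x. poly p' y / poly q y = poly p y / ((y - z) * poly q y)"
          using eventually_neq_at_within[of z x UNIV]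
          by eventually_elim (simp add: p' divide_simps, simp add: algebra_simps)
        then show ?thesis using prem[OF x] is_pole_cong[OF ev refl] by blast
      qed
      then have "pole_poly (filter (\<lambda>\<zeta>. \<exists>x\<in>X. \<zeta> = Some x) \<zeta>s) dvd p'"
        using Cons.IH by (simp add: q_def)
      then show ?thesis
        using True by (simp add: Some pole_poly_Cons p' mult_dvd_mono del: mult_pCons_left)
    qed
  qed
qed

text \<open>Zeros of the common factor \<open>c\<close> are isolated, so the two errors agree on a
  punctured neighbourhood of every point of \<open>X\<close>; \<open>remove_sings\<close> then
  repairs the value at a zero of \<open>c\<close>, where division by zero falsifies it.\<close>

lemma sup_norm_on_rational_error:
  assumes f: "f analytic_on X" and d: "\<And>x. x \<in> X \<Longrightarrow> poly d x \<noteq> 0" and c: "c \<noteq> 0"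
  shows "sup_norm_on X (\<lambda>x. f x - poly (c * p) x / poly (c * d) x) =
    (SUP x\<in>X. ereal (cmod (f x - poly p x / poly d x)))"
  unfolding sup_norm_on_def
proof (rule SUP_cong[OF refl])
  fix x assume x: "x \<in> X"
  define g where "g = (\<lambda>x. f x - poly p x / poly d x)"
  have g: "g analytic_on {x}"
    unfolding g_def using f x d analytic_poly_quotient
    by (intro analytic_on_diff) (auto intro: analytic_on_subset)
  have ev: "\<forall>\<^sub>F y in at x. f y - poly (c * p) y / poly (c * d) y = g y"
    using eventually_poly_nonzero[OF c, of x] by eventually_elim (simp add: g_def)
  have "\<not> is_pole g x" using analytic_at_imp_no_pole[OF g] .
  moreover have "remove_sings (\<lambda>x. f x - poly (c * p) x / poly (c * d) x) x = g x"
    using remove_sings_cong[OF ev refl] remove_sings_at_analytic[OF g] by simp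
  ultimately show "(if is_pole (\<lambda>x. f x - poly (c * p) x / poly (c * d) x) x then \<infinity>
      else ereal (cmod (remove_sings (\<lambda>x. f x - poly (c * p) x / poly (c * d) x) x))) =
    ereal (cmod (f x - poly p x / poly d x))"
    using is_pole_cong[OF ev refl] by (simp add: g_def)
qed

text \<open>The analytic \<open>f\<close> cannot compensate a pole of the rational part, and a
  single pole on \<open>X\<close> makes the supremum infinite.\<close>

lemma sup_norm_on_finite_imp_dvd:
  assumes f: "f analytic_on X" and fin: "sup_norm_on X (\<lambda>x. f x - poly p x / poly (pole_poly \<zeta>s) x) < \<infinity>"
  shows "pole_poly (filter (\<lambda>\<zeta>. \<exists>x\<in>X. \<zeta> = Some x) \<zeta>s) dvd p"
proof (rule pole_free_imp_dvd)
  fix x assume x: "x \<in> X"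
  show "\<not> is_pole (\<lambda>x. poly p x / poly (pole_poly \<zeta>s) x) x"
  proof
    assume "is_pole (\<lambda>x. poly p x / poly (pole_poly \<zeta>s) x) x"
    then have "is_pole (\<lambda>x. - (poly p x / poly (pole_poly \<zeta>s) x)) x"
      by (simp only: is_pole_uminus_iff)
    then have lim: "filterlim (\<lambda>x. - (poly p x / poly (pole_poly \<zeta>s) x)) at_infinity (at x)"
      by (simp only: is_pole_def)
    have "f analytic_on {x}" using f x by (auto intro: analytic_on_subset)
    then have "(f \<longlongrightarrow> f x) (at x)" using analytic_at_imp_isCont isCont_def by blast
    from tendsto_add_filterlim_at_infinity[OF this lim]
    have "is_pole (\<lambda>x. f x - poly p x / poly (pole_poly \<zeta>s) x) x" by (simp add: is_pole_def)
    then have "\<infinity> \<le> sup_norm_on X (\<lambda>x. f x - poly p x / poly (pole_poly \<zeta>s) x)"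
      unfolding sup_norm_on_def using x by (intro SUP_upper2[OF x]) simp
    then show False using fin by simp
  qed
qed

text \<open>If no element has finite error, every element is a minimizer. Otherwise finite error
  forces the numerator to contain the factor \<open>c\<close> of the poles on \<open>X\<close>, and
  what remains is polynomial approximation with weight \<open>1/d\<close>.\<close>

lemma best_rational_approximation_exists:
  assumes f: "f analytic_on X" and X: "X \<noteq> {}" and k: "k > 0"
  obtains r where "is_arg_min (\<lambda>r. sup_norm_on X (\<lambda>x. f x - r x)) (\<lambda>r. r \<in> rational_functions k \<xi>s) r"
    "sup_norm_on X (\<lambda>x. f x - r x) = \<infinity> \<or>
      (\<exists>p d e. e \<ge> 0 \<and> sup_norm_on X (\<lambda>x. f x - r x) = ereal e \<and>
        d dvd pole_poly \<xi>s \<and> (\<forall>x\<in>X. poly d x \<noteq> 0) \<and>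
        (p = 0 \<or> degree p + degree (pole_poly \<xi>s) < degree d + k) \<and>
        (\<forall>x\<in>X. cmod (f x - poly p x / poly d x) \<le> e))"
proof (cases "\<exists>r\<in>rational_functions k \<xi>s. sup_norm_on X (\<lambda>x. f x - r x) < \<infinity>")
  case False
  define r :: "complex \<Rightarrow> complex" where "r = (\<lambda>x. poly 0 x / poly (pole_poly \<xi>s) x)"
  have r: "r \<in> rational_functions k \<xi>s" using k by (auto simp: rational_functions_def r_def intro!: exI[of _ 0])
  then have "is_arg_min (\<lambda>r. sup_norm_on X (\<lambda>x. f x - r x)) (\<lambda>r. r \<in> rational_functions k \<xi>s) r"
    using False by (auto simp: is_arg_min_def)
  then show ?thesis using that False r by auto
next
  case True
  define q where "q = pole_poly \<xi>s"
  define c where "c = pole_poly (filter (\<lambda>\<zeta>. \<exists>x\<in>X. \<zeta> = Some x) \<xi>s)"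
  define d where "d = pole_poly (filter (\<lambda>\<zeta>. \<not> (\<exists>x\<in>X. \<zeta> = Some x)) \<xi>s)"
  have q: "q = c * d" unfolding q_def c_def d_def by (rule pole_poly_split)
  have c0: "c \<noteq> 0" and d0: "d \<noteq> 0" by (simp_all add: c_def d_def)
  have dX: "poly d x \<noteq> 0" if "x \<in> X" for x using that by (auto simp: d_def poly_pole_poly_eq_0_iff)
  \<comment> \<open>The subtraction truncates: for deg c >= k the bound is 0, and then
    \<open>p = 0\<close> is the only cofactor left.\<close>
  define m where "m = k - degree c"
  define N where "N = (\<lambda>p. SUP x\<in>X. ereal (cmod (f x - poly p x / poly d x)))"
  have N: "sup_norm_on X (\<lambda>x. f x - poly (c * p) x / poly q x) = N p" for p
    unfolding N_def q by (rule sup_norm_on_rational_error[OF f dX c0])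
  have N_le: "N p \<le> ereal e \<longleftrightarrow> (\<forall>x\<in>X. cmod (f x - poly p x / poly d x) \<le> e)" for p e
    by (simp add: N_def SUP_le_iff)
  have N_real: "\<exists>e\<ge>0. N p = ereal e" if "N p < \<infinity>" for p
  proof -
    obtain x where x: "x \<in> X" using X by auto
    have "0 \<le> N p" unfolding N_def by (rule SUP_upper2[OF x]) simp
    then show ?thesis using that by (cases "N p") auto
  qed
  have deg: "degree (c * p) < k \<longleftrightarrow> p = 0 \<or> degree p < m" for p
    using c0 k by (cases "p = 0") (auto simp: degree_mult_eq m_def)
  have reduce: "\<exists>p. (p = 0 \<or> degree p < m) \<and> r = (\<lambda>x. poly (c * p) x / poly q x)"
    if r: "r \<in> rational_functions k \<xi>s" and fin: "sup_norm_on X (\<lambda>x. f x - r x) < \<infinity>" for r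
  proof -
    obtain p where p: "degree p < k" "r = (\<lambda>x. poly p x / poly q x)"
      using r unfolding rational_functions_def q_def by blast
    have "c dvd p" using sup_norm_on_finite_imp_dvd[OF f] fin by (simp add: p q_def c_def)
    then obtain p' where p': "p = c * p'" by (rule dvdE)
    show ?thesis using p deg[of p'] unfolding p' by blast
  qed
  obtain r0 where r0: "r0 \<in> rational_functions k \<xi>s" "sup_norm_on X (\<lambda>x. f x - r0 x) < \<infinity>"
    using True by blast
  obtain p0 where p0_deg: "p0 = 0 \<or> degree p0 < m" and p0_eq: "r0 = (\<lambda>x. poly (c * p0) x / poly q x)"
    using reduce[OF r0] by blast
  have "N p0 < \<infinity>" using r0(2) unfolding p0_eq N .
  note p0 = p0_deg this
  obtain e0 where "e0 \<ge> 0" "N p0 = ereal e0" using N_real[OF p0(2)] by blast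
  then have e0: "e0 \<ge> 0" "\<And>x. x \<in> X \<Longrightarrow> cmod (f x - poly p0 x / poly d x) \<le> e0"
    using N_le[of p0 e0] by auto
  have "\<exists>p M. (p = 0 \<or> degree p < m) \<and> M \<ge> 0 \<and> (\<forall>x\<in>X. cmod (f x - poly p x * (1 / poly d x)) \<le> M) \<and>
      (\<forall>p' e. (p' = 0 \<or> degree p' < m) \<and> e \<ge> 0 \<and>
        (\<forall>x\<in>X. cmod (f x - poly p' x * (1 / poly d x)) \<le> e) \<longrightarrow> M \<le> e)"
    by (rule best_weighted_approximation_exists[OF _ p0(1) _ e0(1)]) (use dX e0(2) in auto)
  then obtain p M where p: "p = 0 \<or> degree p < m" and "M \<ge> 0"
    and M_bound: "\<forall>x\<in>X. cmod (f x - poly p x * (1 / poly d x)) \<le> M"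
    and M_least: "\<forall>p' e. (p' = 0 \<or> degree p' < m) \<and> e \<ge> 0 \<and>
        (\<forall>x\<in>X. cmod (f x - poly p' x * (1 / poly d x)) \<le> e) \<longrightarrow> M \<le> e"
    by (elim exE conjE) (rule that)
  define r where "r = (\<lambda>x. poly (c * p) x / poly q x)"
  have r: "r \<in> rational_functions k \<xi>s"
    using deg[of p] p unfolding r_def rational_functions_def q_def by blast
  have Nr: "sup_norm_on X (\<lambda>x. f x - r x) = N p" unfolding r_def by (rule N)
  have NM: "N p \<le> ereal M" using M_bound N_le[of p M] by simp
  then have "N p < \<infinity>" by auto
  then obtain e where e: "e \<ge> 0" "N p = ereal e" using N_real by blast
  have "is_arg_min (\<lambda>r. sup_norm_on X (\<lambda>x. f x - r x)) (\<lambda>r. r \<in> rational_functions k \<xi>s) r"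
    unfolding is_arg_min_def
  proof (intro conjI r notI, elim exE conjE)
    fix y assume y: "y \<in> rational_functions k \<xi>s"
      and less: "sup_norm_on X (\<lambda>x. f x - y x) < sup_norm_on X (\<lambda>x. f x - r x)"
    then have fin: "sup_norm_on X (\<lambda>x. f x - y x) < \<infinity>" by (metis less_ereal.simps(4) ereal_infty_less(1) less_trans not_less_iff_gr_or_eq)
    obtain p' where p': "p' = 0 \<or> degree p' < m" "y = (\<lambda>x. poly (c * p') x / poly q x)"
      using reduce[OF y fin] by blast
    have Ny: "sup_norm_on X (\<lambda>x. f x - y x) = N p'" unfolding p'(2) by (rule N)
    obtain e' where e': "e' \<ge> 0" "N p' = ereal e'" using N_real fin Ny by metis
    then have "M \<le> e'" using M_least[rule_format, of p' e'] p'(1) e' N_le[of p' e'] by simp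
    then have "N p \<le> N p'" using NM e' by (metis ereal_less_eq(3) order_trans)
    then show False using less Ny Nr by simp
  qed
  moreover have "p = 0 \<or> degree p + degree (pole_poly \<xi>s) < degree d + k"
    using p c0 d0 q by (auto simp: m_def degree_mult_eq simp flip: q_def)
  moreover have "d dvd pole_poly \<xi>s" using q by (simp flip: q_def)
  moreover have "\<forall>x\<in>X. cmod (f x - poly p x / poly d x) \<le> e" using N_le[of p e] e by simp
  ultimately show ?thesis using that[of r] e dX Nr by auto
qed

section \<open>The compressed algorithm\<close>

locale rk_compressed_run = rational_lanczos A n b Q \<theta>s k m s
  for A n b Q \<theta>s k m s +
  fixes f :: "complex \<Rightarrow> complex" and \<xi>s :: "pole list" and U V S :: "nat \<Rightarrow> complex mat"
    and v bt w y :: "nat \<Rightarrow> complex vec"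
  assumes len_\<xi>s: "length \<xi>s = k" and cnj_\<xi>s: "cnj_closed \<xi>s"
    and run: "rk_compressed_rational_lanczos f A b k m s \<xi>s Q U V S v bt w y"
    and adm_S: "\<And>i. \<lbrakk>1 \<le> i; i < s\<rbrakk> \<Longrightarrow> poles_admissible (S i) \<xi>s"
begin

lemma run_1:
  "V 1 = blk 1" "S 1 = compress (blk 1) A" "v 1 = start_vec b (k + m)"
  "1 < s \<Longrightarrow> bt 1 = coupling_vec A k m Q 1"
  "y 1 = blk 1 *\<^sub>v (mat_fun f (compress (blk 1) A) *\<^sub>v start_vec b (k + m))"
  using run unfolding rk_compressed_rational_lanczos_def by blast+

text \<open>Shifts the cycle index from \<open>i\<close> to \<open>Suc i\<close>, which removes the
  subtraction \<open>i - 1\<close>.\<close>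

lemma run_Suc:
  assumes "1 \<le> i" "i < s"
  shows "dim_row (U i) = dim_row (S i)"
    "orthonormal_basis_matrix (U i) (rational_krylov (S i) (bt i) \<xi>s)"
    "w i = - (V i *\<^sub>v (U i *\<^sub>v (mat_fun f (compress (U i) (S i)) *\<^sub>v (mat_adjoint (U i) *\<^sub>v v i))))"
    "V (Suc i) = join_cols (V i * U i) (blk (Suc i))"
    "v (Suc i) = (mat_adjoint (U i) *\<^sub>v v i) @\<^sub>v 0\<^sub>v m"
    "S (Suc i) = four_block_mat (compress (U i) (S i))
      (outer_prod (mat_adjoint (U i) *\<^sub>v bt i) (unit_vec m 0))
      (outer_prod (unit_vec m 0) (mat_adjoint (U i) *\<^sub>v bt i)) (compress (blk (Suc i)) A)"
    "Suc i < s \<Longrightarrow> bt (Suc i) = 0\<^sub>v (dim_col (U i)) @\<^sub>v coupling_vec A k m Q (Suc i)"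
    "y (Suc i) = y i + w i + V (Suc i) *\<^sub>v (mat_fun f (S (Suc i)) *\<^sub>v v (Suc i))"
proof -
  have "Suc i \<in> {2..s}" using assms by simp
  note R = run[unfolded rk_compressed_rational_lanczos_def, THEN conjunct2, THEN conjunct2,
      THEN conjunct2, THEN conjunct2, THEN conjunct2, THEN bspec, OF this, unfolded diff_Suc_1]
  show "dim_row (U i) = dim_row (S i)"
    "orthonormal_basis_matrix (U i) (rational_krylov (S i) (bt i) \<xi>s)"
    "w i = - (V i *\<^sub>v (U i *\<^sub>v (mat_fun f (compress (U i) (S i)) *\<^sub>v (mat_adjoint (U i) *\<^sub>v v i))))"
    "V (Suc i) = join_cols (V i * U i) (blk (Suc i))"
    "v (Suc i) = (mat_adjoint (U i) *\<^sub>v v i) @\<^sub>v 0\<^sub>v m"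
    "S (Suc i) = four_block_mat (compress (U i) (S i))
      (outer_prod (mat_adjoint (U i) *\<^sub>v bt i) (unit_vec m 0))
      (outer_prod (unit_vec m 0) (mat_adjoint (U i) *\<^sub>v bt i)) (compress (blk (Suc i)) A)"
    "Suc i < s \<Longrightarrow> bt (Suc i) = 0\<^sub>v (dim_col (U i)) @\<^sub>v coupling_vec A k m Q (Suc i)"
    "y (Suc i) = y i + w i + V (Suc i) *\<^sub>v (mat_fun f (S (Suc i)) *\<^sub>v v (Suc i))"
    using R by blast+
qed

text \<open>Ties the coordinate quantities of the algorithm to \<open>A\<close>. The columns from
  index \<open>k + i * m\<close> on are those not yet processed; the strict inequality in the third
  conjunct leaves out the first of them, whose coupling to \<open>V i\<close> is recorded in
  \<open>bt i\<close>.\<close>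

definition invariant where
  "invariant i \<longleftrightarrow> isometry_mat n (V i) \<and>
    (\<forall>j. k + i * m \<le> j \<and> j < M \<longrightarrow> mat_adjoint (V i) *\<^sub>v q j = 0\<^sub>v (dim_col (V i))) \<and>
    (\<forall>j. k + i * m < j \<and> j < M \<longrightarrow> mat_adjoint (V i) *\<^sub>v (A *\<^sub>v q j) = 0\<^sub>v (dim_col (V i))) \<and>
    S i = compress (V i) A \<and> v i = mat_adjoint (V i) *\<^sub>v b \<and>
    (i < s \<longrightarrow> bt i = mat_adjoint (V i) *\<^sub>v (A *\<^sub>v q (k + i * m)))"

lemma block_end: "i \<le> s \<Longrightarrow> k + i * m \<le> M"
  by simp

lemma block_start: "i < s \<Longrightarrow> k + i * m < M"
  using pos by simp

lemma cycle_of_index: "k + i * m < j \<Longrightarrow> j < M \<Longrightarrow> i < s"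
  by (metis add_less_cancel_left less_trans mult_less_cancel2)

lemma invariant_1: "invariant 1"
proof -
  have le: "k + m \<le> M" using block_end[of 1] pos by simp
  have "mat_adjoint (V 1) *\<^sub>v q j = 0\<^sub>v (dim_col (V 1))" if "k + 1 * m \<le> j" "j < M" for j
    unfolding run_1 blk_1 using adjoint_col_range_eq_0[of "q j" 0 "k + m"] q_orth that by simp
  moreover have "mat_adjoint (V 1) *\<^sub>v (A *\<^sub>v q j) = 0\<^sub>v (dim_col (V 1))" if "k + 1 * m < j" "j < M" for j
    unfolding run_1 blk_1
    using adjoint_col_range_eq_0[of "A *\<^sub>v q j" 0 "k + m"] op_q_lower[of 1] cycle_of_index[OF that] that
    by simp
  ultimately show ?thesis
    unfolding invariant_def
    using col_range_isometry[OF le, of 0] adjoint_col_range_start[OF le] run_1 blk_1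
    by (auto simp: coupling_vec_def)
qed

context
  fixes i assumes i: "1 \<le> i" "i < s" and inv: "invariant i"
begin

lemma V_i: "isometry_mat n (V i)" and S_i: "S i = compress (V i) A" and v_i: "v i = mat_adjoint (V i) *\<^sub>v b"
  and bt_i: "bt i = mat_adjoint (V i) *\<^sub>v (A *\<^sub>v q (k + i * m))"
  and V_q: "\<And>j. k + i * m \<le> j \<Longrightarrow> j < M \<Longrightarrow> mat_adjoint (V i) *\<^sub>v q j = 0\<^sub>v (dim_col (V i))"
  and V_op_q: "\<And>j. k + i * m < j \<Longrightarrow> j < M \<Longrightarrow> mat_adjoint (V i) *\<^sub>v (A *\<^sub>v q j) = 0\<^sub>v (dim_col (V i))"
  using inv i unfolding invariant_def by blast+

lemma U_i: "isometry_mat (dim_col (V i)) (U i)"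
  using orthonormal_basis_matrixD(1)[OF run_Suc(2)[OF i]] run_Suc(1)[OF i] by (simp add: S_i)

lemma bt_carrier: "bt i \<in> carrier_vec (dim_col (V i))"
  unfolding bt_i by (rule adjoint_mult_vec_carrier[OF refl])

lemma U_range:
  assumes "r \<in> rational_functions k \<xi>s"
  shows "\<exists>x\<in>carrier_vec (dim_col (U i)). mat_fun r (compress (V i) A) *\<^sub>v bt i = U i *\<^sub>v x"
proof -
  have "poles_admissible (compress (V i) A) \<xi>s" using adm_S[OF i] by (simp add: S_i)
  then have "mat_fun r (compress (V i) A) *\<^sub>v bt i \<in> rational_krylov (S i) (bt i) \<xi>s"
    unfolding S_i using assms len_\<xi>s rational_krylov_eq[OF compress_V(2,1)[OF V_i] bt_carrier] by blast
  then show ?thesis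
    using orthonormal_basis_matrixD(2)[OF run_Suc(2)[OF i] refl] by blast
qed

lemma VU_i: "isometry_mat n (V i * U i)"
  by (rule isometry_mult[OF V_i U_i])

lemma adjoint_VU:
  assumes "x \<in> carrier_vec n"
  shows "mat_adjoint (V i * U i) *\<^sub>v x = mat_adjoint (U i) *\<^sub>v (mat_adjoint (V i) *\<^sub>v x)"
  by (rule adjoint_mult_mult_vec[OF isometry_mat_carrier[OF V_i] isometry_mat_carrier[OF U_i] assms])

lemma adjoint_U_zero: "mat_adjoint (U i) *\<^sub>v 0\<^sub>v (dim_col (V i)) = 0\<^sub>v (dim_col (U i))"
  using isometry_mat_dim[OF U_i] by (subst adjoint_mult_vec_eq_0_iff)
    (auto intro!: scalar_prod_left_zero carrier_vecI)

lemma VU_q: "k + i * m \<le> j \<Longrightarrow> j < M \<Longrightarrow> mat_adjoint (V i * U i) *\<^sub>v q j = 0\<^sub>v (dim_col (U i))"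
  using adjoint_VU[OF q_carrier] V_q adjoint_U_zero by simp

lemma VU_op_q:
  "k + i * m < j \<Longrightarrow> j < M \<Longrightarrow> mat_adjoint (V i * U i) *\<^sub>v (A *\<^sub>v q j) = 0\<^sub>v (dim_col (U i))"
  using adjoint_VU[OF op_carrier] V_op_q adjoint_U_zero by simp

lemma compress_VU: "compress (V i * U i) A = compress (U i) (S i)"
  unfolding S_i by (rule compress_mult[OF A isometry_mat_carrier[OF V_i] isometry_mat_carrier[OF U_i]])

lemma blk_Suc_i: "blk (Suc i) = col_range Q (k + i * m) (k + Suc i * m)"
  using blk_Suc i by simp

lemma dim_blk: "dim_row (blk (Suc i)) = n" "dim_col (blk (Suc i)) = m"
  by (simp_all add: blk_Suc_i)

lemma dim_VU: "dim_row (V i * U i) = n" "dim_col (V i * U i) = dim_col (U i)"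
  using isometry_mat_dim[OF VU_i] by simp_all

lemma adjoint_V_Suc:
  assumes "x \<in> carrier_vec n"
  shows "mat_adjoint (V (Suc i)) *\<^sub>v x = (mat_adjoint (V i * U i) *\<^sub>v x) @\<^sub>v (mat_adjoint (blk (Suc i)) *\<^sub>v x)"
  unfolding run_Suc(4)[OF i]
  by (rule adjoint_join_cols_mult_vec) (use dim_blk dim_VU assms in auto)

lemma col_blk: "j < m \<Longrightarrow> col (blk (Suc i)) j = q (k + i * m + j)"
  unfolding blk_Suc_i by (subst col_col_range) auto

lemma zero_append: "0\<^sub>v c @\<^sub>v 0\<^sub>v d = (0\<^sub>v (c + d) :: complex vec)"
  by (rule eq_vecI) auto

lemma dim_V_Suc: "dim_col (V (Suc i)) = dim_col (U i) + m"
  unfolding run_Suc(4)[OF i] using dim_blk dim_VU by simp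

text \<open>The range of \<open>V i * U i\<close> lies in that of \<open>V i\<close> and inherits
  its relations to later columns; for the new block they follow from orthonormality and from the
  infinite pole at its end. The next \<open>S\<close> is again a compression, because
  \<open>A\<close> couples \<open>V i * U i\<close> to the new block only through the first column
  of the block.\<close>

lemma invariant_Suc: "invariant (Suc i)"
  unfolding invariant_def
proof (intro conjI allI impI; (elim conjE)?)
  have le: "k + Suc i * m \<le> M" using block_end[of "Suc i"] i by simp
  have blk_iso: "isometry_mat n (blk (Suc i))"
    unfolding blk_Suc_i by (rule col_range_isometry[OF le])
  have idx: "k + i * m + j < M" if "j < m" for j using le that by simp
  show "isometry_mat n (V (Suc i))"
    unfolding run_Suc(4)[OF i]
    by (rule isometry_join_cols[OF VU_i blk_iso]) (use VU_q idx dim_blk dim_VU col_blk in simp)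
  have blk0: "mat_adjoint (blk (Suc i)) *\<^sub>v x = 0\<^sub>v m"
    if "x \<in> carrier_vec n" "\<And>c. k + i * m \<le> c \<Longrightarrow> c < k + Suc i * m \<Longrightarrow> x \<bullet>c q c = 0" for x
    using adjoint_col_range_eq_0[OF that(1), of "k + i * m" "k + Suc i * m"] that(2) by (simp add: blk_Suc_i)
  show "mat_adjoint (V (Suc i)) *\<^sub>v q j = 0\<^sub>v (dim_col (V (Suc i)))" if j: "k + Suc i * m \<le> j" "j < M" for j
    using adjoint_V_Suc[OF q_carrier] VU_q[of j] blk0[OF q_carrier, of j] q_orth[of j] j
    by (simp add: dim_V_Suc zero_append)
  have V_op: "mat_adjoint (V (Suc i)) *\<^sub>v (A *\<^sub>v q j) = 0\<^sub>v (dim_col (V (Suc i)))"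
    if j: "k + Suc i * m < j" "j < M" for j
  proof -
    have "mat_adjoint (blk (Suc i)) *\<^sub>v (A *\<^sub>v q j) = 0\<^sub>v m"
      by (rule blk0) (use op_q_lower[of "Suc i" _ j] cycle_of_index[OF j] j in auto)
    moreover have "mat_adjoint (V i * U i) *\<^sub>v (A *\<^sub>v q j) = 0\<^sub>v (dim_col (U i))"
      by (rule VU_op_q) (use j in auto)
    ultimately show ?thesis
      using adjoint_V_Suc[OF op_carrier] by (simp add: dim_V_Suc zero_append)
  qed
  show "mat_adjoint (V (Suc i)) *\<^sub>v (A *\<^sub>v q j) = 0\<^sub>v (dim_col (V (Suc i)))"
    if "k + Suc i * m < j" "j < M" for j using that by (rule V_op)
  show "v (Suc i) = mat_adjoint (V (Suc i)) *\<^sub>v b"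
  proof -
    have "mat_adjoint (blk (Suc i)) *\<^sub>v b = 0\<^sub>v m"
      by (rule blk0[OF b]) (use b_q_prod le pos in auto)
    then show ?thesis
      using adjoint_V_Suc[OF b] adjoint_VU[OF b] by (simp add: run_Suc(5)[OF i] v_i)
  qed
  show "bt (Suc i) = mat_adjoint (V (Suc i)) *\<^sub>v (A *\<^sub>v q (k + Suc i * m))" if "Suc i < s"
  proof -
    have "mat_adjoint (V i * U i) *\<^sub>v (A *\<^sub>v q (k + Suc i * m)) = 0\<^sub>v (dim_col (U i))"
      by (rule VU_op_q) (use pos block_start[OF that] in auto)
    then show ?thesis
      using adjoint_V_Suc[OF op_carrier, of "q (k + Suc i * m)"] run_Suc(7)[OF i that]
      by (simp add: coupling_vec_def)
  qed
  show "S (Suc i) = compress (V (Suc i)) A"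
    unfolding run_Suc(4,6)[OF i] compress_VU[symmetric]
  proof (rule compress_join_cols[OF A hermitian_adjoint[OF hermitian], symmetric])
    show "V i * U i \<in> carrier_mat n (dim_col (U i))" "blk (Suc i) \<in> carrier_mat n m"
      using dim_VU dim_blk by (intro carrier_matI; simp)+
    show "mat_adjoint (U i) *\<^sub>v bt i \<in> carrier_vec (dim_col (U i))"
      by (rule adjoint_mult_vec_carrier[OF refl])
    show "mat_adjoint (V i * U i) *\<^sub>v (A *\<^sub>v col (blk (Suc i)) j) =
        (if j = 0 then mat_adjoint (U i) *\<^sub>v bt i else 0\<^sub>v (dim_col (U i)))" if j: "j < m" for j
      using adjoint_VU[OF op_carrier, of "q (k + i * m)"] VU_op_q[of "k + i * m + j"] idx[OF j] col_blk[OF j]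
      by (simp add: bt_i)
  qed
qed

end

lemma invariant_dim: "invariant i \<Longrightarrow> dim_row (V i) = n"
  unfolding invariant_def by (blast dest: isometry_mat_dim)

lemma invariant: "1 \<le> i \<Longrightarrow> i \<le> s \<Longrightarrow> invariant i"
proof (induction i rule: nat_induct_at_least)
  case base
  then show ?case using invariant_1 by simp
next
  case (Suc i)
  then show ?case using invariant_Suc by simp
qed

section \<open>Telescoping the error over the cycles\<close>

definition tail where "tail i = col_range Q (k + i * m) M"

text \<open>
  \<open>hybrid i\<close> is the result of compressing only in the cycles \<open>2, \<dots>, i\<close>; it interpolates between the
  uncompressed approximation (\<open>i = 1\<close>) and \<open>y s\<close>.
\<close>

definition hybrid where
  "hybrid i = y i - proj_fun A (V i) f b + proj_fun A (join_cols (V i) (tail i)) f b"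

lemma y_dim: "1 \<le> i \<Longrightarrow> i \<le> s \<Longrightarrow> y i \<in> carrier_vec n"
proof (induction i rule: nat_induct_at_least)
  case base
  then show ?case by (intro carrier_vecI) (simp add: run_1(5)[simplified] blk_1[simplified])
next
  case (Suc i)
  then have "dim_row (V (Suc i)) = n" using invariant[of "Suc i"] by (intro invariant_dim) simp
  then show ?case using Suc by (intro carrier_vecI) (simp add: run_Suc(8))
qed

lemma proj_fun_V:
  assumes "1 \<le> i" "i \<le> s"
  shows "V i *\<^sub>v (mat_fun f (S i) *\<^sub>v v i) = proj_fun A (V i) f b"
  using invariant[OF assms] by (simp add: invariant_def proj_fun_def)

text \<open>\<open>V 1\<close> and the tail are complementary blocks of \<open>Q\<close>, and the
  first two terms of \<open>hybrid 1\<close> cancel.\<close>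

lemma hybrid_1: "hybrid 1 = rational_lanczos_approx f A b Q"
proof -
  have "join_cols (V 1) (tail 1) = Q"
    using join_col_range[of 0 "k + m" M Q] block_end[of 1] pos col_range_full[of Q M]
    by (simp add: run_1[simplified] blk_1[simplified] tail_def)
  moreover have "y 1 = proj_fun A (V 1) f b"
    using proj_fun_V[of 1] pos run_1 by simp
  moreover have "start_vec b (dim_col Q) = mat_adjoint Q *\<^sub>v b"
    using adjoint_col_range_start[of M] col_range_full[of Q M] by simp
  ultimately show ?thesis
    using invariant_dim[OF invariant_1]
    by (intro eq_vecI) (auto simp: hybrid_def rational_lanczos_approx_def proj_fun_def)
qed

lemma hybrid_s: "hybrid s = y s"
proof -
  have dim: "dim_row (V s) = n" using invariant[of s] pos by (intro invariant_dim) simp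
  have "join_cols (V s) (tail s) = V s" by (rule join_cols_empty) (simp_all add: tail_def dim)
  then show ?thesis using y_dim[of s] pos dim by (intro eq_vecI) (auto simp: hybrid_def)
qed

lemma w_eq:
  assumes "1 \<le> i" "i < s"
  shows "w i = - proj_fun A (V i * U i) f b"
proof -
  have inv: "invariant i" using invariant[of i] assms by simp
  note V = V_i[OF assms inv] and U = U_i[OF assms inv]
  have "proj_fun A (V i * U i) f b =
      V i *\<^sub>v (U i *\<^sub>v (mat_fun f (compress (U i) (S i)) *\<^sub>v (mat_adjoint (U i) *\<^sub>v v i)))"
    unfolding proj_fun_def adjoint_VU[OF assms inv b] v_i[OF assms inv, symmetric]
      compress_VU[OF assms inv, symmetric]
    by (rule assoc_mult_mat_vec[OF isometry_mat_carrier[OF V] isometry_mat_carrier[OF U]])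
      (use mat_fun_vec_carrier[OF VU_i[OF assms inv]] dim_VU[OF assms inv] in simp)
  then show ?thesis by (simp add: run_Suc(3)[OF assms])
qed

text \<open>Block \<open>Suc i\<close> only changes sides: \<open>V (Suc i)\<close> with its tail
  has the same columns as \<open>V i * U i\<close> with the old tail. The last term added to
  \<open>y (Suc i)\<close> cancels against the one subtracted in \<open>hybrid\<close>, and four
  projected functions remain.\<close>

lemma hybrid_diff:
  assumes "1 \<le> i" "i < s"
  shows "hybrid i - hybrid (Suc i) =
    proj_fun_diff (join_cols (V i) (tail i)) (V i) f b -
    proj_fun_diff (join_cols (V i * U i) (tail i)) (V i * U i) f b"
proof -
  have inv: "invariant i" "invariant (Suc i)" using invariant assms by simp_all
  have dims: "dim_row (V i) = n" "dim_row (V (Suc i)) = n" "dim_row (V i * U i) = n" "dim_vec (y i) = n"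
    using inv[THEN invariant_dim] isometry_mat_dim[OF VU_i[OF assms inv(1)]] y_dim[of i] assms by simp_all
  have "join_cols (V (Suc i)) (tail (Suc i)) = join_cols (V i * U i) (join_cols (blk (Suc i)) (tail (Suc i)))"
    unfolding run_Suc(4)[OF assms]
    by (rule join_cols_assoc) (use dims dim_blk[OF assms inv(1)] in \<open>simp_all add: tail_def\<close>)
  also have "join_cols (blk (Suc i)) (tail (Suc i)) = tail i"
    unfolding blk_Suc_i[OF assms inv(1)] tail_def
    by (rule join_col_range) (use block_end[of "Suc i"] assms in auto)
  finally have J: "join_cols (V (Suc i)) (tail (Suc i)) = join_cols (V i * U i) (tail i)" .
  have y: "y (Suc i) = y i + - proj_fun A (V i * U i) f b + proj_fun A (V (Suc i)) f b"
    using run_Suc(8)[OF assms] w_eq[OF assms] proj_fun_V[of "Suc i"] assms by simp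
  show ?thesis
    unfolding hybrid_def J y proj_fun_diff_def using dims by (intro eq_vecI) auto
qed

text \<open>The factor \<open>s - 1\<close> counts the compressions, one between consecutive values
  of \<open>hybrid\<close>.\<close>

lemma error_bound:
  assumes d: "d dvd pole_poly \<xi>s" "\<And>x. x \<in> field_of_values A \<Longrightarrow> poly d x \<noteq> 0"
    and p: "p = 0 \<or> degree p + degree (pole_poly \<xi>s) < degree d + k"
    and e: "e \<ge> 0" "\<And>x. x \<in> field_of_values A \<Longrightarrow> cmod (f x - poly p x / poly d x) \<le> e"
  shows "norm2 (rational_lanczos_approx f A b Q - y s) \<le> 4 * real (s - 1) * norm2 b * e"
proof -
  have step: "norm2 (hybrid i - hybrid (Suc i)) \<le> 4 * e * norm2 b" if i: "1 \<le> i" "i < s" for i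
  proof -
    have inv: "invariant i" using invariant i by simp
    have tail_col: "col (tail i) j = q (k + i * m + j)" if "j < dim_col (tail i)" for j
      using that unfolding tail_def by (subst col_col_range) simp_all
    show ?thesis
      unfolding hybrid_diff[OF i]
    proof (rule compression_step_bound[OF V_i[OF i inv] U_i[OF i inv] _ _ bt_carrier[OF i inv] b
          _ _ len_\<xi>s pos(1) cnj_\<xi>s _ U_range[OF i inv] field_of_values_nonempty d p e])
      show "isometry_mat n (tail i)" unfolding tail_def by (rule col_range_isometry) simp
      show "dim_col (tail i) > 0" using block_start[OF i(2)] by (simp add: tail_def)
      show "poles_admissible (compress (V i) A) \<xi>s" using adm_S[OF i] by (simp add: S_i[OF i inv])
      fix j assume j: "j < dim_col (tail i)"
      then have jM: "k + i * m + j < M" by (simp add: tail_def)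
      show "mat_adjoint (V i) *\<^sub>v col (tail i) j = 0\<^sub>v (dim_col (V i))"
        unfolding tail_col[OF j] by (rule V_q[OF i inv _ jM]) simp
      show "mat_adjoint (V i) *\<^sub>v (A *\<^sub>v col (tail i) j) = (if j = 0 then bt i else 0\<^sub>v (dim_col (V i)))"
        unfolding tail_col[OF j] using V_op_q[OF i inv _ jM] by (simp add: bt_i[OF i inv])
    qed
  qed
  have dim_hybrid: "hybrid i \<in> carrier_vec n" if "1 \<le> i" "i \<le> s" for i
    using invariant_dim[OF invariant[OF that]] by (intro carrier_vecI) (simp add: hybrid_def)
  have "norm2 (hybrid 1 - hybrid i) \<le> real (i - 1) * (4 * e * norm2 b)" if "1 \<le> i" "i \<le> s" for i
    using that
  proof (induction i rule: nat_induct_at_least)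
    case base
    have "hybrid 1 - hybrid 1 = 0\<^sub>v n" using dim_hybrid[of 1] pos by (intro eq_vecI) auto
    then show ?case using norm2_eq_0_iff[of "0\<^sub>v n" n] by simp
  next
    case (Suc i)
    have c: "hybrid 1 \<in> carrier_vec n" "hybrid i \<in> carrier_vec n" "hybrid (Suc i) \<in> carrier_vec n"
      using dim_hybrid Suc by simp_all
    have "hybrid 1 - hybrid (Suc i) = (hybrid 1 - hybrid i) + (hybrid i - hybrid (Suc i))"
      using c by (intro eq_vecI) auto
    then have "norm2 (hybrid 1 - hybrid (Suc i)) \<le> norm2 (hybrid 1 - hybrid i) + norm2 (hybrid i - hybrid (Suc i))"
      using norm2_add_le[of "hybrid 1 - hybrid i" n "hybrid i - hybrid (Suc i)"] c by simp
    also have "\<dots> \<le> real (i - 1) * (4 * e * norm2 b) + 4 * e * norm2 b"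
      using Suc step[of i] by simp
    also have "\<dots> = real (Suc i - 1) * (4 * e * norm2 b)"
      using Suc by (simp add: of_nat_diff algebra_simps)
    finally show ?case .
  qed
  from this[of s] show ?thesis using pos by (simp add: hybrid_1[simplified] hybrid_s mult_ac)
qed

end

text \<open>The bound is stated in the extended reals because inner poles in the field of values can
  make even the best error infinite.\<close>

theorem proposition4p2:
  fixes A Q :: "complex mat" and b :: "complex vec"
    and n k m s :: nat
    and \<theta>s \<xi>s :: "pole list"
    and f :: "complex \<Rightarrow> complex"
    and U V S :: "nat \<Rightarrow> complex mat"
    and v bt w y :: "nat \<Rightarrow> complex vec"
  assumes "A \<in> carrier_mat n n" and "hermitian A"
    and "b \<in> carrier_vec n" and "b \<noteq> 0\<^sub>v n"
    and "k > 0" and "m > 0" and "s > 0"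
    and "length \<theta>s = k + s * m" and "cnj_closed \<theta>s"
    and "\<theta>s ! 0 = None" and "\<forall>i\<in>{1..s - 1}. \<theta>s ! (k + i * m) = None"
    and "length \<xi>s = k" and "cnj_closed \<xi>s"
    and "f analytic_on field_of_values A"
    and "poles_admissible A \<theta>s"
    and "rational_lanczos_basis A b \<theta>s Q"
    and "rk_compressed_rational_lanczos f A b k m s \<xi>s Q U V S v bt w y"
    and "\<forall>i\<in>{1..<s}. poles_admissible (S i) \<xi>s"
  shows "\<exists>r. is_arg_min (\<lambda>r. sup_norm_on (field_of_values A) (\<lambda>x. f x - r x))
              (\<lambda>r. r \<in> rational_functions k \<xi>s) r \<and>
           ereal (norm2 (rational_lanczos_approx f A b Q - y s))
             \<le> ereal (4 * real (s - 1) * norm2 b) *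
                 sup_norm_on (field_of_values A) (\<lambda>x. f x - r x)"
proof -
  interpret rk_compressed_run A n b Q \<theta>s k m s f \<xi>s U V S v bt w y
    using assms by unfold_locales auto
  let ?X = "field_of_values A"
  obtain r where min: "is_arg_min (\<lambda>r. sup_norm_on ?X (\<lambda>x. f x - r x)) (\<lambda>r. r \<in> rational_functions k \<xi>s) r"
    and r: "sup_norm_on ?X (\<lambda>x. f x - r x) = \<infinity> \<or>
      (\<exists>p d e. e \<ge> 0 \<and> sup_norm_on ?X (\<lambda>x. f x - r x) = ereal e \<and>
        d dvd pole_poly \<xi>s \<and> (\<forall>x\<in>?X. poly d x \<noteq> 0) \<and>
        (p = 0 \<or> degree p + degree (pole_poly \<xi>s) < degree d + k) \<and>
        (\<forall>x\<in>?X. cmod (f x - poly p x / poly d x) \<le> e))"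
    by (rule best_rational_approximation_exists[OF assms(14) field_of_values_nonempty pos(1), of \<xi>s])
      (rule that)
  have "ereal (norm2 (rational_lanczos_approx f A b Q - y s)) \<le>
      ereal (4 * real (s - 1) * norm2 b) * sup_norm_on ?X (\<lambda>x. f x - r x)"
  proof (cases "sup_norm_on ?X (\<lambda>x. f x - r x) = \<infinity>")
    case False
    then obtain p d e where e: "e \<ge> 0" "sup_norm_on ?X (\<lambda>x. f x - r x) = ereal e"
      and p: "d dvd pole_poly \<xi>s" "\<forall>x\<in>?X. poly d x \<noteq> 0"
        "p = 0 \<or> degree p + degree (pole_poly \<xi>s) < degree d + k"
        "\<forall>x\<in>?X. cmod (f x - poly p x / poly d x) \<le> e"
      using r by blast
    have "norm2 (rational_lanczos_approx f A b Q - y s) \<le> 4 * real (s - 1) * norm2 b * e"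
      by (rule error_bound[OF p(1) bspec[OF p(2)] p(3) e(1) bspec[OF p(4)]])
    then show ?thesis unfolding e(2) by (simp only: times_ereal.simps ereal_less_eq)
  next
    \<comment> \<open>In the extended reals 0 * \<infinity> = 0, so for \<open>s = 1\<close> the
      error itself has to vanish; for larger \<open>s\<close> the right-hand side is
      infinite.\<close>
    case True
    define c where "c = 4 * real (s - 1) * norm2 b"
    define N where "N = norm2 (rational_lanczos_approx f A b Q - y s)"
    have "N = 0" if "s = 1"
    proof -
      have "rational_lanczos_approx f A b Q = y s" using hybrid_1 hybrid_s unfolding that by metis
      moreover have "y s - y s = 0\<^sub>v n"
      proof (rule minus_cancel_vec)
        show "y s \<in> carrier_vec n" using pos(3) by (intro y_dim) simp_all
      qed
      ultimately show ?thesis using norm2_eq_0_iff[of "0\<^sub>v n" n] unfolding N_def by simp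
    qed
    moreover have "c > 0" if "s \<noteq> 1"
    proof -
      have "norm2 b \<noteq> 0" using norm2_eq_0_iff[OF b] b0 by blast
      then have "norm2 b > 0" using norm2_nonneg[of b] by linarith
      moreover have "real (s - 1) > 0" using that pos(3) by simp
      ultimately show ?thesis unfolding c_def by (intro mult_pos_pos) simp_all
    qed
    moreover have "c = 0" if "s = 1" unfolding c_def that by simp
    ultimately have "ereal N \<le> ereal c * \<infinity>"
      by (cases "s = 1") (simp_all flip: zero_ereal_def)
    then show ?thesis unfolding True c_def N_def .
  qed
  then show ?thesis using min by blast
qed

end
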